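(* Let $\mu>0$ and let $\mathbf{P}_1,\mathbf{P}_2\in\mathcal{RH}_\infty$ have the state-space realization $$\mathbf{P}_1(z)=C(zI-A)^{-1}B_1+D_1,\qquad \mathbf{P}_2(z)=C(zI-A)^{-1}B_2+D_2.$$ There exists $\mathbf{F}\in\mathcal{RH}_\infty$ such that $$\|\mathbf{P}_1(z)\mathbf{F}(z)-\mathbf{P}_2(z)\|_\infty<\mu$$ if and only if there exist symmetric matrices $X,Z$ and matrices $Q,F,L,R$ of compatible dimensions such that $$\begin{bmatrix} X & Z & AX+B_1L & AZ+B_1L & B_1R-B_2 & 0\\ \star & Z & Q & Q & F & 0\\ \star & \star & X & Z & 0 & XC^{\mathsf T}+L^{\mathsf T}D_1^{\mathsf T}\\ \star & \star & \star & Z & 0 & ZC^{\mathsf T}+L^{\mathsf T}D_1^{\mathsf T}\\ \star & \star & \star & \star & I & R^{\mathsf T}D_1^{\mathsf T}-D_2^{\mathsf T}\\ \star & \star & \star & \star & \star & \mu^2 I \end{bmatrix}\succ 0 .$$ If this matrix inequality holds, a state-space realization of such a filter $\mathbf{F}(z)=\hat C(zI-\hat A)^{-1}\hat B+\hat D$ is $$\begin{bmatrix}\hat A&\hat B\\\hat C&\hat D\end{bmatrix}=\begin{bmatrix}U^{\mathsf T}Z^{-1}&0\\0&I\end{bmatrix}\begin{bmatrix}Q&F\\L&R\end{bmatrix}\begin{bmatrix}U^{-1}&0\\0&I\end{bmatrix}^{\mathsf T},$$ where $U$ is an arbitrary non-singular matrix.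
   Context: $\mathcal{RH}_\infty$ denotes the set of real-rational proper stable transfer matrices in discrete time (all poles in the open unit disc), of whatever dimensions are compatible; $\|\cdot\|_\infty$ is the $\mathcal{H}_\infty$ norm, $\|\mathbf{T}\|_\infty=\sup_{|z|=1}\sigma_{\max}(\mathbf{T}(z))$. All matrices are real. In the block matrix, $\star$ denotes the blocks determined by symmetry, and $\succ 0$ means symmetric positive definite. If $A\in\mathbb{R}^{n\times n}$, $\mathbf{P}_1$ is $p\times m$ and $\mathbf{P}_2$ is $p\times r$, then $\mathbf{F}(z)$ is $m\times r$, and the compatible dimensions are $X,Z,Q,U\in\mathbb{R}^{n\times n}$, $F\in\mathbb{R}^{n\times r}$, $L\in\mathbb{R}^{m\times n}$, $R\in\mathbb{R}^{m\times r}$. The filter $\mathbf{F}$ (a transfer matrix) and the matrix variable $F$ are different objects.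
   Formalization: The matrix A of the given realization is additionally assumed to have all eigenvalues in the open unit disc; otherwise the claim fails, e.g. n=1, A=2, B1=B2=0, C=0, D1=D2=0, where F=0 works but the matrix inequality is infeasible. *)

theory Defs
  imports
    "HOL-Analysis.Analysis"
    "HOL-Computational_Algebra.Polynomial_Factorial"
    "HOL-Computational_Algebra.Field_as_Ring"
begin

section \<open>Real-rational transfer matrices\<close>

text \<open>
  A real-rational transfer function is an element of the field of fractions of the real polynomials
  in z, and a transfer matrix is a matrix over that field. The function \<^const>\<open>quot_of_fract\<close>
  returns numerator and denominator in lowest terms, so that the poles below are the genuine ones.
\<close>

type_synonym ratfun = "real poly fract"

definition rnum :: "ratfun \<Rightarrow> real poly" where
  "rnum f = fst (quot_of_fract f)"

definition rden :: "ratfun \<Rightarrow> real poly" where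
  "rden f = snd (quot_of_fract f)"

definition proper :: "ratfun \<Rightarrow> bool" where
  "proper f \<longleftrightarrow> degree (rnum f) \<le> degree (rden f)"

definition poles :: "ratfun \<Rightarrow> complex set" where
  "poles f = {z. poly (map_poly complex_of_real (rden f)) z = 0}"

definition RH_inf :: "(ratfun^'c^'r) set" where
  "RH_inf = {G. \<forall>i j. proper (G $ i $ j) \<and> poles (G $ i $ j) \<subseteq> ball 0 1}"

definition rat_eval :: "ratfun \<Rightarrow> complex \<Rightarrow> complex" where
  "rat_eval f z = poly (map_poly complex_of_real (rnum f)) z / poly (map_poly complex_of_real (rden f)) z"

definition tm_eval :: "ratfun^'c^'r \<Rightarrow> complex \<Rightarrow> complex^'c^'r" where
  "tm_eval G z = map_matrix (\<lambda>f. rat_eval f z) G"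

definition conj_transpose :: "complex^'c^'r \<Rightarrow> complex^'r^'c" where
  "conj_transpose M = map_matrix cnj (transpose M)"

text \<open>
  The squares of the elements of the following set are the eigenvalues of the square matrix of
  size \<open>CARD('c)\<close> on the left of the equation. For a wide matrix this includes additional zeros,
  which do not affect the maximum.
\<close>

definition singular_values :: "complex^'c^'r \<Rightarrow> real set" where
  "singular_values M =
     {s. 0 \<le> s \<and> (\<exists>v. v \<noteq> 0 \<and>
        (conj_transpose M ** M) *v v = complex_of_real (s\<^sup>2) *s v)}"

text \<open>The set of singular values is finite and nonempty, so the supremum is the maximum.\<close>

definition sigma_max :: "complex^'c^'r \<Rightarrow> real" where
  "sigma_max M = Sup (singular_values M)"

text \<open>
  This is meaningful for matrices without poles on the unit circle, in particular on
  \<^const>\<open>RH_inf\<close>, where the supremum ranges over a bounded set.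
\<close>

definition hinf_norm :: "ratfun^'c^'r \<Rightarrow> real" where
  "hinf_norm G = (SUP z\<in>sphere 0 1. sigma_max (tm_eval G z))"


section \<open>State-space realizations\<close>

definition const_tm :: "real^'c^'r \<Rightarrow> ratfun^'c^'r" where
  "const_tm M = map_matrix (\<lambda>a. to_fract [:a:]) M"

definition zvar :: ratfun where
  "zvar = to_fract [:0, 1:]"

text \<open>
  The inverse is taken over the field of rational functions, where zI - A is always invertible.
\<close>

definition transfer_matrix ::
  "real^'n^'n \<Rightarrow> real^'m^'n \<Rightarrow> real^'n^'p \<Rightarrow> real^'m^'p \<Rightarrow> ratfun^'m^'p" where
  "transfer_matrix A B C D =
     const_tm C ** matrix_inv (mat zvar - const_tm A) ** const_tm B + const_tm D"

definition schur_stable :: "real^'n^'n \<Rightarrow> bool" where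
  "schur_stable A \<longleftrightarrow>
     (\<forall>z v. v \<noteq> 0 \<and> map_matrix complex_of_real A *v v = z *s v \<longrightarrow> cmod z < 1)"

text \<open>
  Realizations of elements of \<^const>\<open>RH_inf\<close> are internally stable: cancelled unstable modes are
  excluded, since for an unstable A the matrix inequality below is never feasible, even if the
  transfer matrices themselves are stable. Minimality is not required.
\<close>

definition stable_realization ::
  "real^'n^'n \<Rightarrow> real^'m^'n \<Rightarrow> real^'n^'p \<Rightarrow> real^'m^'p \<Rightarrow> ratfun^'m^'p \<Rightarrow> bool" where
  "stable_realization A B C D G \<longleftrightarrow> schur_stable A \<and> G = transfer_matrix A B C D"


section \<open>Block matrices and the matrix inequality\<close>

definition hcat :: "'a^'c^'r \<Rightarrow> 'a^'d^'r \<Rightarrow> 'a^('c + 'd)^'r" (infixr "|||" 55) where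
  "M ||| N = (\<chi> i j. case j of Inl k \<Rightarrow> M $ i $ k | Inr k \<Rightarrow> N $ i $ k)"

definition vcat :: "'a^'c^'r \<Rightarrow> 'a^'c^'s \<Rightarrow> 'a^'c^('r + 's)" (infixr "===" 54) where
  "M === N = (\<chi> i. case i of Inl k \<Rightarrow> M $ k | Inr k \<Rightarrow> N $ k)"

definition symmetric_matrix :: "real^'n^'n \<Rightarrow> bool" where
  "symmetric_matrix M \<longleftrightarrow> transpose M = M"

definition pos_def :: "real^'n^'n \<Rightarrow> bool" where
  "pos_def M \<longleftrightarrow> symmetric_matrix M \<and> (\<forall>x. x \<noteq> 0 \<longrightarrow> x \<bullet> (M *v x) > 0)"

definition filter_lmi ::
  "real^'n^'n \<Rightarrow> real^'m^'n \<Rightarrow> real^'r^'n \<Rightarrow> real^'n^'p \<Rightarrow> real^'m^'p \<Rightarrow> real^'r^'p \<Rightarrow> real \<Rightarrow>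
   real^'n^'n \<Rightarrow> real^'n^'n \<Rightarrow> real^'n^'n \<Rightarrow> real^'r^'n \<Rightarrow> real^'n^'m \<Rightarrow> real^'r^'m \<Rightarrow>
   real^('n + 'n + 'n + 'n + 'r + 'p)^('n + 'n + 'n + 'n + 'r + 'p)" where
  "filter_lmi A B1 B2 C D1 D2 \<mu> X Z Q F L R =
     (let AXL = A ** X + B1 ** L;
          AZL = A ** Z + B1 ** L;
          BR = B1 ** R - B2;
          XCL = X ** transpose C + transpose L ** transpose D1;
          ZCL = Z ** transpose C + transpose L ** transpose D1;
          DR = transpose R ** transpose D1 - transpose D2
      in
        (X             ||| Z             ||| AXL           ||| AZL           ||| BR           ||| 0)
    === (transpose Z   ||| Z             ||| Q             ||| Q             ||| F            ||| 0)
    === (transpose AXL ||| transpose Q   ||| X             ||| Z             ||| 0            ||| XCL)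
    === (transpose AZL ||| transpose Q   ||| transpose Z   ||| Z             ||| 0            ||| ZCL)
    === (transpose BR  ||| transpose F   ||| 0             ||| 0             ||| mat 1        ||| DR)
    === (0             ||| 0             ||| transpose XCL ||| transpose ZCL ||| transpose DR ||| mat (\<mu>\<^sup>2)))"

end

theory Submission
  imports Defs "HOL-Computational_Algebra.Fundamental_Theorem_Algebra"
begin

text \<open>
  Put \<open>K = L Z\<^sup>-\<^sup>1\<close> and \<open>Ah = Q Z\<^sup>-\<^sup>1\<close>, and consider the filter with state equation
  \<open>\<xi>\<^sup>+ = Ah \<xi> + F w\<close> and output \<open>u = K \<xi> + R w\<close>, driving the plant \<open>x\<^sup>+ = A x + B1 u - B2 w\<close>,
  \<open>y = C x + D1 u - D2 w\<close>. The matrix inequality is the strict bounded real inequality of the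
  interconnection, for the storage matrix with blocks \<open>X, Z, Z, Z\<close>, written as a Schur complement. In
  the coordinates \<open>x - \<xi>\<close> and \<open>\<xi>\<close> this storage matrix is the block diagonal of \<open>X - Z\<close> and \<open>Z\<close>, and
  completing squares (\<open>filter_lmi_completed_squares\<close>) turns the inequality into positivity of
  \<open>X - Z\<close>, of \<open>Z\<close> and of a form \<open>dissipation\<close> in costates \<open>a\<close>, \<open>b\<close> of plant and filter and a direction
  \<open>f\<close> in the output space.

  Sufficiency. For \<open>z\<close> on the unit circle, let the costates solve the adjoint equations of plant and
  filter driven by \<open>f\<close>. As \<open>z\<close> has modulus one, the storage terms of \<open>dissipation\<close> cancel, and what
  remains says that the adjoint of the closed loop at \<open>z\<close> shortens \<open>f\<close> by a factor below \<open>\<mu>\<close>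
  (\<open>frequency_response_bound\<close>). For \<open>a = 0\<close> and \<open>f = 0\<close> positivity is a Stein inequality for \<open>Ah\<close>,
  whence the filter is stable. The matrix \<open>U\<close> only changes the coordinates of the filter state.

  Necessity. The given filter may have any order, while the inequality speaks of filters of order
  \<open>n\<close>. Two ideas bridge the gap.

  First, a filter that knows \<open>w\<close> can simulate the plant: with \<open>Ah = A + B1 K\<close> and \<open>F = B1 R - B2\<close> the
  error \<open>x - \<xi>\<close> obeys \<open>e\<^sup>+ = A e\<close>, so that \<open>X - Z\<close> can be a small multiple of a solution of a Stein
  inequality for \<open>A\<close>, and all that is left is a strict bounded real inequality for the state feedback
  \<open>u = K x + R w\<close> (\<open>lmi_feasible_if_full_information\<close>, after the dualization in
  \<open>dual_dissipation\<close>).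

  Second, such a feedback exists. Consider the game in which, at every time, \<open>w\<close> is revealed before
  \<open>u\<close> is chosen, with stage cost the square of the norm of \<open>y\<close>, plus small multiples of those of \<open>x\<close>
  and \<open>u\<close>, minus a multiple slightly below \<open>\<mu>\<^sup>2\<close> of that of \<open>w\<close>. The finite-horizon values are
  quadratic forms, since partial extrema of coercive forms are attained at linear functions of the
  other variables; they increase with the horizon; and they are bounded, because the given filter is
  one admissible strategy (\<open>bounded_game_value\<close>). Two consecutive values are therefore almost equal at
  some horizon, and there the linear minimizer is the feedback and the value is its storage function.

  The bound on the cost of the filter strategy is where the norm enters (\<open>fir_cost_bound\<close>). The filter
  is first replaced by a finite impulse response, a polynomial in \<open>1/z\<close>, that is uniformly close on the
  circle; the order of the filter, which no type of state vectors fixes in advance, then never appears.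
  A finite-horizon trajectory is compared with the frequency response by the discrete Fourier
  transform over a long period; the defect from periodicity is harmless because the powers of a stable
  matrix tend to zero.
\<close>

section \<open>Inverse matrices\<close>

lemma
  assumes "invertible M"
  shows matrix_inv_left: "matrix_inv M ** M = mat 1"
    and matrix_inv_right: "M ** matrix_inv M = mat 1"
  using someI_ex[OF assms[unfolded invertible_def]] unfolding matrix_inv_def by auto

lemma matrix_inv_unique:
  fixes M :: "'a::field^'n^'n"
  assumes "M ** R = mat 1"
  shows "matrix_inv M = R"
proof -
  have "invertible M" using assms by (auto simp: invertible_right_inverse)
  then have "matrix_inv M ** (M ** R) = R" by (simp add: matrix_mul_assoc matrix_inv_left)
  then show ?thesis by (simp add: assms)
qed

section \<open>Places of the field of rational functions\<close>

text \<open>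
  A place of the field of rational functions: \<open>V f v\<close> says that \<open>f\<close> is finite at the place and has
  the value \<open>v\<close>. Evaluation at a complex point and evaluation at infinity are both places, so one
  argument about inverse matrices gives the value of a resolvent at a point and its properness.
\<close>

definition place :: "(ratfun \<Rightarrow> 'k::field \<Rightarrow> bool) \<Rightarrow> bool" where
  "place V \<longleftrightarrow>
     V 0 0 \<and> V 1 1 \<and> (\<forall>v. V 0 v \<longrightarrow> v = 0) \<and>
     (\<forall>f g v w. V f v \<longrightarrow> V g w \<longrightarrow> V (f + g) (v + w) \<and> V (f * g) (v * w)) \<and>
     (\<forall>f v. V f v \<longrightarrow> V (- f) (- v)) \<and>
     (\<forall>f v. V f v \<longrightarrow> v \<noteq> 0 \<longrightarrow> V (inverse f) (inverse v))"

definition mat_rel :: "('a \<Rightarrow> 'b \<Rightarrow> bool) \<Rightarrow> 'a^'c^'r \<Rightarrow> 'b^'c^'r \<Rightarrow> bool" where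
  "mat_rel V G M \<longleftrightarrow> (\<forall>i j. V (G $ i $ j) (M $ i $ j))"

context
  fixes V :: "ratfun \<Rightarrow> 'k::field \<Rightarrow> bool"
  assumes V: "place V"
begin

lemma place_zero: "V 0 0" and place_one: "V 1 1"
  and place_zero_unique: "V 0 v \<Longrightarrow> v = 0"
  and place_add: "V f v \<Longrightarrow> V g w \<Longrightarrow> V (f + g) (v + w)"
  and place_mult: "V f v \<Longrightarrow> V g w \<Longrightarrow> V (f * g) (v * w)"
  and place_minus: "V f v \<Longrightarrow> V (- f) (- v)"
  and place_inverse: "V f v \<Longrightarrow> v \<noteq> 0 \<Longrightarrow> V (inverse f) (inverse v)"
  using V unfolding place_def by blast+

lemma place_diff: "V f v \<Longrightarrow> V g w \<Longrightarrow> V (f - g) (v - w)"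
  using place_add[OF _ place_minus, of f v g w] by simp

lemma place_unique: "V f v \<Longrightarrow> V f w \<Longrightarrow> v = w"
  using place_zero_unique[of "v - w"] place_diff[of f v f w] by simp

lemma place_divide: "V f v \<Longrightarrow> V g w \<Longrightarrow> w \<noteq> 0 \<Longrightarrow> V (f / g) (v / w)"
  using place_mult[OF _ place_inverse, of f v g w] by (simp add: divide_inverse)

lemma place_sum: "(\<And>i. i \<in> I \<Longrightarrow> V (f i) (v i)) \<Longrightarrow> V (\<Sum>i\<in>I. f i) (\<Sum>i\<in>I. v i)"
  by (induction I rule: infinite_finite_induct) (auto intro: place_zero place_add)

lemma place_prod: "(\<And>i. i \<in> I \<Longrightarrow> V (f i) (v i)) \<Longrightarrow> V (\<Prod>i\<in>I. f i) (\<Prod>i\<in>I. v i)"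
  by (induction I rule: infinite_finite_induct) (auto intro: place_one place_mult)

lemma place_sign: "V (of_int (sign p)) (of_int (sign p))"
  by (auto simp: sign_def intro: place_one place_minus)

lemma place_matrix_mult: "mat_rel V G M \<Longrightarrow> mat_rel V H N \<Longrightarrow> mat_rel V (G ** H) (M ** N)"
  unfolding mat_rel_def matrix_matrix_mult_def by (auto intro!: place_sum place_mult)

lemma place_matrix_add: "mat_rel V G M \<Longrightarrow> mat_rel V H N \<Longrightarrow> mat_rel V (G + H) (M + N)"
  unfolding mat_rel_def by (auto intro!: place_add)

lemma place_matrix_diff: "mat_rel V G M \<Longrightarrow> mat_rel V H N \<Longrightarrow> mat_rel V (G - H) (M - N)"
  unfolding mat_rel_def by (auto intro!: place_diff)

lemma place_mat: "V f v \<Longrightarrow> mat_rel V (mat f) (mat v)"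
  unfolding mat_rel_def mat_def by (auto intro: place_zero)

lemma place_det: "mat_rel V G M \<Longrightarrow> V (det G) (det M)"
  unfolding det_def mat_rel_def by (intro place_sum place_mult place_sign place_prod) auto

lemma place_invertible:
  fixes G :: "ratfun^'n^'n"
  assumes "mat_rel V G M" "invertible M"
  shows "invertible G"
  using place_det[OF assms(1)] assms(2) place_zero_unique
  by (auto simp: invertible_det_nz)

text \<open>
  By Cramer's rule the entries of the inverse are quotients of determinants, and the determinant in
  the denominator does not vanish at the place.
\<close>

lemma place_matrix_inv:
  fixes G :: "ratfun^'n^'n"
  assumes GM: "mat_rel V G M" and M: "invertible M"
  shows "mat_rel V (matrix_inv G) (matrix_inv M)"
proof -
  have G: "invertible G" using place_invertible[OF assms] .
  have dG: "det G \<noteq> 0" and dM: "det M \<noteq> 0" using G M by (auto simp: invertible_det_nz)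
  have entry: "\<exists>v. V (matrix_inv G $ i $ j) v" for i j
  proof -
    have "G ** matrix_inv G = mat 1" using G by (simp add: matrix_inv_right)
    then have "G *v column j (matrix_inv G) = column j (mat 1)"
      by (simp add: vec_eq_iff column_def matrix_matrix_mult_def matrix_vector_mult_def)
    then have "column j (matrix_inv G) =
        (\<chi> k. det (\<chi> i l. if l = k then column j (mat 1) $ i else G $ i $ l) / det G)"
      using cramer[OF dG] by blast
    then have e: "matrix_inv G $ i $ j =
        det (\<chi> k l. if l = i then column j (mat 1) $ k else G $ k $ l) / det G"
      by (simp add: vec_eq_iff column_def)
    have "mat_rel V (\<chi> k l. if l = i then column j (mat 1) $ k else G $ k $ l)
        (\<chi> k l. if l = i then column j (mat 1) $ k else M $ k $ l)"
      using GM unfolding mat_rel_def by (auto simp: column_def mat_def intro: place_one place_zero)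
    from place_divide[OF place_det[OF this] place_det[OF GM] dM] show ?thesis unfolding e by blast
  qed
  define R where "R = (\<chi> i j. SOME v. V (matrix_inv G $ i $ j) v)"
  have R: "mat_rel V (matrix_inv G) R"
    unfolding mat_rel_def R_def using someI_ex[OF entry] by simp
  have "mat_rel V (mat 1) (M ** R)"
    using place_matrix_mult[OF GM R] G by (simp add: matrix_inv_right)
  then have "M ** R = mat 1"
    using place_mat[OF place_one] place_unique unfolding mat_rel_def by (simp add: vec_eq_iff) blast
  then have "matrix_inv M = R" by (rule matrix_inv_unique)
  with R show ?thesis by simp
qed

end

section \<open>Evaluation of rational functions at complex points\<close>

abbreviation cev :: "complex \<Rightarrow> real poly \<Rightarrow> complex" where
  "cev z p \<equiv> poly (map_poly complex_of_real p) z"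

lemma cev_pCons: "cev z (pCons a p) = of_real a + z * cev z p"
  by (cases "a = 0 \<and> p = 0") (auto simp: map_poly_pCons)

lemma cev_add: "cev z (p + q) = cev z p + cev z q"
  by (induction p q rule: poly_induct2) (auto simp: cev_pCons algebra_simps)

lemma cev_smult: "cev z (smult a q) = of_real a * cev z q"
  by (induction q) (auto simp: cev_pCons algebra_simps)

lemma cev_mult: "cev z (p * q) = cev z p * cev z q"
  by (induction p) (auto simp: cev_pCons cev_add cev_smult algebra_simps)

lemma cev_minus: "cev z (- p) = - cev z p"
  using cev_smult[where z = z and a = "-1" and q = p] by simp

text \<open>
  Any representation of \<open>f\<close> as a fraction whose denominator does not vanish at \<open>z\<close> may be used, which
  makes the closure under the field operations immediate; fractions in lowest terms return in
  \<open>rat_at_rat_eval\<close>.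
\<close>

definition rat_at :: "complex \<Rightarrow> ratfun \<Rightarrow> complex \<Rightarrow> bool" where
  "rat_at z f v \<longleftrightarrow>
     (\<exists>p q. f * to_fract q = to_fract p \<and> cev z q \<noteq> 0 \<and> v * cev z q = cev z p)"

lemma cev_1 [simp]: "cev z 1 = 1" by (simp add: one_pCons cev_pCons del: One_nat_def)

lemma place_rat_at: "place (rat_at z)"
  unfolding place_def
proof (intro conjI allI impI)
  show "rat_at z 0 0" unfolding rat_at_def by (rule exI[of _ 0], rule exI[of _ 1]) simp
  show "rat_at z 1 1" unfolding rat_at_def by (rule exI[of _ 1], rule exI[of _ 1]) simp
  show "v = 0" if "rat_at z 0 v" for v using that unfolding rat_at_def by auto
  show "rat_at z (- f) (- v)" if "rat_at z f v" for f v
  proof -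
    from that obtain p q where "f * to_fract q = to_fract p" "cev z q \<noteq> 0" "v * cev z q = cev z p"
      unfolding rat_at_def by blast
    then show ?thesis
      unfolding rat_at_def by (intro exI[of _ "- p"] exI[of _ q]) (simp add: cev_minus)
  qed
  fix f g v w assume "rat_at z f v" "rat_at z g w"
  then obtain p q r s where f: "f * to_fract q = to_fract p" "cev z q \<noteq> 0" "v * cev z q = cev z p"
    and g: "g * to_fract s = to_fract r" "cev z s \<noteq> 0" "w * cev z s = cev z r"
    unfolding rat_at_def by blast
  have "(f + g) * to_fract (q * s) = (f * to_fract q) * to_fract s + (g * to_fract s) * to_fract q"
    "(f * g) * to_fract (q * s) = (f * to_fract q) * (g * to_fract s)"
    "(v + w) * cev z (q * s) = (v * cev z q) * cev z s + (w * cev z s) * cev z q"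
    "(v * w) * cev z (q * s) = (v * cev z q) * (w * cev z s)"
    by (simp_all add: cev_mult algebra_simps)
  then have "(f + g) * to_fract (q * s) = to_fract (p * s + r * q)"
    "(f * g) * to_fract (q * s) = to_fract (p * r)"
    "(v + w) * cev z (q * s) = cev z (p * s + r * q)"
    "(v * w) * cev z (q * s) = cev z (p * r)"
    unfolding f(1,3) g(1,3) by (simp_all add: cev_mult cev_add)
  moreover have "cev z (q * s) \<noteq> 0" using f(2) g(2) by (simp add: cev_mult)
  ultimately show "rat_at z (f + g) (v + w)" "rat_at z (f * g) (v * w)"
    unfolding rat_at_def by blast+
next
  fix f v assume "rat_at z f v" "v \<noteq> 0"
  then obtain p q where f: "f * to_fract q = to_fract p" "cev z q \<noteq> 0" "v * cev z q = cev z p"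
    unfolding rat_at_def by blast
  then have p: "cev z p \<noteq> 0" using \<open>v \<noteq> 0\<close> by auto
  have "f \<noteq> 0"
  proof
    assume "f = 0"
    then have "to_fract p = 0" using f(1) by simp
    then show False using p by simp
  qed
  then have "inverse f * to_fract p = to_fract q" unfolding f(1)[symmetric] by simp
  moreover have "inverse v * cev z p = cev z q" using \<open>v \<noteq> 0\<close> unfolding f(3)[symmetric] by simp
  ultimately show "rat_at z (inverse f) (inverse v)" using p unfolding rat_at_def by blast
qed

lemma rat_fraction: "f * to_fract (rden f) = to_fract (rnum f)"
  and rden_nonzero: "rden f \<noteq> 0"
  and rat_coprime: "coprime (rnum f) (rden f)"
proof -
  have n: "quot_of_fract f \<in> normalized_fracts" by simp
  then show "rden f \<noteq> 0" "coprime (rnum f) (rden f)"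
    unfolding rden_def rnum_def by (auto simp: normalized_fracts_def)
  then show "f * to_fract (rden f) = to_fract (rnum f)"
  proof -
    have "Fract (rnum f) (rden f) = f" unfolding rden_def rnum_def by simp
    then show ?thesis using \<open>rden f \<noteq> 0\<close> by (simp add: Fract_conv_to_fract divide_eq_eq)
  qed
qed

lemma rden_dvd:
  assumes "f * to_fract q = to_fract p"
  shows "rnum f * q = p * rden f" "rden f dvd q"
proof -
  have "to_fract (rnum f * q) = (f * to_fract q) * to_fract (rden f)"
    by (simp add: rat_fraction[symmetric])
  then have "to_fract (rnum f * q) = to_fract (p * rden f)" by (simp add: assms)
  then show e: "rnum f * q = p * rden f" by (simp only: to_fract_eq_iff)
  then show "rden f dvd q"
    using rat_coprime[of f] by (metis coprime_commute coprime_dvd_mult_right_iff dvd_triv_right)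
qed

lemma rat_at_rat_eval:
  assumes "rat_at z f v"
  shows "cev z (rden f) \<noteq> 0" "rat_eval f z = v"
proof -
  obtain p q where f: "f * to_fract q = to_fract p" "cev z q \<noteq> 0" "v * cev z q = cev z p"
    using assms unfolding rat_at_def by blast
  show d: "cev z (rden f) \<noteq> 0"
    using rden_dvd(2)[OF f(1)] f(2) by (auto simp: dvd_def cev_mult)
  have "cev z (rnum f) * cev z q = cev z p * cev z (rden f)"
    using arg_cong[OF rden_dvd(1)[OF f(1)], of "cev z"] by (simp add: cev_mult)
  then have "cev z (rnum f) * cev z q = (v * cev z (rden f)) * cev z q"
    unfolding f(3)[symmetric] by (simp add: ac_simps)
  then show "rat_eval f z = v" using d f(2) unfolding rat_eval_def by simp
qed

lemma RH_inf_rat_at: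
  assumes "G \<in> RH_inf" "1 \<le> cmod z"
  shows "mat_rel (rat_at z) G (tm_eval G z)"
proof -
  have "rat_at z (G $ i $ j) (rat_eval (G $ i $ j) z)" for i j
  proof -
    have "poles (G $ i $ j) \<subseteq> ball 0 1" using assms by (simp add: RH_inf_def)
    then have "z \<notin> poles (G $ i $ j)" using assms(2) by force
    then have "cev z (rden (G $ i $ j)) \<noteq> 0" by (simp add: poles_def)
    then show ?thesis unfolding rat_at_def rat_eval_def using rat_fraction by force
  qed
  then show ?thesis unfolding mat_rel_def tm_eval_def by simp
qed

lemma mat_rel_tm_eval: "mat_rel (rat_at z) G M \<Longrightarrow> tm_eval G z = M"
  unfolding mat_rel_def tm_eval_def by (simp add: vec_eq_iff rat_at_rat_eval(2))

abbreviation cmat :: "real^'c^'r \<Rightarrow> complex^'c^'r" where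
  "cmat A \<equiv> map_matrix complex_of_real A"

lemma rat_at_const: "mat_rel (rat_at z) (const_tm A) (cmat A)"
  unfolding mat_rel_def const_tm_def rat_at_def
proof (intro allI)
  fix i j
  show "\<exists>p q. map_matrix (\<lambda>a. to_fract [:a:]) A $ i $ j * to_fract q = to_fract p \<and>
      cev z q \<noteq> 0 \<and> cmat A $ i $ j * cev z q = cev z p"
    by (intro exI[of _ "[:A $ i $ j:]"] exI[of _ 1]) (simp add: cev_pCons)
qed

lemma rat_at_zvar: "rat_at z zvar z"
  unfolding zvar_def rat_at_def by (intro exI[of _ "[:0,1:]"] exI[of _ 1]) (simp add: cev_pCons)

lemma rat_at_transfer_matrix:
  assumes "invertible (mat z - cmat A)"
  shows "mat_rel (rat_at z) (transfer_matrix A B C D)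
    (cmat C ** matrix_inv (mat z - cmat A) ** cmat B + cmat D)"
proof -
  note V = place_rat_at[of z]
  have "mat_rel (rat_at z) (mat zvar - const_tm A) (mat z - cmat A)"
    by (rule place_matrix_diff[OF V place_mat[OF V rat_at_zvar] rat_at_const])
  from place_matrix_inv[OF V this assms] show ?thesis
    unfolding transfer_matrix_def
    using place_matrix_add[OF V place_matrix_mult[OF V place_matrix_mult[OF V rat_at_const]
        rat_at_const] rat_at_const] by blast
qed

section \<open>Evaluation at infinity, and stable realizations\<close>

text \<open>
  The value at infinity is the quotient of the coefficients at the degree of the denominator. Here
  \<open>rat_at_infinity f v\<close> forces \<open>f\<close> to be proper.
\<close>

definition rat_at_infinity :: "ratfun \<Rightarrow> real \<Rightarrow> bool" where
  "rat_at_infinity f v \<longleftrightarrow>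
     (\<exists>p q. f * to_fract q = to_fract p \<and> q \<noteq> 0 \<and> degree p \<le> degree q \<and>
        v * lead_coeff q = coeff p (degree q))"

lemma coeff_mult_top:
  assumes "degree p \<le> a" "degree q \<le> b"
  shows "coeff (p * q) (a + b) = coeff p a * coeff q b"
proof -
  have "coeff (p * q) (a + b) = (\<Sum>i\<le>a + b. coeff p i * coeff q (a + b - i))"
    by (simp add: coeff_mult)
  also have "\<dots> = (\<Sum>i\<le>a + b. if i = a then coeff p a * coeff q b else 0)"
  proof (rule sum.cong)
    fix i assume i: "i \<in> {..a + b}"
    consider "i = a" | "i < a" | "i > a" by linarith
    then show "coeff p i * coeff q (a + b - i) = (if i = a then coeff p a * coeff q b else 0)"
    proof cases
      case 2
      then have "degree q < a + b - i" using assms(2) by linarith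
      then show ?thesis using 2 by (simp add: coeff_eq_0)
    next
      case 3
      then show ?thesis using assms(1) by (simp add: coeff_eq_0)
    qed simp
  qed simp
  finally show ?thesis by simp
qed

lemma place_rat_at_infinity: "place rat_at_infinity"
  unfolding place_def
proof (intro conjI allI impI)
  show "rat_at_infinity 0 0" unfolding rat_at_infinity_def by (rule exI[of _ 0], rule exI[of _ 1]) simp
  show "rat_at_infinity 1 1" unfolding rat_at_infinity_def by (rule exI[of _ 1], rule exI[of _ 1]) simp
  show "v = 0" if "rat_at_infinity 0 v" for v using that unfolding rat_at_infinity_def by auto
  show "rat_at_infinity (- f) (- v)" if "rat_at_infinity f v" for f v
  proof -
    from that obtain p q where "f * to_fract q = to_fract p" "q \<noteq> 0" "degree p \<le> degree q"
      "v * lead_coeff q = coeff p (degree q)"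
      unfolding rat_at_infinity_def by blast
    then show ?thesis
      unfolding rat_at_infinity_def by (intro exI[of _ "- p"] exI[of _ q]) simp
  qed
  fix f g v w assume "rat_at_infinity f v" "rat_at_infinity g w"
  then obtain p q r s where f: "f * to_fract q = to_fract p" "q \<noteq> 0" "degree p \<le> degree q"
      "v * lead_coeff q = coeff p (degree q)"
    and g: "g * to_fract s = to_fract r" "s \<noteq> 0" "degree r \<le> degree s"
      "w * lead_coeff s = coeff r (degree s)"
    unfolding rat_at_infinity_def by blast
  have dqs: "degree (q * s) = degree q + degree s" using f g by (simp add: degree_mult_eq)
  have d1: "degree (p * s) \<le> degree q + degree s" using degree_mult_le[of p s] f g by linarith
  have d2: "degree (q * r) \<le> degree q + degree s" using degree_mult_le[of q r] f g by linarith
  have d3: "degree (p * r) \<le> degree q + degree s" using degree_mult_le[of p r] f g by linarith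
  have "(f + g) * to_fract (q * s) = (f * to_fract q) * to_fract s + (g * to_fract s) * to_fract q"
    "(f * g) * to_fract (q * s) = (f * to_fract q) * (g * to_fract s)"
    by (simp_all add: algebra_simps)
  then have fr: "(f + g) * to_fract (q * s) = to_fract (p * s + q * r)"
    "(f * g) * to_fract (q * s) = to_fract (p * r)"
    unfolding f(1) g(1) by (simp_all add: mult.commute)
  have "(v + w) * lead_coeff (q * s)
      = (v * lead_coeff q) * lead_coeff s + lead_coeff q * (w * lead_coeff s)"
    "(v * w) * lead_coeff (q * s) = (v * lead_coeff q) * (w * lead_coeff s)"
    by (simp_all add: lead_coeff_mult algebra_simps)
  then have lc: "(v + w) * lead_coeff (q * s) = coeff (p * s + q * r) (degree (q * s))"
    "(v * w) * lead_coeff (q * s) = coeff (p * r) (degree (q * s))"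
    unfolding f(4) g(4) dqs coeff_add
    using coeff_mult_top[OF f(3) g(3)] coeff_mult_top[OF f(3) order_refl, of s]
      coeff_mult_top[OF order_refl g(3), of q] by simp_all
  have "q * s \<noteq> 0" "degree (p * s + q * r) \<le> degree (q * s)" "degree (p * r) \<le> degree (q * s)"
    using f(2) g(2) d1 d2 d3 dqs by (auto intro: degree_add_le)
  then show "rat_at_infinity (f + g) (v + w)" "rat_at_infinity (f * g) (v * w)"
    using fr lc unfolding rat_at_infinity_def by blast+
next
  fix f v assume "rat_at_infinity f v" "v \<noteq> 0"
  then obtain p q where f: "f * to_fract q = to_fract p" "q \<noteq> 0" "degree p \<le> degree q"
      "v * lead_coeff q = coeff p (degree q)"
    unfolding rat_at_infinity_def by blast
  then have p: "coeff p (degree q) \<noteq> 0" using \<open>v \<noteq> 0\<close> by (metis leading_coeff_0_iff mult_eq_0_iff)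
  then have d: "degree p = degree q" using f(3) le_degree le_antisym by blast
  have "f \<noteq> 0"
  proof
    assume "f = 0"
    then have "to_fract p = 0" using f(1) by simp
    then show False using p by simp
  qed
  then have "inverse f * to_fract p = to_fract q" unfolding f(1)[symmetric] by simp
  moreover have "inverse v * lead_coeff p = coeff q (degree p)"
    using \<open>v \<noteq> 0\<close> unfolding d f(4)[symmetric] by simp
  moreover have "p \<noteq> 0" "degree q \<le> degree p" using p d by auto
  ultimately show "rat_at_infinity (inverse f) (inverse v)" unfolding rat_at_infinity_def by blast
qed

lemma rat_at_infinity_proper:
  assumes "rat_at_infinity f v"
  shows "proper f"
proof (cases "rnum f = 0")
  case False
  obtain p q where f: "f * to_fract q = to_fract p" "q \<noteq> 0" "degree p \<le> degree q"
    using assms unfolding rat_at_infinity_def by blast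
  have e: "rnum f * q = p * rden f" by (rule rden_dvd[OF f(1)])
  then have "p \<noteq> 0" using False f(2) by auto
  then have "degree (rnum f) + degree q = degree p + degree (rden f)"
    using e False f(2) rden_nonzero[of f] by (metis degree_mult_eq)
  then show ?thesis using f(3) by (simp add: proper_def)
qed (simp add: proper_def)

lemma rat_at_infinity_const: "mat_rel rat_at_infinity (const_tm A) A"
  unfolding mat_rel_def const_tm_def rat_at_infinity_def
proof (intro allI)
  fix i j
  show "\<exists>p q. map_matrix (\<lambda>a. to_fract [:a:]) A $ i $ j * to_fract q = to_fract p \<and>
      q \<noteq> 0 \<and> degree p \<le> degree q \<and> A $ i $ j * lead_coeff q = coeff p (degree q)"
    by (intro exI[of _ "[:A $ i $ j:]"] exI[of _ 1]) simp
qed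

lemma rat_at_infinity_inverse_zvar: "rat_at_infinity (inverse zvar) 0"
  unfolding zvar_def rat_at_infinity_def by (intro exI[of _ 1] exI[of _ "[:0,1:]"]) simp

lemma matrix_diff_ldistrib: "M ** (B - C) = M ** B - M ** (C :: 'a::ring_1^'c^'n)"
  by (simp add: matrix_matrix_mult_def vec_eq_iff right_diff_distrib sum_subtractf)

lemma mat_scalar_mult: "mat c ** M = (\<chi> i j. c * M $ i $ j)"
  unfolding matrix_matrix_mult_def mat_def
  by (simp add: vec_eq_iff if_distrib[of "\<lambda>x. x * _"] cong: if_cong)

lemma mat_mult_mat: "mat c ** mat d = (mat (c * d) :: 'a::semiring_1^'n^'n)"
  by (simp add: mat_scalar_mult) (simp add: mat_def vec_eq_iff)

text \<open>
  The matrix \<open>zI - A\<close> itself has no value at infinity, but \<open>I - z\<^sup>-\<^sup>1 A\<close> has the value \<open>I\<close>, and the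
  resolvent is the inverse of the latter times \<open>z\<^sup>-\<^sup>1\<close>.
\<close>

lemma resolvent_at_infinity:
  "mat_rel rat_at_infinity (matrix_inv (mat zvar - const_tm A)) 0"
proof -
  note V = place_rat_at_infinity
  let ?z = "mat (inverse zvar) :: ratfun^'n^'n"
  let ?N = "mat 1 - ?z ** const_tm A"
  have z0: "zvar \<noteq> 0" by (simp add: zvar_def)
  have rz: "mat_rel rat_at_infinity ?z (mat 0)"
    by (rule place_mat[OF V rat_at_infinity_inverse_zvar])
  have m0: "mat 0 = (0 :: real^'n^'n)" by (simp add: mat_def vec_eq_iff)
  have "mat_rel rat_at_infinity ?N (mat 1 - mat 0 ** A)"
    by (rule place_matrix_diff[OF V place_mat[OF V place_one[OF V]]
          place_matrix_mult[OF V rz rat_at_infinity_const]])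
  then have N: "mat_rel rat_at_infinity ?N (mat 1)" by (simp add: m0)
  have i1: "invertible (mat 1 :: real^'n^'n)" by (simp add: invertible_det_nz)
  have iN: "invertible ?N"
    using place_invertible[OF place_rat_at_infinity N i1] .
  have f: "mat zvar - const_tm A = mat zvar ** ?N"
    using z0 by (simp add: matrix_diff_ldistrib matrix_mul_assoc mat_mult_mat)
  have "(mat zvar - const_tm A) ** (matrix_inv ?N ** ?z) = mat zvar ** (?N ** matrix_inv ?N) ** ?z"
    unfolding f by (simp only: matrix_mul_assoc)
  also have "\<dots> = mat 1" unfolding matrix_inv_right[OF iN] using z0 by (simp add: mat_mult_mat)
  finally have "matrix_inv (mat zvar - const_tm A) = matrix_inv ?N ** ?z"
    by (rule matrix_inv_unique)
  moreover have "mat_rel rat_at_infinity (matrix_inv ?N ** ?z) (matrix_inv (mat 1) ** mat 0)"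
    by (rule place_matrix_mult[OF V place_matrix_inv[OF V N i1] rz])
  ultimately show ?thesis by (simp add: m0)
qed

lemma transfer_matrix_proper: "proper (transfer_matrix A B C D $ i $ j)"
proof -
  note V = place_rat_at_infinity
  have "mat_rel rat_at_infinity (transfer_matrix A B C D) (C ** 0 ** B + D)"
    unfolding transfer_matrix_def
    by (rule place_matrix_add[OF V place_matrix_mult[OF V place_matrix_mult[OF V
          rat_at_infinity_const resolvent_at_infinity] rat_at_infinity_const]
          rat_at_infinity_const])
  then show ?thesis unfolding mat_rel_def by (auto intro: rat_at_infinity_proper)
qed

lemma mat_mult_vec: "mat z *v v = z *s v"
  by (simp add: vec_eq_iff matrix_vector_mult_def mat_def if_distrib[of "\<lambda>x. x * _"] cong: if_cong)

lemma schur_stable_resolvent: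
  assumes "schur_stable A" "1 \<le> cmod z"
  shows "invertible (mat z - cmat A)"
proof -
  have "v = 0" if "(mat z - cmat A) *v v = 0" for v
  proof -
    from that have e: "cmat A *v v = z *s v" by (simp add: matrix_vector_mult_diff_rdistrib mat_mult_vec)
    show "v = 0"
    proof (rule ccontr)
      assume "v \<noteq> 0"
      with e assms(1) have "cmod z < 1" unfolding schur_stable_def by blast
      with assms(2) show False by simp
    qed
  qed
  then show ?thesis unfolding invertible_left_inverse matrix_left_invertible_ker by blast
qed

lemma transfer_matrix_RH_inf:
  assumes "schur_stable A"
  shows "transfer_matrix A B C D \<in> RH_inf"
proof -
  have "poles (transfer_matrix A B C D $ i $ j) \<subseteq> ball 0 1" for i j
  proof
    fix z assume z: "z \<in> poles (transfer_matrix A B C D $ i $ j)"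
    have "cmod z < 1"
    proof (rule ccontr)
      assume "\<not> cmod z < 1"
      then have "invertible (mat z - cmat A)" by (intro schur_stable_resolvent assms) simp
      note v = rat_at_transfer_matrix[where B = B and C = C and D = D, OF this, unfolded mat_rel_def, rule_format, of i j]
      show False using rat_at_rat_eval(1)[OF v] z unfolding poles_def by simp
    qed
    then show "z \<in> ball 0 1" by simp
  qed
  then show ?thesis by (simp add: RH_inf_def transfer_matrix_proper)
qed

lemma tm_eval_transfer_matrix:
  assumes "schur_stable A" "1 \<le> cmod z"
  shows "tm_eval (transfer_matrix A B C D) z
    = cmat C ** matrix_inv (mat z - cmat A) ** cmat B + cmat D"
  using mat_rel_tm_eval[OF rat_at_transfer_matrix[OF schur_stable_resolvent[OF assms]]] .

lemma tm_eval_model_mismatch: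
  assumes "P \<in> RH_inf" "Q \<in> RH_inf" "G \<in> RH_inf" "1 \<le> cmod z"
  shows "tm_eval (P ** Q - G) z = tm_eval P z ** tm_eval Q z - tm_eval G z"
  by (rule mat_rel_tm_eval[OF place_matrix_diff[OF place_rat_at place_matrix_mult[OF place_rat_at]]])
    (rule RH_inf_rat_at assms)+

section \<open>Powers of a stable matrix\<close>

lemma contraction_sequence_tendsto_zero:
  fixes a b :: "nat \<Rightarrow> real"
  assumes "\<And>k. a (Suc k) \<le> c * a k + b k" "\<And>k. 0 \<le> a k" "0 \<le> c" "c < 1" "b \<longlonglongrightarrow> 0"
  shows "a \<longlonglongrightarrow> 0"
proof (rule LIMSEQ_I)
  fix r :: real assume r: "0 < r"
  define e where "e = r / 2"
  have e: "0 < e * (1 - c)" using r assms by (simp add: e_def)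
  obtain N where N: "\<And>k. k \<ge> N \<Longrightarrow> \<bar>b k\<bar> < e * (1 - c)"
    using LIMSEQ_D[OF assms(5) e] by auto
  have bound: "a (N + k) \<le> e + c ^ k * a N" for k
  proof (induction k)
    case 0 then show ?case using r by (simp add: e_def)
  next
    case (Suc k)
    have "a (N + Suc k) \<le> c * a (N + k) + b (N + k)" using assms(1) by simp
    also have "\<dots> \<le> c * (e + c ^ k * a N) + e * (1 - c)"
      using Suc N[of "N + k"] assms(3) by (intro add_mono mult_left_mono) auto
    finally show ?case by (simp add: algebra_simps)
  qed
  have "(\<lambda>k. c ^ k * a N) \<longlonglongrightarrow> 0"
    using assms by (intro tendsto_mult_left_zero LIMSEQ_power_zero) auto
  then obtain K where K: "\<And>k. k \<ge> K \<Longrightarrow> \<bar>c ^ k * a N\<bar> < e"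
    using LIMSEQ_D[of "\<lambda>k. c ^ k * a N" 0 e] r e_def by (metis diff_zero half_gt_zero real_norm_def)
  have "norm (a k - 0) < r" if "k \<ge> N + K" for k
  proof -
    have "a k \<le> e + c ^ (k - N) * a N" using bound[of "k - N"] that by simp
    also have "\<dots> < r" using K[of "k - N"] that unfolding e_def by (smt (verit) add_le_imp_le_diff add.commute field_sum_of_halves)
    finally show ?thesis using assms(2)[of k] by simp
  qed
  then show "\<exists>no. \<forall>n\<ge>no. norm (a n - 0) < r" by blast
qed

text \<open>
  The vector \<open>p(M) v\<close>, by Horner's scheme.
\<close>

definition poly_apply :: "complex^'n^'n \<Rightarrow> complex poly \<Rightarrow> complex^'n \<Rightarrow> complex^'n" where
  "poly_apply M p v = fold_coeffs (\<lambda>a w. a *s v + M *v w) p 0"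

lemma poly_apply_0 [simp]: "poly_apply M 0 v = 0"
  by (simp add: poly_apply_def)

lemma poly_apply_pCons: "poly_apply M (pCons a p) v = a *s v + M *v poly_apply M p v"
  by (cases "a = 0 \<and> p = 0") (auto simp: poly_apply_def)

lemma poly_apply_add: "poly_apply M (p + q) v = poly_apply M p v + poly_apply M q v"
  by (induction p q rule: poly_induct2)
    (auto simp: poly_apply_pCons matrix_vector_right_distrib vector_sadd_rdistrib)

lemma poly_apply_smult: "poly_apply M (smult c p) v = c *s poly_apply M p v"
  by (induction p)
    (auto simp: poly_apply_pCons vector_smult_assoc vector_scalar_commute vector_add_ldistrib)

lemma poly_apply_sum: "poly_apply M (\<Sum>i\<in>I. p i) v = (\<Sum>i\<in>I. poly_apply M (p i) v)"
  by (induction I rule: infinite_finite_induct) (auto simp: poly_apply_add)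

lemma poly_apply_monom: "poly_apply M (monom c k) v = c *s ((*v) M ^^ k) v"
  by (induction k) (auto simp: monom_0 monom_Suc poly_apply_pCons vector_scalar_commute)

lemma poly_apply_minus_arg: "poly_apply M p (v - w) = poly_apply M p v - poly_apply M p w"
  by (induction p)
    (auto simp: poly_apply_pCons matrix_vector_mult_diff_distrib vector_ssub_ldistrib)

lemma poly_apply_scale_arg: "poly_apply M p (c *s v) = c *s poly_apply M p v"
  by (induction p)
    (auto simp: poly_apply_pCons vector_scalar_commute vector_smult_assoc vector_add_ldistrib
       mult.commute)

lemma poly_apply_commute: "poly_apply M p (M *v v) = M *v poly_apply M p v"
  by (induction p)
    (auto simp: poly_apply_pCons vector_scalar_commute matrix_vector_right_distrib)

lemma poly_apply_linear_factor:
  "poly_apply M ([:- c, 1:] * p) v = M *v poly_apply M p v - c *s poly_apply M p v"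
proof -
  have "[:- c, 1:] * p = pCons 0 p + smult (- c) p" by simp
  then show ?thesis
    by (simp only: poly_apply_add poly_apply_smult poly_apply_pCons) (simp add: vec_eq_iff)
qed

text \<open>
  Among the \<open>n + 1\<close> vectors \<open>v, M v, ..., M\<^sup>n v\<close> there is a linear relation. The case distinction is
  due to coincidences among them, which collapse the set of these vectors.
\<close>

lemma annihilating_polynomial:
  fixes M :: "complex^'n^'n"
  shows "\<exists>p. p \<noteq> 0 \<and> poly_apply M p v = 0"
proof -
  let ?n = "CARD('n)"
  let ?f = "\<lambda>k. ((*v) M ^^ k) v"
  have "\<exists>c. (\<exists>i\<le>?n. c i \<noteq> 0) \<and> (\<Sum>i\<le>?n. c i *s ?f i) = 0"
  proof (cases "inj_on ?f {..?n}")
    case True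
    have "vec.dependent (?f ` {..?n})"
      by (rule vec.dependent_biggerset_general)
        (auto simp: card_image[OF True] intro: le_less_trans[OF dim_subset_UNIV_cart_gen])
    then obtain u where "\<exists>w\<in>?f ` {..?n}. u w \<noteq> 0" "(\<Sum>w\<in>?f ` {..?n}. u w *s w) = 0"
      by (auto simp: vec.dependent_finite)
    then show ?thesis
      by (intro exI[of _ "\<lambda>i. u (?f i)"]) (auto simp: sum.reindex[OF True])
  next
    case False
    then obtain i j where ij: "i \<le> ?n" "j \<le> ?n" "i \<noteq> j" "?f i = ?f j" by (auto simp: inj_on_def)
    let ?c = "\<lambda>k. (if k = i then 1 else 0) - (if k = j then 1 else 0 :: complex)"
    have "(\<Sum>k\<le>?n. ?c k *s ?f k)
        = (\<Sum>k\<le>?n. (if k = i then ?f i else 0)) - (\<Sum>k\<le>?n. (if k = j then ?f j else 0))"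
      unfolding sum_subtractf[symmetric] by (rule sum.cong) (auto simp: vec_eq_iff)
    then show ?thesis using ij by (intro exI[of _ ?c]) auto
  qed
  then obtain c i where c: "i \<le> ?n" "c i \<noteq> 0" "(\<Sum>i\<le>?n. c i *s ?f i) = 0" by blast
  have "coeff (\<Sum>i\<le>?n. monom (c i) i) i = c i"
    using c(1) by (simp add: coeff_sum if_distrib cong: if_cong)
  then have "(\<Sum>i\<le>?n. monom (c i) i) \<noteq> 0" using c(2) by force
  then show ?thesis
    using c(3) by (intro exI[of _ "\<Sum>i\<le>?n. monom (c i) i"]) (simp add: poly_apply_sum poly_apply_monom)
qed

lemma norm_smult_complex: "norm (c *s v) = cmod c * norm v" for v :: "complex^'n"
  by (simp add: norm_vec_def norm_mult L2_set_right_distrib)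

text \<open>
  Split off a root \<open>c\<close> of \<open>p\<close>. If it lies in the open unit disc, then \<open>M\<^sup>k v\<close> satisfies a contractive
  recursion whose input \<open>M\<^sup>k (M v - c v)\<close> tends to zero by induction. Otherwise \<open>c\<close> is no eigenvalue,
  the factor \<open>M - c\<close> is injective, and the remaining factor already annihilates \<open>v\<close>.
\<close>

lemma powers_tendsto_zero_if_annihilated:
  fixes M :: "complex^'n^'n"
  assumes stable: "\<And>z v. v \<noteq> 0 \<Longrightarrow> M *v v = z *s v \<Longrightarrow> cmod z < 1"
  shows "p \<noteq> 0 \<Longrightarrow> poly_apply M p v = 0 \<Longrightarrow> (\<lambda>k. ((*v) M ^^ k) v) \<longlonglongrightarrow> 0"
proof (induction "degree p" arbitrary: p v)
  case 0
  then obtain c where "p = [:c:]" "c \<noteq> 0" by (metis degree_eq_zeroE pCons_0_0)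
  then have "v = 0" using 0 by (simp add: poly_apply_pCons)
  then have "((*v) M ^^ k) v = 0" for k by (induction k) auto
  then show ?case by simp
next
  case (Suc d)
  then obtain c where "poly p c = 0"
    using Fundamental_Theorem_Algebra.fundamental_theorem_of_algebra[of p] constant_degree[of p] by auto
  then obtain q where q: "p = [:- c, 1:] * q" by (auto simp: poly_eq_0_iff_dvd)
  then have q0: "q \<noteq> 0" using Suc.prems(1) by auto
  then have "degree p = Suc (degree q)"
    unfolding q by (subst degree_mult_eq) simp_all
  then have d: "d = degree q" using Suc.hyps(2) by simp
  let ?u = "M *v v - c *s v"
  have f: "poly_apply M p v = M *v poly_apply M q v - c *s poly_apply M q v"
    unfolding q by (rule poly_apply_linear_factor)
  show ?case
  proof (cases "cmod c < 1")
    case True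
    have "poly_apply M q ?u = 0"
      using f Suc.prems(2) by (simp add: poly_apply_minus_arg poly_apply_scale_arg poly_apply_commute)
    then have "(\<lambda>k. ((*v) M ^^ k) ?u) \<longlonglongrightarrow> 0" by (rule Suc.hyps(1)[OF d q0])
    moreover have u: "((*v) M ^^ Suc k) v = c *s ((*v) M ^^ k) v + ((*v) M ^^ k) ?u" for k
    proof (induction k)
      case (Suc k)
      have "((*v) M ^^ Suc (Suc k)) v = M *v (c *s ((*v) M ^^ k) v + ((*v) M ^^ k) ?u)"
        unfolding Suc[symmetric] by simp
      then show ?case by (simp add: matrix_vector_right_distrib vector_scalar_commute)
    qed (simp add: vec_eq_iff)
    have "(\<lambda>k. norm (((*v) M ^^ k) v)) \<longlonglongrightarrow> 0"
    proof (rule contraction_sequence_tendsto_zero[where c = "cmod c" and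
          b = "\<lambda>k. norm (((*v) M ^^ k) ?u)"])
      show "norm (((*v) M ^^ Suc k) v) \<le> cmod c * norm (((*v) M ^^ k) v) + norm (((*v) M ^^ k) ?u)" for k
        unfolding u norm_smult_complex[symmetric] by (rule norm_triangle_ineq)
    qed (use True calculation in \<open>auto intro: tendsto_norm_zero\<close>)
    then show ?thesis by (rule tendsto_norm_zero_cancel)
  next
    case False
    then have "poly_apply M q v = 0" using f Suc.prems(2) stable[of "poly_apply M q v" c] by auto
    then show ?thesis by (rule Suc.hyps(1)[OF d q0])
  qed
qed

abbreviation cvec :: "real^'n \<Rightarrow> complex^'n" where
  "cvec v \<equiv> (\<chi> i. complex_of_real (v $ i))"

lemma cmat_mult_cvec: "cmat A *v cvec v = cvec (A *v v)"
  by (simp add: vec_eq_iff matrix_vector_mult_def)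

lemma norm_cvec: "norm (cvec v) = norm v"
  by (simp add: norm_vec_def)

lemma schur_stable_powers:
  assumes "schur_stable A"
  shows "(\<lambda>k. ((*v) A ^^ k) v) \<longlonglongrightarrow> 0"
proof -
  obtain p where "p \<noteq> 0" "poly_apply (cmat A) p (cvec v) = 0" using annihilating_polynomial by blast
  then have "(\<lambda>k. ((*v) (cmat A) ^^ k) (cvec v)) \<longlonglongrightarrow> 0"
    using assms by (intro powers_tendsto_zero_if_annihilated) (auto simp: schur_stable_def)
  moreover have "((*v) (cmat A) ^^ k) (cvec v) = cvec (((*v) A ^^ k) v)" for k
    by (induction k) (auto simp: cmat_mult_cvec)
  ultimately have "(\<lambda>k. norm (((*v) A ^^ k) v)) \<longlonglongrightarrow> 0"
    using tendsto_norm_zero by (fastforce simp: norm_cvec)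
  then show ?thesis by (rule tendsto_norm_zero_cancel)
qed

lemma linear_funpow: "linear f \<Longrightarrow> linear (f ^^ k)" for f :: "'a::real_vector \<Rightarrow> 'a"
  by (induction k) (auto intro: linear_compose simp: linear_id[unfolded id_def] linear_id)

text \<open>
  Pointwise convergence of the powers is uniform on the unit ball, because it suffices to look at the
  basis vectors.
\<close>

lemma schur_stable_power_contraction:
  fixes A :: "real^'n^'n"
  assumes "schur_stable A" "0 < e"
  shows "\<exists>N. \<forall>v. norm (((*v) A ^^ N) v) \<le> e * norm v"
proof -
  let ?f = "\<lambda>k. \<Sum>i\<in>UNIV. norm (((*v) A ^^ k) (axis i 1))"
  have "?f \<longlonglongrightarrow> (\<Sum>i\<in>(UNIV::'n set). norm (0::real^'n))"
    by (intro tendsto_sum tendsto_norm schur_stable_powers assms)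
  then have "\<forall>\<^sub>F k in sequentially. ?f k < e" using assms(2) by (simp add: order_tendstoD)
  then obtain N where N: "?f N < e" by (auto simp: eventually_sequentially)
  have lin: "linear ((*v) A ^^ N)" by (intro linear_funpow matrix_vector_mul_linear)
  have "norm (((*v) A ^^ N) v) \<le> e * norm v" for v
  proof -
    have "((*v) A ^^ N) v = ((*v) A ^^ N) (\<Sum>i\<in>UNIV. (v $ i) *\<^sub>R axis i 1)"
      by (simp only: basis_expansion[of v, unfolded scalar_mult_eq_scaleR])
    also have "\<dots> = (\<Sum>i\<in>UNIV. (v $ i) *\<^sub>R ((*v) A ^^ N) (axis i 1))"
      by (simp add: linear_sum[OF lin] linear_cmul[OF lin])
    also have "norm \<dots> \<le> (\<Sum>i\<in>UNIV. norm v * norm (((*v) A ^^ N) (axis i 1)))"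
      by (rule sum_norm_le) (auto intro!: mult_right_mono component_le_norm_cart)
    also have "\<dots> = ?f N * norm v" by (simp add: sum_distrib_left mult.commute)
    also have "\<dots> \<le> e * norm v" using N by (intro mult_right_mono) auto
    finally show ?thesis .
  qed
  then show ?thesis by blast
qed

lemma schur_stable_iff_resolvent:
  "schur_stable A \<longleftrightarrow> (\<forall>z. 1 \<le> cmod z \<longrightarrow> invertible (mat z - cmat A))"
proof (intro iffI allI impI)
  assume inv: "\<forall>z. 1 \<le> cmod z \<longrightarrow> invertible (mat z - cmat A)"
  show "schur_stable A" unfolding schur_stable_def
  proof (intro allI impI)
    fix z v assume v: "v \<noteq> 0 \<and> cmat A *v v = z *s v"
    have "(mat z - cmat A) *v v = 0" using v by (simp add: matrix_vector_mult_diff_rdistrib mat_mult_vec)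
    then have "\<not> invertible (mat z - cmat A)"
      using v by (metis invertible_left_inverse matrix_left_invertible_ker)
    then show "cmod z < 1" using inv by (meson not_le)
  qed
qed (rule schur_stable_resolvent)

lemma schur_stable_transpose:
  assumes "schur_stable A"
  shows "schur_stable (transpose A)"
proof -
  have "mat z - cmat (transpose A) = transpose (mat z - cmat A)" for z
    by (simp add: vec_eq_iff transpose_def mat_def)
  then show ?thesis
    using assms by (simp add: schur_stable_iff_resolvent invertible_det_nz)
qed

section \<open>Singular values and the supremum norm\<close>

lemma norm_matrix_vector_le:
  fixes M :: "complex^'c^'r"
  shows "norm (M *v x) \<le> (\<Sum>i\<in>UNIV. \<Sum>j\<in>UNIV. cmod (M $ i $ j)) * norm x"
proof -
  have "norm (M *v x) \<le> (\<Sum>i\<in>UNIV. cmod ((M *v x) $ i))" 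
    unfolding norm_vec_def by (rule L2_set_le_sum) simp
  also have "\<dots> \<le> (\<Sum>i\<in>UNIV. \<Sum>j\<in>UNIV. cmod (M $ i $ j) * norm x)"
    unfolding matrix_vector_mult_def vec_lambda_beta
    by (intro sum_mono order_trans[OF norm_sum])
      (auto simp: norm_mult intro!: mult_left_mono Finite_Cartesian_Product.norm_nth_le)
  finally show ?thesis by (simp add: sum_distrib_right)
qed

lemma inner_complex_vec: "x \<bullet> y = Re (\<Sum>i\<in>UNIV. x $ i * cnj (y $ i))" for x y :: "complex^'n"
  by (simp add: inner_vec_def inner_complex_def)

lemma conj_transpose_adjoint:
  "(M *v x) \<bullet> y = x \<bullet> (conj_transpose M *v y)"
proof -
  have "(\<Sum>i\<in>UNIV. (M *v x) $ i * cnj (y $ i)) = (\<Sum>i\<in>UNIV. \<Sum>j\<in>UNIV. M $ i $ j * x $ j * cnj (y $ i))"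
    by (simp add: matrix_vector_mult_def sum_distrib_right)
  also have "\<dots> = (\<Sum>j\<in>UNIV. \<Sum>i\<in>UNIV. M $ i $ j * x $ j * cnj (y $ i))" by (rule sum.swap)
  also have "\<dots> = (\<Sum>j\<in>UNIV. x $ j * cnj ((conj_transpose M *v y) $ j))"
    by (simp add: conj_transpose_def transpose_def matrix_vector_mult_def sum_distrib_left ac_simps)
  finally show ?thesis unfolding inner_complex_vec by simp
qed

lemma nonneg_quadratic_linear_coeff_zero:
  fixes a b :: real
  assumes "\<And>s. 0 \<le> 2 * s * a + s\<^sup>2 * b" "0 \<le> b"
  shows "a = 0"
proof (rule ccontr)
  assume "a \<noteq> 0"
  have "0 \<le> 2 * (- a / (b + 1)) * a + (- a / (b + 1))\<^sup>2 * b" by (rule assms(1))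
  also have "\<dots> = - (a\<^sup>2 * (b + 2)) / (b + 1)\<^sup>2"
  proof -
    have "b + 1 \<noteq> 0" using assms(2) by simp
    then have "2 * (- a / (b + 1)) * a = - (2 * a\<^sup>2 * (b + 1)) / (b + 1)\<^sup>2"
      by (simp add: power2_eq_square)
    moreover have "(- a / (b + 1))\<^sup>2 * b = a\<^sup>2 * b / (b + 1)\<^sup>2" by (simp add: power_divide)
    ultimately show ?thesis by (simp add: add_divide_distrib[symmetric] algebra_simps)
  qed
  also have "\<dots> < 0"
  proof -
    have "0 < a\<^sup>2 * (b + 2)" using \<open>a \<noteq> 0\<close> assms(2) by (intro mult_pos_pos) auto
    moreover have "0 < (b + 1)\<^sup>2" using assms(2) by simp
    ultimately show ?thesis by (simp add: divide_neg_pos)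
  qed
  finally show False by simp
qed

lemma complex_scale_of_real: "complex_of_real t *s v = t *\<^sub>R v"
  by (simp add: vec_eq_iff) (simp add: scaleR_conv_of_real)

lemma singular_value_le:
  assumes "\<And>v. norm (M *v v) \<le> s * norm v" "t \<in> singular_values M"
  shows "t \<le> s"
proof -
  obtain v where t: "0 \<le> t" and v: "v \<noteq> 0"
    "(conj_transpose M ** M) *v v = complex_of_real (t\<^sup>2) *s v"
    using assms(2) by (auto simp: singular_values_def)
  have "(norm (M *v v))\<^sup>2 = v \<bullet> ((conj_transpose M ** M) *v v)"
    by (simp add: power2_norm_eq_inner conj_transpose_adjoint flip: matrix_vector_mul_assoc)
  also have "\<dots> = (t * norm v)\<^sup>2"
    unfolding v(2) complex_scale_of_real by (simp add: power2_norm_eq_inner[symmetric] power_mult_distrib)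
  finally have "norm (M *v v) = t * norm v"
    using t by (metis abs_of_nonneg norm_ge_zero mult_nonneg_nonneg power2_eq_iff_nonneg)
  then have "t * norm v \<le> s * norm v" using assms(1)[of v] by simp
  then show ?thesis using v(1) by simp
qed

text \<open>
  Let \<open>t\<close> be the maximum of \<open>norm (M *v v)\<close> over the unit sphere. The form
  \<open>t\<^sup>2 (norm v)\<^sup>2 - (norm (M *v v))\<^sup>2\<close> is nonnegative and vanishes at a maximizer, hence so does its
  gradient there, and this is the eigenvector equation.
\<close>

lemma maximal_singular_value:
  fixes M :: "complex^'c^'r"
  shows "\<exists>t\<in>singular_values M. \<forall>v. norm (M *v v) \<le> t * norm v"
proof -
  have cont: "continuous_on (sphere 0 1) (\<lambda>v. norm (M *v v))"
    unfolding matrix_vector_mult_def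
    by (intro continuous_intros)
  have ne: "sphere (0::complex^'c) 1 \<noteq> {}"
    using vector_choose_size[of 1, where ?'a = "complex^'c"] by force
  obtain v0 where v0: "norm v0 = 1" and max: "\<And>v. norm v = 1 \<Longrightarrow> norm (M *v v) \<le> norm (M *v v0)"
    using continuous_attains_sup[OF compact_sphere ne cont] by auto
  define t where "t = norm (M *v v0)"
  have bound: "norm (M *v v) \<le> t * norm v" for v
  proof (cases "v = 0")
    case False
    have sc: "M *v (r *\<^sub>R v) = r *\<^sub>R (M *v v)" for r
      by (metis complex_scale_of_real vector_scalar_commute)
    have "norm (M *v ((1 / norm v) *\<^sub>R v)) \<le> t"
      unfolding t_def using False by (intro max) simp
    then show ?thesis using False by (simp add: sc field_simps)
  qed simp
  define B where "B v = t\<^sup>2 *\<^sub>R v - conj_transpose M *v (M *v v)" for v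
  have B: "h \<bullet> B v = t\<^sup>2 * (h \<bullet> v) - (M *v h) \<bullet> (M *v v)" for h v
    by (simp add: B_def inner_diff_right conj_transpose_adjoint[symmetric])
  have nonneg: "0 \<le> v \<bullet> B v" for v
    using power_mono[OF bound[of v], of 2]
    by (simp add: B power_mult_distrib power2_norm_eq_inner)
  have zero: "v0 \<bullet> B v0 = 0"
    using v0 by (simp add: B t_def power2_norm_eq_inner[symmetric] dot_square_norm)
  have lin: "B (v + s *\<^sub>R h) = B v + s *\<^sub>R B h" for v h s
    unfolding B_def complex_scale_of_real[symmetric]
    by (simp add: vector_scalar_commute matrix_vector_right_distrib vec_eq_iff algebra_simps)
  have "h \<bullet> B v0 = 0" for h
  proof (rule nonneg_quadratic_linear_coeff_zero[where b = "h \<bullet> B h"])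
    fix s
    have sym: "v0 \<bullet> B h = h \<bullet> B v0" by (simp add: B inner_commute)
    have "0 \<le> (v0 + s *\<^sub>R h) \<bullet> B (v0 + s *\<^sub>R h)" by (rule nonneg)
    then show "0 \<le> 2 * s * (h \<bullet> B v0) + s\<^sup>2 * (h \<bullet> B h)"
      unfolding lin by (simp add: inner_add_left inner_add_right zero sym algebra_simps power2_eq_square)
  qed (rule nonneg)
  then have "B v0 = 0" by (metis inner_eq_zero_iff)
  then have "(conj_transpose M ** M) *v v0 = complex_of_real (t\<^sup>2) *s v0"
    unfolding complex_scale_of_real by (simp add: B_def matrix_vector_mul_assoc)
  moreover have "v0 \<noteq> 0" "0 \<le> t" using v0 by (auto simp: t_def)
  ultimately show ?thesis using bound unfolding singular_values_def by blast
qed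

lemma sigma_max_le:
  assumes "\<And>v. norm (M *v v) \<le> s * norm v"
  shows "sigma_max M \<le> s"
  unfolding sigma_max_def
  using maximal_singular_value[of M] singular_value_le[OF assms]
  by (intro cSup_least) auto

lemma norm_le_sigma_max: "norm (M *v v) \<le> sigma_max M * norm v"
proof -
  obtain t where t: "t \<in> singular_values M" "\<And>v. norm (M *v v) \<le> t * norm v"
    using maximal_singular_value by blast
  then have "t \<le> sigma_max M"
    unfolding sigma_max_def using singular_value_le[OF t(2)]
    by (intro cSup_upper bdd_aboveI) auto
  then show ?thesis using t(2)[of v] by (meson mult_right_mono norm_ge_zero order_trans)
qed

definition gain_le :: "(complex \<Rightarrow> complex^'c^'r) \<Rightarrow> real \<Rightarrow> bool" where
  "gain_le G s \<longleftrightarrow> (\<forall>z v. cmod z = 1 \<longrightarrow> norm (G z *v v) \<le> s * norm v)"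

lemma hinf_norm_le:
  assumes "gain_le (tm_eval G) s"
  shows "hinf_norm G \<le> s"
proof -
  have "sphere (0::complex) 1 \<noteq> {}" by (metis empty_iff mem_sphere_0 norm_one)
  then show ?thesis unfolding hinf_norm_def
    using assms by (intro cSUP_least sigma_max_le) (auto simp: gain_le_def)
qed

text \<open>
  The constant \<open>K\<close> makes the set of the singular values bounded, without which its supremum says
  nothing.
\<close>

lemma gain_le_hinf_norm:
  assumes "gain_le (tm_eval G) K"
  shows "gain_le (tm_eval G) (hinf_norm G)"
  unfolding gain_le_def
proof (intro allI impI)
  fix z v assume z: "cmod z = 1"
  have "sigma_max (tm_eval G z) \<le> hinf_norm G"
    unfolding hinf_norm_def using z assms
    by (intro cSUP_upper bdd_aboveI2[where M = K] sigma_max_le) (auto simp: gain_le_def)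
  then show "norm (tm_eval G z *v v) \<le> hinf_norm G * norm v"
    using norm_le_sigma_max[of "tm_eval G z" v] by (meson mult_right_mono norm_ge_zero order_trans)
qed

lemma gain_le_mono: "gain_le G s \<Longrightarrow> s \<le> t \<Longrightarrow> gain_le G t"
  unfolding gain_le_def by (meson mult_right_mono norm_ge_zero order_trans)

lemma gain_le_mult:
  assumes "gain_le G s" "gain_le H t" "0 \<le> s"
  shows "gain_le (\<lambda>z. G z ** H z) (s * t)"
  unfolding gain_le_def
proof (intro allI impI)
  fix z v assume z: "cmod z = 1"
  have "norm (G z *v (H z *v v)) \<le> s * norm (H z *v v)" using assms(1) z by (simp add: gain_le_def)
  also have "\<dots> \<le> s * (t * norm v)" using assms(2,3) z by (intro mult_left_mono) (auto simp: gain_le_def)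
  finally show "norm (G z ** H z *v v) \<le> s * t * norm v" by (simp add: matrix_vector_mul_assoc)
qed

lemma gain_le_diff:
  assumes "gain_le G s" "gain_le H t"
  shows "gain_le (\<lambda>z. G z - H z) (s + t)"
  unfolding gain_le_def
proof (intro allI impI)
  fix z v assume z: "cmod z = 1"
  then have "norm (G z *v v) \<le> s * norm v" "norm (H z *v v) \<le> t * norm v"
    using assms by (auto simp: gain_le_def)
  then show "norm ((G z - H z) *v v) \<le> (s + t) * norm v"
    using norm_triangle_ineq4[of "G z *v v" "H z *v v"]
    by (simp add: matrix_vector_mult_diff_rdistrib distrib_right)
qed

lemma gain_le_bounded_entries:
  assumes "\<And>i j. \<exists>K. \<forall>z. cmod z = 1 \<longrightarrow> cmod (G z $ i $ j) \<le> K"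
  shows "\<exists>K\<ge>0. gain_le G K"
proof -
  obtain K where K: "\<And>i j z. cmod z = 1 \<Longrightarrow> cmod (G z $ i $ j) \<le> K i j" using assms by metis
  let ?K = "\<Sum>i\<in>UNIV. \<Sum>j\<in>UNIV. \<bar>K i j\<bar>"
  have "norm (G z *v v) \<le> ?K * norm v" if "cmod z = 1" for z v
    by (intro order_trans[OF norm_matrix_vector_le] mult_right_mono sum_mono
        order_trans[OF K[OF that] abs_ge_self]) auto
  moreover have "0 \<le> ?K" by (intro sum_nonneg) auto
  ultimately show ?thesis unfolding gain_le_def by blast
qed

lemma gain_le_continuous:
  assumes "\<And>i j. continuous_on (sphere 0 1) (\<lambda>z. G z $ i $ j)"
  shows "\<exists>K\<ge>0. gain_le G K"
proof (rule gain_le_bounded_entries)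
  fix i j
  have "bounded ((\<lambda>z. G z $ i $ j) ` sphere 0 1)"
    by (intro compact_imp_bounded compact_continuous_image assms compact_sphere)
  then show "\<exists>K. \<forall>z. cmod z = 1 \<longrightarrow> cmod (G z $ i $ j) \<le> K" unfolding bounded_iff by force
qed

lemma gain_le_cmat: "\<exists>K\<ge>0. gain_le (\<lambda>z. cmat M) K"
  by (rule gain_le_continuous) (intro continuous_intros)

lemma RH_inf_denominator: "G \<in> RH_inf \<Longrightarrow> 1 \<le> cmod z \<Longrightarrow> cev z (rden (G $ i $ j)) \<noteq> 0"
  using rat_at_rat_eval(1) RH_inf_rat_at unfolding mat_rel_def by blast

lemma gain_le_RH_inf:
  assumes "G \<in> RH_inf"
  shows "\<exists>K\<ge>0. gain_le (tm_eval G) K"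
  using RH_inf_denominator[OF assms]
  by (intro gain_le_continuous) (auto simp: tm_eval_def rat_eval_def intro!: continuous_intros)

text \<open>
  The resolvent is the transfer matrix of a stable system whose input and output matrices are the
  identity.
\<close>

lemma gain_le_resolvent:
  assumes "schur_stable A"
  shows "\<exists>K\<ge>0. gain_le (\<lambda>z. matrix_inv (mat z - cmat A)) K"
proof -
  have "cmat (mat 1) = (mat 1 :: complex^'a^'a)" "cmat 0 = (0 :: complex^'a^'a)"
    by (simp_all add: vec_eq_iff mat_def)
  then have "tm_eval (transfer_matrix A (mat 1) (mat 1) 0) z = matrix_inv (mat z - cmat A)"
    if "cmod z = 1" for z
    using tm_eval_transfer_matrix[OF assms, of z "mat 1" "mat 1" 0] that by simp
  then show ?thesis
    using gain_le_RH_inf[OF transfer_matrix_RH_inf[OF assms, of "mat 1" "mat 1" 0]]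
    unfolding gain_le_def by simp
qed

section \<open>Approximation of stable filters by finite impulse responses\<close>

text \<open>
  Uniform limits on the unit circle of polynomials in \<open>1/z\<close>.
\<close>

definition fir_approximable :: "(complex \<Rightarrow> complex) \<Rightarrow> bool" where
  "fir_approximable g \<longleftrightarrow>
     (\<forall>e>0. \<exists>p. \<forall>z. cmod z = 1 \<longrightarrow> cmod (g z - poly p (inverse z)) \<le> e)"

lemma fir_approximable_poly: "fir_approximable (\<lambda>z. poly p (inverse z))"
  unfolding fir_approximable_def by (auto intro!: exI[of _ p])

lemma fir_approximable_cong:
  "(\<And>z. cmod z = 1 \<Longrightarrow> g z = h z) \<Longrightarrow> fir_approximable g \<longleftrightarrow> fir_approximable h"
  unfolding fir_approximable_def by simp

lemma poly_unit_circle_bound: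
  "cmod w = 1 \<Longrightarrow> cmod (poly p w) \<le> (\<Sum>i\<le>degree p. cmod (coeff p i))"
  unfolding poly_altdef by (rule sum_norm_le) (simp add: norm_mult norm_power)

lemma fir_approximable_bounded:
  assumes "fir_approximable g"
  shows "\<exists>K>0. \<forall>z. cmod z = 1 \<longrightarrow> cmod (g z) \<le> K"
proof -
  obtain p where p: "\<And>z. cmod z = 1 \<Longrightarrow> cmod (g z - poly p (inverse z)) \<le> 1"
    using assms unfolding fir_approximable_def by (meson zero_less_one)
  let ?K = "1 + (\<Sum>i\<le>degree p. cmod (coeff p i))"
  have "cmod (g z) \<le> ?K" if "cmod z = 1" for z
    using p[OF that] poly_unit_circle_bound[of "inverse z" p] that
      norm_triangle_ineq[of "g z - poly p (inverse z)" "poly p (inverse z)"]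
    by (simp add: norm_inverse)
  moreover have "?K > 0" by (simp add: add_pos_nonneg sum_nonneg)
  ultimately show ?thesis by blast
qed

lemma fir_approximable_mult:
  assumes g: "fir_approximable g" and h: "fir_approximable h"
  shows "fir_approximable (\<lambda>z. g z * h z)"
  unfolding fir_approximable_def
proof (intro allI impI)
  fix e :: real assume e: "0 < e"
  obtain K where K: "K > 0" "\<And>z. cmod z = 1 \<Longrightarrow> cmod (g z) \<le> K"
    using fir_approximable_bounded[OF g] by blast
  obtain q where q: "\<And>z. cmod z = 1 \<Longrightarrow> cmod (h z - poly q (inverse z)) \<le> e / (2 * K)"
    using h e K(1) unfolding fir_approximable_def by (metis divide_pos_pos mult_pos_pos zero_less_numeral)
  obtain L where L: "L > 0" "\<And>z. cmod z = 1 \<Longrightarrow> cmod (poly q (inverse z)) \<le> L"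
    using fir_approximable_bounded[OF fir_approximable_poly] by blast
  obtain p where p: "\<And>z. cmod z = 1 \<Longrightarrow> cmod (g z - poly p (inverse z)) \<le> e / (2 * L)"
    using g e L(1) unfolding fir_approximable_def by (metis divide_pos_pos mult_pos_pos zero_less_numeral)
  have "cmod (g z * h z - poly (p * q) (inverse z)) \<le> e" if z: "cmod z = 1" for z
  proof -
    have "g z * h z - poly (p * q) (inverse z)
        = g z * (h z - poly q (inverse z)) + (g z - poly p (inverse z)) * poly q (inverse z)"
      by (simp add: algebra_simps)
    also have "cmod \<dots> \<le> K * (e / (2 * K)) + e / (2 * L) * L"
      by (intro order_trans[OF norm_triangle_ineq] add_mono)
        (use K L p[OF z] q[OF z] e in \<open>auto simp only: norm_mult intro!: mult_mono K(2)[OF z] L(2)[OF z]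
          norm_ge_zero divide_nonneg_pos less_imp_le[OF e] mult_pos_pos zero_less_numeral\<close>)
    finally show ?thesis using K(1) L(1) by simp
  qed
  then show "\<exists>p. \<forall>z. cmod z = 1 \<longrightarrow> cmod (g z * h z - poly p (inverse z)) \<le> e" by blast
qed

lemma fir_approximable_first_order:
  assumes a: "cmod a < 1"
  shows "fir_approximable (\<lambda>z. 1 / (1 - a * inverse z))"
  unfolding fir_approximable_def
proof (intro allI impI)
  fix e :: real assume e: "0 < e"
  then have "0 < e * (1 - cmod a)" using a by simp
  from real_arch_pow_inv[OF this a] obtain n where n: "cmod a ^ n < e * (1 - cmod a)" by blast
  let ?p = "\<Sum>k<n. monom (a ^ k) k"
  have "cmod (1 / (1 - a * inverse z) - poly ?p (inverse z)) \<le> e" if z: "cmod z = 1" for z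
  proof -
    let ?x = "a * inverse z"
    have nx: "cmod ?x = cmod a" using z by (simp add: norm_mult norm_inverse)
    have p: "poly ?p (inverse z) = (\<Sum>k<n. ?x ^ k)"
      by (simp add: poly_sum poly_monom power_mult_distrib power_inverse)
    have x1: "?x \<noteq> 1" using nx a by auto
    have "1 / (1 - x) - (\<Sum>k<n. x ^ k) = x ^ n / (1 - x)" if "x \<noteq> 1" for x :: complex
      using that by (simp add: sum_gp_strict diff_divide_distrib)
    from this[OF x1] have "1 / (1 - ?x) - (\<Sum>k<n. ?x ^ k) = ?x ^ n / (1 - ?x)" .
    moreover have "1 - cmod a \<le> cmod (1 - ?x)" using norm_triangle_ineq2[of 1 ?x] nx by simp
    ultimately have "cmod (1 / (1 - ?x) - (\<Sum>k<n. ?x ^ k)) \<le> cmod a ^ n / (1 - cmod a)"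
      using a by (simp add: norm_divide norm_power nx frac_le del: norm_inverse)
    also have "\<dots> \<le> e" using n a by (simp add: pos_divide_le_eq)
    finally show ?thesis unfolding p .
  qed
  then show "\<exists>p. \<forall>z. cmod z = 1 \<longrightarrow> cmod (1 / (1 - a * inverse z) - poly p (inverse z)) \<le> e" by blast
qed

text \<open>
  Up to a constant the function is the product of the factors \<open>1 / (1 - a/z)\<close> over the roots \<open>a\<close>, each
  of which is a convergent geometric series in \<open>1/z\<close>.
\<close>

lemma fir_approximable_inverse_poly:
  assumes "q \<noteq> 0" "\<And>z. poly q z = 0 \<Longrightarrow> cmod z < 1"
  shows "fir_approximable (\<lambda>z. z ^ degree q / poly q z)"
  using assms
proof (induction "degree q" arbitrary: q)
  case 0
  then obtain c where q: "q = [:c:]" "c \<noteq> 0" by (metis degree_eq_zeroE pCons_0_0)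
  show ?case using fir_approximable_poly[of "[:1 / c:]"] by (simp add: q)
next
  case (Suc d)
  then obtain a where a: "poly q a = 0"
    using Fundamental_Theorem_Algebra.fundamental_theorem_of_algebra[of q] constant_degree[of q] by auto
  then obtain r where r: "q = [:- a, 1:] * r" by (auto simp: poly_eq_0_iff_dvd)
  then have r0: "r \<noteq> 0" using Suc.prems(1) by auto
  have qz: "poly q z = (z - a) * poly r z" for z by (simp add: r algebra_simps)
  have dr: "degree q = Suc (degree r)" unfolding r using r0 by (subst degree_mult_eq) simp_all
  have "fir_approximable (\<lambda>z. z ^ degree r / poly r z)"
    using Suc.prems(2) dr Suc.hyps(2) r0 by (intro Suc.hyps(1)) (auto simp: r)
  from fir_approximable_mult[OF fir_approximable_first_order[OF Suc.prems(2)[OF a]] this]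
  show ?case
  proof (subst (asm) fir_approximable_cong)
    fix z :: complex assume z: "cmod z = 1"
    then have "z \<noteq> 0" "z \<noteq> a" using Suc.prems(2)[OF a] by auto
    then have "1 / (1 - a * inverse z) = z / (z - a)" by (simp add: divide_simps)
    then show "1 / (1 - a * inverse z) * (z ^ degree r / poly r z) = z ^ degree q / poly q z"
      using \<open>z \<noteq> a\<close> dr qz by simp
  qed
qed

lemma poly_le_degree_sum:
  fixes p :: "'a::comm_semiring_1 poly"
  assumes "degree p \<le> d"
  shows "poly p x = (\<Sum>i\<le>d. coeff p i * x ^ i)"
  unfolding poly_altdef using assms
  by (intro sum.mono_neutral_left) (auto simp: coeff_eq_0)

lemma fir_approximable_fraction:
  assumes q: "q \<noteq> 0" "\<And>z. poly q z = 0 \<Longrightarrow> cmod z < 1" and d: "degree p \<le> degree q"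
  shows "fir_approximable (\<lambda>z. poly p z / poly q z)"
proof -
  let ?d = "degree q"
  let ?r = "\<Sum>i\<le>?d. monom (coeff p i) (?d - i)"
  have "fir_approximable (\<lambda>z. poly ?r (inverse z) * (z ^ ?d / poly q z))"
    by (intro fir_approximable_mult fir_approximable_poly fir_approximable_inverse_poly q)
  then show ?thesis
  proof (subst (asm) fir_approximable_cong)
    fix z :: complex assume "cmod z = 1"
    then have z0: "z \<noteq> 0" by auto
    have "poly ?r (inverse z) * z ^ ?d = (\<Sum>i\<le>?d. coeff p i * z ^ i)"
      unfolding poly_sum poly_monom sum_distrib_right
    proof (rule sum.cong)
      fix i assume "i \<in> {..?d}"
      then have "z ^ ?d = z ^ (?d - i) * z ^ i" by (simp flip: power_add)
      then show "coeff p i * inverse z ^ (?d - i) * z ^ ?d = coeff p i * z ^ i"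
        using z0 by (simp add: power_inverse)
    qed simp
    then have "poly ?r (inverse z) * z ^ ?d = poly p z" using poly_le_degree_sum[OF d] by simp
    then show "poly ?r (inverse z) * (z ^ ?d / poly q z) = poly p z / poly q z" by simp
  qed
qed

lemma cev_map_Re: "cev w (map_poly Re p) = (poly p w + cnj (poly p (cnj w))) / 2"
proof (induction p)
  case (pCons a p)
  have "complex_of_real (Re a) = (a + cnj a) / 2" by (simp add: complex_add_cnj)
  then show ?case using pCons by (simp add: map_poly_pCons cev_pCons field_simps)
qed simp

lemma cev_cnj: "cev (cnj z) p = cnj (cev z p)"
  by (induction p) (auto simp: cev_pCons)

text \<open>
  A rational function with real coefficients commutes with conjugation, so averaging an approximation
  with its mirror image makes the coefficients real and does not increase the error.
\<close>

lemma real_fir_approximation: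
  assumes "proper f" "poles f \<subseteq> ball 0 1" "0 < e"
  shows "\<exists>p. \<forall>z. cmod z = 1 \<longrightarrow> cmod (rat_eval f z - cev (inverse z) p) \<le> e"
proof -
  have q0: "map_poly complex_of_real (rden f) \<noteq> 0"
    using rden_nonzero[of f] by (metis map_poly_eq_0_iff of_real_0 of_real_eq_0_iff)
  have "fir_approximable (rat_eval f)"
    unfolding rat_eval_def
    using assms(1,2) q0 by (intro fir_approximable_fraction)
      (auto simp: poles_def proper_def degree_map_poly)
  then obtain p where p: "\<And>z. cmod z = 1 \<Longrightarrow> cmod (rat_eval f z - poly p (inverse z)) \<le> e"
    using assms(3) unfolding fir_approximable_def by blast
  have "cmod (rat_eval f z - cev (inverse z) (map_poly Re p)) \<le> e" if z: "cmod z = 1" for z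
  proof -
    have "rat_eval f (cnj z) = cnj (rat_eval f z)" by (simp add: rat_eval_def cev_cnj)
    then have "rat_eval f z - cev (inverse z) (map_poly Re p)
       = ((rat_eval f z - poly p (inverse z))
          + cnj (rat_eval f (cnj z) - poly p (inverse (cnj z)))) / 2"
      by (simp add: cev_map_Re field_simps)
    also have "cmod \<dots> \<le> (e + e) / 2"
      unfolding norm_divide using p[of z] p[of "cnj z"] z
      by (intro divide_mono order_trans[OF norm_triangle_ineq] add_mono) (simp_all del: complex_cnj_diff)
    finally show ?thesis by simp
  qed
  then show ?thesis by blast
qed

definition fir_eval :: "nat \<Rightarrow> (nat \<Rightarrow> real^'c^'r) \<Rightarrow> complex \<Rightarrow> complex^'c^'r" where
  "fir_eval d f z = (\<Sum>k\<le>d. mat (inverse z ^ k) ** cmat (f k))"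

lemma fir_eval_nth: "fir_eval d f z $ i $ j = (\<Sum>k\<le>d. inverse z ^ k * of_real (f k $ i $ j))"
  by (simp add: fir_eval_def mat_scalar_mult)

lemma fir_approximation:
  fixes F :: "ratfun^'c^'r"
  assumes F: "F \<in> RH_inf" and e: "0 < e"
  shows "\<exists>d f. gain_le (\<lambda>z. tm_eval F z - fir_eval d f z) e"
proof -
  let ?n = "real (CARD('r) * CARD('c))"
  have n: "0 < ?n" by simp
  have "\<exists>p. \<forall>z. cmod z = 1 \<longrightarrow> cmod (rat_eval (F $ i $ j) z - cev (inverse z) p) \<le> e / ?n" for i j
    using F e n by (intro real_fir_approximation divide_pos_pos) (simp_all add: RH_inf_def)
  then obtain p where p:
    "\<And>i j z. cmod z = 1 \<Longrightarrow> cmod (rat_eval (F $ i $ j) z - cev (inverse z) (p i j)) \<le> e / ?n"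
    by metis
  define d where "d = (\<Sum>i\<in>UNIV. \<Sum>j\<in>UNIV. degree (p i j))"
  have d: "degree (p i j) \<le> d" for i j
  proof -
    have "degree (p i j) \<le> (\<Sum>j\<in>UNIV. degree (p i j))" by (rule member_le_sum) auto
    also have "\<dots> \<le> d" unfolding d_def
      by (rule member_le_sum[of i UNIV "\<lambda>i. \<Sum>j\<in>UNIV. degree (p i j)"]) auto
    finally show ?thesis .
  qed
  define f where "f k = (\<chi> i j. coeff (p i j) k)" for k
  have ev: "fir_eval d f z $ i $ j = cev (inverse z) (p i j)" for z i j
  proof -
    have "degree (map_poly complex_of_real (p i j)) \<le> d" using d by (simp add: degree_map_poly)
    from poly_le_degree_sum[OF this, of "inverse z"] show ?thesis
      by (simp add: fir_eval_nth f_def coeff_map_poly mult.commute)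
  qed
  have "norm ((tm_eval F z - fir_eval d f z) *v v) \<le> e * norm v" if z: "cmod z = 1" for z v
  proof -
    have "norm ((tm_eval F z - fir_eval d f z) *v v)
        \<le> (\<Sum>i\<in>(UNIV::'r set). \<Sum>j\<in>(UNIV::'c set). e / ?n) * norm v"
      using p[OF z]
      by (intro order_trans[OF norm_matrix_vector_le] mult_right_mono sum_mono)
        (simp_all add: ev tm_eval_def)
    then show ?thesis by simp
  qed
  then show ?thesis unfolding gain_le_def by blast
qed

section \<open>Frequency-domain bounds for finite-horizon costs\<close>

lemma roots_of_unity_orthogonal:
  fixes N :: nat
  defines "w \<equiv> exp (2 * of_real pi * \<i> / of_nat N)"
  assumes "t < N" "s < N"
  shows "(\<Sum>k<N. inverse (w ^ k) ^ t * (w ^ k) ^ s) = (if t = s then of_nat N else 0)"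
proof -
  have N: "N \<noteq> 0" using assms by auto
  have w0: "w \<noteq> 0" by (simp add: w_def)
  have pw: "w ^ j = exp (2 * of_real pi * \<i> * of_nat j / of_nat N)" for j
    unfolding w_def exp_of_nat_mult[symmetric] by (simp add: field_simps)
  let ?a = "inverse (w ^ t) * w ^ s"
  have "inverse (w ^ k) ^ t * (w ^ k) ^ s = ?a ^ k" for k
    by (simp add: power_mult_distrib power_inverse power_mult[symmetric] mult.commute)
  then have e: "(\<Sum>k<N. inverse (w ^ k) ^ t * (w ^ k) ^ s) = (\<Sum>k<N. ?a ^ k)" by simp
  have wN: "w ^ N = 1" using N by (simp add: pw)
  have "?a ^ N = inverse ((w ^ N) ^ t) * (w ^ N) ^ s"
    by (simp add: power_mult_distrib power_inverse power_mult[symmetric] mult.commute)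
  then have aN: "?a ^ N = 1" by (simp add: wN)
  have "?a = 1 \<longleftrightarrow> w ^ s = w ^ t" using w0 by (simp add: field_simps)
  also have "\<dots> \<longleftrightarrow> s = t"
    unfolding pw using assms(2,3) complex_root_unity_eq[of N s t] N by simp
  finally have a1: "?a = 1 \<longleftrightarrow> t = s" by auto
  show ?thesis
  proof (cases "t = s")
    case True
    then show ?thesis using a1 e by simp
  next
    case False
    then have "?a \<noteq> 1" using a1 by simp
    then have "(\<Sum>k<N. ?a ^ k) = 0" by (simp add: sum_gp_strict aN)
    then show ?thesis using False e by simp
  qed
qed

lemma parseval_scalar:
  fixes a :: "nat \<Rightarrow> complex" and N :: nat
  defines "w \<equiv> exp (2 * of_real pi * \<i> / of_nat N)"
  shows "(\<Sum>k<N. (cmod (\<Sum>t<N. inverse (w ^ k) ^ t * a t))\<^sup>2) = real N * (\<Sum>t<N. (cmod (a t))\<^sup>2)"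
proof -
  have cw: "cnj (inverse (w ^ k)) = w ^ k" for k
  proof -
    have "w * cnj w = 1" unfolding w_def by (simp add: exp_cnj flip: exp_add)
    then have "w ^ k * cnj w ^ k = 1" by (simp flip: power_mult_distrib)
    then show ?thesis by (simp add: inverse_unique mult.commute)
  qed
  have "complex_of_real (\<Sum>k<N. (cmod (\<Sum>t<N. inverse (w ^ k) ^ t * a t))\<^sup>2)
      = (\<Sum>k<N. (\<Sum>t<N. inverse (w ^ k) ^ t * a t) * (\<Sum>s<N. (w ^ k) ^ s * cnj (a s)))"
    by (simp add: complex_norm_square cw[simplified] cnj_sum del: of_real_power)
  also have "\<dots> = (\<Sum>k<N. \<Sum>t<N. \<Sum>s<N. (inverse (w ^ k) ^ t * (w ^ k) ^ s) * (a t * cnj (a s)))"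
    by (simp add: sum_product ac_simps)
  also have "\<dots> = (\<Sum>t<N. \<Sum>s<N. (\<Sum>k<N. inverse (w ^ k) ^ t * (w ^ k) ^ s) * (a t * cnj (a s)))"
    unfolding sum_distrib_right by (subst sum.swap, rule sum.cong[OF refl], rule sum.swap)
  also have "\<dots> = (\<Sum>t<N. \<Sum>s<N. (if t = s then of_nat N else 0) * (a t * cnj (a s)))"
    using roots_of_unity_orthogonal[of _ N] by (intro sum.cong) (auto simp: w_def)
  also have "\<dots> = (\<Sum>t<N. of_nat N * (a t * cnj (a t)))"
    by (simp add: if_distrib[of "\<lambda>x. x * _"] cong: if_cong)
  also have "\<dots> = complex_of_real (real N * (\<Sum>t<N. (cmod (a t))\<^sup>2))"
    by (simp add: complex_norm_square sum_distrib_left del: of_real_power)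
  finally show ?thesis by (simp only: of_real_eq_iff)
qed

definition dft :: "nat \<Rightarrow> complex \<Rightarrow> (nat \<Rightarrow> complex^'n) \<Rightarrow> complex^'n" where
  "dft N z a = (\<Sum>t<N. inverse z ^ t *s a t)"

lemma norm_vec_power2: "(norm v)\<^sup>2 = (\<Sum>i\<in>UNIV. (cmod (v $ i))\<^sup>2)" for v :: "complex^'n"
  unfolding norm_vec_def L2_set_def by (simp add: sum_nonneg)

lemma parseval:
  fixes a :: "nat \<Rightarrow> complex^'n" and N :: nat
  defines "w \<equiv> exp (2 * of_real pi * \<i> / of_nat N)"
  shows "(\<Sum>k<N. (norm (dft N (w ^ k) a))\<^sup>2) = real N * (\<Sum>t<N. (norm (a t))\<^sup>2)"
proof -
  have "(\<Sum>k<N. (norm (dft N (w ^ k) a))\<^sup>2)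
      = (\<Sum>i\<in>UNIV. \<Sum>k<N. (cmod (\<Sum>t<N. inverse (w ^ k) ^ t * a t $ i))\<^sup>2)"
    unfolding norm_vec_power2 by (subst sum.swap) (simp add: dft_def)
  also have "\<dots> = (\<Sum>i\<in>UNIV. real N * (\<Sum>t<N. (cmod (a t $ i))\<^sup>2))"
    unfolding w_def parseval_scalar ..
  also have "\<dots> = real N * (\<Sum>t<N. (norm (a t))\<^sup>2)"
    unfolding norm_vec_power2 sum_distrib_left[symmetric] by (subst sum.swap) simp
  finally show ?thesis .
qed

lemma matrix_vector_mult_sum: "M *v (\<Sum>i\<in>I. g i) = (\<Sum>i\<in>I. M *v g i)"
  by (induction I rule: infinite_finite_induct) (simp_all add: matrix_vector_right_distrib)

lemma dft_matrix: "dft N z (\<lambda>t. M *v a t) = M *v dft N z a"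
  by (simp add: dft_def matrix_vector_mult_sum vector_scalar_commute)

lemma dft_add: "dft N z (\<lambda>t. a t + b t) = dft N z a + dft N z b"
  by (simp add: dft_def vector_add_ldistrib sum.distrib)

lemma dft_diff: "dft N z (\<lambda>t. a t - b t) = dft N z a - dft N z b"
  by (simp add: dft_def vector_ssub_ldistrib sum_subtractf)

text \<open>
  Since \<open>a\<close> is not periodic, the shift is multiplication by \<open>z\<close> only up to a boundary term.
\<close>

lemma dft_shift:
  assumes "z ^ N = 1" "z \<noteq> 0"
  shows "dft N z (\<lambda>t. a (Suc t)) = z *s (dft N z a - a 0 + a N)"
proof -
  let ?g = "\<lambda>t. inverse z ^ t *s a t"
  have "inverse z ^ N = 1" using assms(1) by (simp add: power_inverse)
  then have e: "(\<Sum>t<N. ?g (Suc t)) = dft N z a - a 0 + a N"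
    using sum.lessThan_Suc_shift[of ?g N] by (simp add: dft_def algebra_simps)
  have "dft N z (\<lambda>t. a (Suc t)) = (\<Sum>t<N. z *s ?g (Suc t))"
    unfolding dft_def
  proof (rule sum.cong)
    fix t
    have "z * inverse z ^ Suc t = inverse z ^ t" using assms(2) by simp
    then show "inverse z ^ t *s a (Suc t) = z *s ?g (Suc t)"
      by (simp only: vector_smult_assoc)
  qed simp
  then show ?thesis unfolding vec.scale_sum_right[symmetric] e .
qed

definition fir_response :: "nat \<Rightarrow> (nat \<Rightarrow> real^'c^'r) \<Rightarrow> (nat \<Rightarrow> real^'c) \<Rightarrow> nat \<Rightarrow> real^'r" where
  "fir_response d f w t = (\<Sum>k\<le>d. if k \<le> t then f k *v w (t - k) else 0)"

lemma cvec_add: "cvec (x + y) = cvec x + cvec y"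
  and cvec_diff: "cvec (x - y) = cvec x - cvec y"
  and vec_lambda_0: "(\<chi> i. 0) = (0 :: complex^'n)"
  and cvec_sum: "cvec (\<Sum>i\<in>I. g i) = (\<Sum>i\<in>I. cvec (g i))"
  by (simp_all add: vec_eq_iff)

text \<open>
  The last \<open>d\<close> samples of \<open>w\<close> in the period vanish, so the response does not wrap around.
\<close>

lemma dft_fir_response:
  assumes w: "\<And>t. T \<le> t \<Longrightarrow> w t = 0" and N: "T + d \<le> N"
  shows "dft N z (\<lambda>t. cvec (fir_response d f w t)) = fir_eval d f z *v dft N z (\<lambda>t. cvec (w t))"
proof -
  let ?g = "\<lambda>k t. inverse z ^ t *s (cmat (f k) *v cvec (w (t - k)))"
  have inner: "(\<Sum>t<N. if k \<le> t then ?g k t else 0)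
      = (mat (inverse z ^ k) ** cmat (f k)) *v dft N z (\<lambda>t. cvec (w t))" if k: "k \<le> d" for k
  proof -
    have "(\<Sum>t<N. if k \<le> t then ?g k t else 0) = (\<Sum>t\<in>{k..<N}. ?g k t)"
      by (simp add: sum.If_cases) (rule sum.cong, auto)
    also have "\<dots> = (\<Sum>s<N - k. ?g k (k + s))"
      by (simp add: sum.atLeastLessThan_shift_0[of _ k N] atLeast0LessThan)
    also have "\<dots> = (\<Sum>s<N. inverse z ^ (k + s) *s (cmat (f k) *v cvec (w s)))"
    proof (rule sum.mono_neutral_cong_left)
      show "\<forall>s\<in>{..<N} - {..<N - k}. inverse z ^ (k + s) *s (cmat (f k) *v cvec (w s)) = 0"
      proof
        fix s assume "s \<in> {..<N} - {..<N - k}"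
        then have "w s = 0" using N k by (intro w) auto
        then have "cmat (f k) *v cvec (w s) = 0" unfolding cmat_mult_cvec
          by (simp add: \<open>w s = 0\<close> vec_eq_iff)
        then show "inverse z ^ (k + s) *s (cmat (f k) *v cvec (w s)) = 0" by simp
      qed
    qed auto
    also have "\<dots> = inverse z ^ k *s dft N z (\<lambda>t. cmat (f k) *v cvec (w t))"
      by (simp add: dft_def power_add vec.scale_sum_right)
    also have "\<dots> = (mat (inverse z ^ k) ** cmat (f k)) *v dft N z (\<lambda>t. cvec (w t))"
      by (simp add: dft_matrix mat_scalar_mult)
        (simp add: vec_eq_iff matrix_vector_mult_def sum_distrib_left ac_simps)
    finally show ?thesis .
  qed
  have "dft N z (\<lambda>t. cvec (fir_response d f w t))
      = (\<Sum>t<N. \<Sum>k\<le>d. if k \<le> t then ?g k t else 0)"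
    unfolding dft_def fir_response_def cvec_sum vec.scale_sum_right
    by (intro sum.cong refl) (simp add: cmat_mult_cvec vec_lambda_0)
  also have "\<dots> = (\<Sum>k\<le>d. (mat (inverse z ^ k) ** cmat (f k)) *v dft N z (\<lambda>t. cvec (w t)))"
    by (subst sum.swap) (simp add: inner)
  also have "\<dots> = fir_eval d f z *v dft N z (\<lambda>t. cvec (w t))"
    unfolding fir_eval_def
    by (induction d) (simp_all add: matrix_vector_mult_add_rdistrib)
  finally show ?thesis .
qed

primrec trajectory :: "real^'n^'n \<Rightarrow> (nat \<Rightarrow> real^'n) \<Rightarrow> real^'n \<Rightarrow> nat \<Rightarrow> real^'n" where
  "trajectory A b x0 0 = x0"
| "trajectory A b x0 (Suc t) = A *v trajectory A b x0 t + b t"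

lemma trajectory_cong:
  "(\<And>s. s < t \<Longrightarrow> b s = c s) \<Longrightarrow> trajectory A b x0 t = trajectory A c x0 t"
  by (induction t) auto

lemma trajectory_free:
  "(\<And>t. T \<le> t \<Longrightarrow> b t = 0) \<Longrightarrow> trajectory A b x0 (T + k) = ((*v) A ^^ k) (trajectory A b x0 T)"
  by (induction k) auto

lemma trajectory_tendsto_zero:
  assumes "schur_stable A" "\<And>t. T \<le> t \<Longrightarrow> b t = 0"
  shows "trajectory A b x0 \<longlonglongrightarrow> 0"
proof -
  have "(\<lambda>k. trajectory A b x0 (k + T)) \<longlonglongrightarrow> 0"
    using schur_stable_powers[OF assms(1)] trajectory_free[of T b, OF assms(2)]
    by (simp add: add.commute)
  then show ?thesis by (rule LIMSEQ_offset)
qed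

lemma norm_add_power2_le:
  fixes x y :: "'a::real_normed_vector"
  assumes "0 < h" "norm x \<le> a" "norm y \<le> b"
  shows "(norm (x + y))\<^sup>2 \<le> (1 + h) * a\<^sup>2 + (1 + 1 / h) * b\<^sup>2"
proof -
  have "0 \<le> (h * a - b)\<^sup>2 / h" using assms(1) by simp
  also have "(h * a - b)\<^sup>2 / h = h * a\<^sup>2 - 2 * a * b + b\<^sup>2 / h"
    using assms(1) by (simp add: power2_eq_square field_simps)
  finally have "2 * a * b \<le> h * a\<^sup>2 + b\<^sup>2 / h" by simp
  moreover have "(norm (x + y))\<^sup>2 \<le> (a + b)\<^sup>2"
    using norm_triangle_ineq[of x y] assms by (intro power_mono) auto
  ultimately show ?thesis by (simp add: power2_eq_square algebra_simps)
qed

text \<open>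
  The vector \<open>\<delta>\<close> is the boundary term of \<open>dft_shift\<close>. The slack between the gains and \<open>g\<close> pays for
  separating its contribution from that of \<open>W\<close> by Young's inequality with parameter \<open>h\<close>.
\<close>

lemma frequency_domain_cost_bound:
  fixes F :: "complex \<Rightarrow> complex^'r^'m"
  assumes A: "schur_stable A"
    and gy: "gain_le (\<lambda>z. cmat C ** matrix_inv (mat z - cmat A) ** (cmat B1 ** F z - cmat B2)
               + (cmat D1 ** F z - cmat D2)) sy"
    and gx: "gain_le (\<lambda>z. matrix_inv (mat z - cmat A) ** (cmat B1 ** F z - cmat B2)) sx"
    and gu: "gain_le F su"
    and s: "sy\<^sup>2 + e\<^sup>2 * (sx\<^sup>2 + su\<^sup>2) < g\<^sup>2"
  shows "\<exists>c. \<forall>z X W \<delta>. cmod z = 1 \<longrightarrow>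
      (mat z - cmat A) *v X = cmat B1 *v (F z *v W) - cmat B2 *v W + z *s \<delta> \<longrightarrow>
      (norm (cmat C *v X + cmat D1 *v (F z *v W) - cmat D2 *v W))\<^sup>2
        + e\<^sup>2 * (norm X)\<^sup>2 + e\<^sup>2 * (norm (F z *v W))\<^sup>2 \<le> g\<^sup>2 * (norm W)\<^sup>2 + c * (norm \<delta>)\<^sup>2"
proof -
  define H where "H = sy\<^sup>2 + e\<^sup>2 * (sx\<^sup>2 + su\<^sup>2)"
  have H: "0 \<le> H" "H < g\<^sup>2" using s by (simp_all add: H_def)
  define h where "h = (g\<^sup>2 - H) / (H + 1)"
  have h: "0 < h" using H by (simp add: h_def)
  have "(g\<^sup>2 - H) * H \<le> (g\<^sup>2 - H) * (H + 1)" using H by (intro mult_left_mono) auto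
  then have "h * H \<le> g\<^sup>2 - H" using H by (simp add: h_def pos_divide_le_eq mult.commute)
  then have hH: "(1 + h) * H \<le> g\<^sup>2" by (simp add: algebra_simps)
  let ?R = "\<lambda>z. matrix_inv (mat z - cmat A)"
  obtain KR where KR: "0 \<le> KR" "gain_le ?R KR" using gain_le_resolvent[OF A] by blast
  obtain KC where KC: "0 \<le> KC" "gain_le (\<lambda>z. cmat C) KC" using gain_le_cmat by blast
  show ?thesis
  proof (intro exI[of _ "(1 + 1 / h) * ((KC * KR)\<^sup>2 + e\<^sup>2 * KR\<^sup>2)"] allI impI)
    fix z X W \<delta> assume z: "cmod z = 1"
      and eq: "(mat z - cmat A) *v X = cmat B1 *v (F z *v W) - cmat B2 *v W + z *s \<delta>"
    let ?U = "F z *v W" and ?Y = "cmat C *v X + cmat D1 *v (F z *v W) - cmat D2 *v W"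
    let ?x = "(?R z ** (cmat B1 ** F z - cmat B2)) *v W" and ?\<delta> = "?R z *v (z *s \<delta>)"
    let ?y = "(cmat C ** ?R z ** (cmat B1 ** F z - cmat B2) + (cmat D1 ** F z - cmat D2)) *v W"
    have inv: "invertible (mat z - cmat A)" using schur_stable_resolvent[OF A] z by simp
    have "X = (?R z ** (mat z - cmat A)) *v X" by (simp add: matrix_inv_left[OF inv])
    also have "\<dots> = ?R z *v (cmat B1 *v ?U - cmat B2 *v W + z *s \<delta>)"
      unfolding eq[symmetric] by (simp add: matrix_vector_mul_assoc)
    also have "\<dots> = ?x + ?\<delta>"
      by (simp add: matrix_vector_right_distrib matrix_vector_mult_diff_rdistrib
          flip: matrix_vector_mul_assoc)
    finally have X: "X = ?x + ?\<delta>" .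
    have Y: "?Y = ?y + cmat C *v ?\<delta>"
      unfolding X by (simp add: matrix_vector_right_distrib matrix_vector_mult_diff_rdistrib
          matrix_vector_mult_add_rdistrib flip: matrix_vector_mul_assoc)
    have n\<delta>: "norm ?\<delta> \<le> KR * norm \<delta>"
      using KR(2) z unfolding gain_le_def by (metis mult_1 norm_smult_complex)
    have "norm (cmat C *v ?\<delta>) \<le> KC * norm ?\<delta>" using KC(2) z unfolding gain_le_def by blast
    also have "\<dots> \<le> KC * (KR * norm \<delta>)" using n\<delta> KC(1) by (rule mult_left_mono)
    finally have nC: "norm (cmat C *v ?\<delta>) \<le> KC * (KR * norm \<delta>)" .
    have nx: "norm ?x \<le> sx * norm W" using gx z unfolding gain_le_def by blast
    have ny: "norm ?y \<le> sy * norm W" using gy z unfolding gain_le_def by blast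
    have nu: "norm ?U \<le> su * norm W" using gu z unfolding gain_le_def by blast
    have 1: "(norm ?Y)\<^sup>2 \<le> (1 + h) * (sy * norm W)\<^sup>2 + (1 + 1 / h) * (KC * (KR * norm \<delta>))\<^sup>2"
      unfolding Y by (rule norm_add_power2_le[OF h ny nC])
    have 2: "(norm X)\<^sup>2 \<le> (1 + h) * (sx * norm W)\<^sup>2 + (1 + 1 / h) * (KR * norm \<delta>)\<^sup>2"
      by (subst X) (rule norm_add_power2_le[OF h nx n\<delta>])
    have "(norm ?U)\<^sup>2 \<le> (su * norm W)\<^sup>2" using nu by (intro power_mono) auto
    also have "\<dots> \<le> (1 + h) * (su * norm W)\<^sup>2" using h by (simp add: mult_right_mono distrib_right)
    finally have 3: "(norm ?U)\<^sup>2 \<le> (1 + h) * (su * norm W)\<^sup>2" .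
    have "(norm ?Y)\<^sup>2 + e\<^sup>2 * (norm X)\<^sup>2 + e\<^sup>2 * (norm ?U)\<^sup>2
       \<le> ((1 + h) * (sy * norm W)\<^sup>2 + (1 + 1 / h) * (KC * (KR * norm \<delta>))\<^sup>2)
         + e\<^sup>2 * ((1 + h) * (sx * norm W)\<^sup>2 + (1 + 1 / h) * (KR * norm \<delta>)\<^sup>2)
         + e\<^sup>2 * ((1 + h) * (su * norm W)\<^sup>2)"
      using 1 2 3 by (intro add_mono mult_left_mono) auto
    also have "\<dots> = ((1 + h) * H) * (norm W)\<^sup>2
         + (1 + 1 / h) * ((KC * KR)\<^sup>2 + e\<^sup>2 * KR\<^sup>2) * (norm \<delta>)\<^sup>2"
      unfolding H_def power_mult_distrib by (simp add: distrib_left distrib_right ac_simps)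
    also have "\<dots> \<le> g\<^sup>2 * (norm W)\<^sup>2
         + (1 + 1 / h) * ((KC * KR)\<^sup>2 + e\<^sup>2 * KR\<^sup>2) * (norm \<delta>)\<^sup>2"
      using mult_right_mono[OF hH zero_le_power2[of "norm W"]] by simp
    finally show "(norm ?Y)\<^sup>2 + e\<^sup>2 * (norm X)\<^sup>2 + e\<^sup>2 * (norm ?U)\<^sup>2 \<le> g\<^sup>2 * (norm W)\<^sup>2
         + (1 + 1 / h) * ((KC * KR)\<^sup>2 + e\<^sup>2 * KR\<^sup>2) * (norm \<delta>)\<^sup>2" .
  qed
qed

text \<open>
  The penalties with weight \<open>e\<^sup>2\<close> make the minimization over \<open>u\<close> coercive and the value of the game
  positive definite.
\<close>

definition stage_cost ::
  "real^'n^'p \<Rightarrow> real^'m^'p \<Rightarrow> real^'r^'p \<Rightarrow> real \<Rightarrow> real \<Rightarrow> real^'n \<Rightarrow> real^'r \<Rightarrow> real^'m \<Rightarrow> real" where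
  "stage_cost C D1 D2 e g x w u =
     (norm (C *v x + D1 *v u - D2 *v w))\<^sup>2 + e\<^sup>2 * (norm x)\<^sup>2 + e\<^sup>2 * (norm u)\<^sup>2 - g\<^sup>2 * (norm w)\<^sup>2"

text \<open>
  Let \<open>w\<close> vanish from time \<open>T\<close> on, which leaves the first \<open>T\<close> costs unchanged and makes the later ones
  nonnegative. Parseval's identity over a period \<open>N\<close> bounds the cost by the boundary term, that is by
  a multiple of \<open>(norm (x0 - x N))\<^sup>2\<close>, and \<open>x N\<close> tends to zero as \<open>N\<close> grows.
\<close>

lemma fir_cost_bound:
  fixes A :: "real^'n^'n" and B1 :: "real^'m^'n" and B2 :: "real^'r^'n"
    and C :: "real^'n^'p" and D1 :: "real^'m^'p" and D2 :: "real^'r^'p"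
    and f :: "nat \<Rightarrow> real^'r^'m"
  assumes A: "schur_stable A"
    and gy: "gain_le (\<lambda>z. cmat C ** matrix_inv (mat z - cmat A) ** (cmat B1 ** fir_eval d f z - cmat B2)
               + (cmat D1 ** fir_eval d f z - cmat D2)) sy"
    and gx: "gain_le (\<lambda>z. matrix_inv (mat z - cmat A) ** (cmat B1 ** fir_eval d f z - cmat B2)) sx"
    and gu: "gain_le (fir_eval d f) su"
    and s: "sy\<^sup>2 + e\<^sup>2 * (sx\<^sup>2 + su\<^sup>2) < g\<^sup>2"
  shows "\<exists>c. \<forall>x0 w T. (\<Sum>t<T. stage_cost C D1 D2 e g
      (trajectory A (\<lambda>t. B1 *v fir_response d f w t - B2 *v w t) x0 t) (w t) (fir_response d f w t))
      \<le> c * (norm x0)\<^sup>2"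
proof -
  from frequency_domain_cost_bound[OF assms] obtain c where c: "\<And>z X W \<delta>. cmod z = 1 \<Longrightarrow>
      (mat z - cmat A) *v X = cmat B1 *v (fir_eval d f z *v W) - cmat B2 *v W + z *s \<delta> \<Longrightarrow>
      (norm (cmat C *v X + cmat D1 *v (fir_eval d f z *v W) - cmat D2 *v W))\<^sup>2
        + e\<^sup>2 * (norm X)\<^sup>2 + e\<^sup>2 * (norm (fir_eval d f z *v W))\<^sup>2
        \<le> g\<^sup>2 * (norm W)\<^sup>2 + c * (norm \<delta>)\<^sup>2"
    by blast
  define x where "x w x0 = trajectory A (\<lambda>t. B1 *v fir_response d f w t - B2 *v w t) x0" for w x0
  define cost where "cost w x0 t = stage_cost C D1 D2 e g (x w x0 t) (w t) (fir_response d f w t)"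
    for w x0 t
  have periodic: "(\<Sum>t<N. cost w x0 t) \<le> c * (norm (x0 - x w x0 N))\<^sup>2"
    if w: "\<And>t. T \<le> t \<Longrightarrow> w t = 0" and N: "T + d \<le> N" "0 < N" for w x0 T N
  proof -
    define \<omega> where "\<omega> = exp (2 * of_real pi * \<i> / of_nat N)"
    let ?u = "fir_response d f w"
    let ?y = "\<lambda>t. C *v x w x0 t + D1 *v ?u t - D2 *v w t"
    let ?\<delta> = "cvec (x0 - x w x0 N)"
    have wN: "\<omega> ^ N = 1" using N(2) unfolding \<omega>_def exp_of_nat_mult[symmetric] by simp
    have n\<omega>: "cmod \<omega> = 1" unfolding \<omega>_def by (simp add: norm_exp_eq_Re)
    have freq: "(norm (dft N (\<omega> ^ k) (\<lambda>t. cvec (?y t))))\<^sup>2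
        + e\<^sup>2 * (norm (dft N (\<omega> ^ k) (\<lambda>t. cvec (x w x0 t))))\<^sup>2
        + e\<^sup>2 * (norm (dft N (\<omega> ^ k) (\<lambda>t. cvec (?u t))))\<^sup>2
        \<le> g\<^sup>2 * (norm (dft N (\<omega> ^ k) (\<lambda>t. cvec (w t))))\<^sup>2 + c * (norm ?\<delta>)\<^sup>2" for k
    proof -
      let ?z = "\<omega> ^ k"
      let ?X = "dft N ?z (\<lambda>t. cvec (x w x0 t))" and ?W = "dft N ?z (\<lambda>t. cvec (w t))"
      have z1: "cmod ?z = 1" using n\<omega> by (simp add: norm_power)
      then have z0: "?z \<noteq> 0" by (metis norm_zero zero_neq_one)
      have zN: "?z ^ N = 1" using wN by (metis power_commutes power_mult power_one mult.commute)
      have U: "dft N ?z (\<lambda>t. cvec (?u t)) = fir_eval d f ?z *v ?W"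
        by (rule dft_fir_response[OF w N(1)])
      have Y: "dft N ?z (\<lambda>t. cvec (?y t))
          = cmat C *v ?X + cmat D1 *v (fir_eval d f ?z *v ?W) - cmat D2 *v ?W"
        unfolding U[symmetric] cvec_add cvec_diff cmat_mult_cvec[symmetric] dft_add dft_diff dft_matrix ..
      have "dft N ?z (\<lambda>t. cvec (x w x0 (Suc t)))
          = cmat A *v ?X + (cmat B1 *v (fir_eval d f ?z *v ?W) - cmat B2 *v ?W)"
        unfolding U[symmetric] x_def trajectory.simps cvec_add cvec_diff cmat_mult_cvec[symmetric]
          dft_add dft_diff dft_matrix ..
      moreover have "dft N ?z (\<lambda>t. cvec (x w x0 (Suc t))) = ?z *s (?X - ?\<delta>)"
      proof -
        have "x w x0 0 = x0" by (simp add: x_def)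
        then have "?X - cvec (x w x0 0) + cvec (x w x0 N) = ?X - ?\<delta>" unfolding cvec_diff by simp
        with dft_shift[OF zN z0, of "\<lambda>t. cvec (x w x0 t)"] show ?thesis by (simp only:)
      qed
      ultimately have "(mat ?z - cmat A) *v ?X
          = cmat B1 *v (fir_eval d f ?z *v ?W) - cmat B2 *v ?W + ?z *s ?\<delta>"
        by (simp add: mat_mult_vec matrix_vector_mult_diff_rdistrib vector_ssub_ldistrib algebra_simps)
      from c[OF z1 this] show ?thesis unfolding U Y .
    qed
    have "(\<Sum>k<N. (norm (dft N (\<omega> ^ k) (\<lambda>t. cvec (?y t))))\<^sup>2
        + e\<^sup>2 * (norm (dft N (\<omega> ^ k) (\<lambda>t. cvec (x w x0 t))))\<^sup>2
        + e\<^sup>2 * (norm (dft N (\<omega> ^ k) (\<lambda>t. cvec (?u t))))\<^sup>2)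
      \<le> (\<Sum>k<N. g\<^sup>2 * (norm (dft N (\<omega> ^ k) (\<lambda>t. cvec (w t))))\<^sup>2 + c * (norm ?\<delta>)\<^sup>2)"
      by (intro sum_mono freq)
    then have "real N * (\<Sum>t<N. (norm (?y t))\<^sup>2) + e\<^sup>2 * (real N * (\<Sum>t<N. (norm (x w x0 t))\<^sup>2))
          + e\<^sup>2 * (real N * (\<Sum>t<N. (norm (?u t))\<^sup>2))
        \<le> g\<^sup>2 * (real N * (\<Sum>t<N. (norm (w t))\<^sup>2)) + c * (real N * (norm ?\<delta>)\<^sup>2)"
      unfolding sum.distrib sum_distrib_left[symmetric] \<omega>_def parseval norm_cvec by simp
    then have "real N * (\<Sum>t<N. cost w x0 t) \<le> real N * (c * (norm (x0 - x w x0 N))\<^sup>2)"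
      unfolding cost_def stage_cost_def norm_cvec
      by (simp add: sum.distrib sum_subtractf sum_distrib_left[symmetric] algebra_simps)
    then show ?thesis using N(2) by simp
  qed
  have finite_support: "(\<Sum>t<T. cost w x0 t) \<le> c * (norm x0)\<^sup>2"
    if w: "\<And>t. T \<le> t \<Longrightarrow> w t = 0" for w x0 T
  proof -
    have u0: "fir_response d f w t = 0" if "T + d \<le> t" for t
      unfolding fir_response_def using that by (intro sum.neutral) (auto simp: w)
    have "x w x0 \<longlonglongrightarrow> 0"
      unfolding x_def by (rule trajectory_tendsto_zero[OF A, of "T + d"]) (simp add: u0 w)
    then have "(\<lambda>N. c * (norm (x0 - x w x0 N))\<^sup>2) \<longlonglongrightarrow> c * (norm (x0 - 0))\<^sup>2"
      by (intro tendsto_intros)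
    moreover have "(\<Sum>t<T. cost w x0 t) \<le> c * (norm (x0 - x w x0 N))\<^sup>2" if "Suc (T + d) \<le> N" for N
    proof -
      have "(\<Sum>t<T. cost w x0 t) \<le> (\<Sum>t<N. cost w x0 t)"
        using that w by (intro sum_mono2) (auto simp: cost_def stage_cost_def)
      also have "\<dots> \<le> c * (norm (x0 - x w x0 N))\<^sup>2" using that by (intro periodic[OF w]) auto
      finally show ?thesis .
    qed
    ultimately have "(\<Sum>t<T. cost w x0 t) \<le> c * (norm (x0 - 0))\<^sup>2"
      by (intro LIMSEQ_le_const) auto
    then show ?thesis by simp
  qed
  have "(\<Sum>t<T. cost w x0 t) \<le> c * (norm x0)\<^sup>2" for w x0 T
  proof -
    define w' where "w' t = (if t < T then w t else 0)" for t
    have u: "fir_response d f w' t = fir_response d f w t" if "t < T" for t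
      unfolding fir_response_def w'_def using that by (intro sum.cong) auto
    have "x w' x0 t = x w x0 t" if "t < T" for t
      unfolding x_def using that by (intro trajectory_cong) (simp add: u w'_def)
    then have "(\<Sum>t<T. cost w x0 t) = (\<Sum>t<T. cost w' x0 t)"
      by (intro sum.cong) (simp_all add: cost_def u w'_def)
    also have "\<dots> \<le> c * (norm x0)\<^sup>2" by (rule finite_support) (simp add: w'_def)
    finally show ?thesis .
  qed
  then show ?thesis unfolding cost_def x_def by blast
qed

section \<open>Quadratic forms\<close>

text \<open>
  Forms on arbitrary real vector spaces rather than symmetric matrices: the value of the game is found
  by partial extremization of forms on product spaces.
\<close>

definition quadratic_form :: "('a::real_vector \<Rightarrow> real) \<Rightarrow> bool" where
  "quadratic_form q \<longleftrightarrow> (\<exists>b. bilinear b \<and> (\<forall>x y. b x y = b y x) \<and> (\<forall>x. q x = b x x))"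

lemma quadratic_formI:
  assumes "\<And>x y z. b (x + y) z = b x z + b y z" "\<And>r x z. b (r *\<^sub>R x) z = r * b x z"
    "\<And>x y. b x y = b y x" "\<And>x. q x = b x x"
  shows "quadratic_form q"
proof -
  have "linear (\<lambda>x. b x z)" for z using assms(1,2) by (intro linearI) simp_all
  then have "bilinear b" unfolding bilinear_def using assms(3) by simp
  then show ?thesis using assms unfolding quadratic_form_def by blast
qed

lemma quadratic_formD:
  assumes "quadratic_form q"
  shows "\<exists>b. (\<forall>x y z. b (x + y) z = b x z + b y z) \<and> (\<forall>r x z. b (r *\<^sub>R x) z = r * b x z) \<and>
    (\<forall>x y. b x y = b y x) \<and> (\<forall>x. q x = b x x) \<and> bilinear b"
proof -
  obtain b where b: "bilinear b" "\<forall>x y. b x y = b y x" "\<forall>x. q x = b x x"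
    using assms unfolding quadratic_form_def by blast
  have "b (x + y) z = b x z + b y z" "b (r *\<^sub>R x) z = r * b x z" for x y z r
    using bilinear_ladd[OF b(1)] bilinear_lmul[OF b(1)] by simp_all
  with b show ?thesis by blast
qed

lemma quadratic_form_add:
  assumes "quadratic_form p" "quadratic_form q"
  shows "quadratic_form (\<lambda>x. p x + q x)"
proof -
  obtain b where b: "\<And>x y z. b (x + y) z = b x z + b y z" "\<And>r x z. b (r *\<^sub>R x) z = r * b x z"
    "\<And>x y. b x y = b y x" "\<And>x. p x = b x x" using quadratic_formD[OF assms(1)] by blast
  obtain c where c: "\<And>x y z. c (x + y) z = c x z + c y z" "\<And>r x z. c (r *\<^sub>R x) z = r * c x z"
    "\<And>x y. c x y = c y x" "\<And>x. q x = c x x" using quadratic_formD[OF assms(2)] by blast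
  show ?thesis
    by (rule quadratic_formI[of "\<lambda>x y. b x y + c x y"])
      (simp_all add: b(1,2,4) c(1,2,4) algebra_simps, metis b(3) c(3))
qed

lemma quadratic_form_scale:
  assumes "quadratic_form q"
  shows "quadratic_form (\<lambda>x. r * q x)"
proof -
  obtain b where b: "\<And>x y z. b (x + y) z = b x z + b y z" "\<And>r x z. b (r *\<^sub>R x) z = r * b x z"
    "\<And>x y. b x y = b y x" "\<And>x. q x = b x x" using quadratic_formD[OF assms] by blast
  show ?thesis
    by (rule quadratic_formI[of "\<lambda>x y. r * b x y"])
      (simp_all add: b(1,2,4) algebra_simps, metis b(3))
qed

lemma quadratic_form_minus: "quadratic_form q \<Longrightarrow> quadratic_form (\<lambda>x. - q x)"
  using quadratic_form_scale[of q "-1"] by simp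

lemma quadratic_form_diff:
  "quadratic_form p \<Longrightarrow> quadratic_form q \<Longrightarrow> quadratic_form (\<lambda>x. p x - q x)"
  using quadratic_form_add[OF _ quadratic_form_minus, of p q] by simp

lemma quadratic_form_compose:
  assumes "quadratic_form q" "linear f"
  shows "quadratic_form (\<lambda>x. q (f x))"
proof -
  obtain b where b: "\<And>x y z. b (x + y) z = b x z + b y z" "\<And>r x z. b (r *\<^sub>R x) z = r * b x z"
    "\<And>x y. b x y = b y x" "\<And>x. q x = b x x" using quadratic_formD[OF assms(1)] by blast
  show ?thesis
    by (rule quadratic_formI[of "\<lambda>x y. b (f x) (f y)"])
      (simp_all add: b(1,2,4) linear_add[OF assms(2)] linear_cmul[OF assms(2)], metis b(3))
qed

lemma quadratic_form_norm: "quadratic_form (\<lambda>x::'a::real_inner. (norm x)\<^sup>2)"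
  by (rule quadratic_formI[of inner])
    (simp_all add: inner_add_left power2_norm_eq_inner, rule inner_commute)

lemma quadratic_form_0: "quadratic_form (\<lambda>x. 0)"
  by (rule quadratic_formI[of "\<lambda>x y. 0"]) simp_all

text \<open>
  The stationarity condition in the second variable is a linear equation \<open>H u = - G s\<close>, where \<open>H\<close> is
  injective, hence invertible, by coercivity.
\<close>

lemma coercive_quadratic_form_minimizer:
  fixes q :: "'a::euclidean_space \<times> 'b::euclidean_space \<Rightarrow> real"
  assumes q: "quadratic_form q" and \<theta>: "0 < \<theta>" and coercive: "\<And>u. \<theta> * (norm u)\<^sup>2 \<le> q (0, u)"
  shows "\<exists>k. linear k \<and> (\<forall>s u. q (s, k s) \<le> q (s, u))"
proof -
  obtain b where b: "\<And>x y z. b (x + y) z = b x z + b y z" "\<And>r x z. b (r *\<^sub>R x) z = r * b x z"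
    "\<And>x y. b x y = b y x" "\<And>x. q x = b x x" using quadratic_formD[OF q] by blast
  define G where "G x = (\<Sum>i\<in>Basis. b x (0, i) *\<^sub>R i)" for x
  have G_inner: "G x \<bullet> v = b x (0, v)" for x v
  proof -
    have s: "b (0, \<Sum>i\<in>I. c i *\<^sub>R i) x = (\<Sum>i\<in>I. c i * b (0, i) x)" for I :: "'b set" and c
    proof (induction I rule: infinite_finite_induct)
      case (insert i I)
      have "(0, c i *\<^sub>R i + (\<Sum>i\<in>I. c i *\<^sub>R i)) = (c i *\<^sub>R (0, i) + (0, \<Sum>i\<in>I. c i *\<^sub>R i) :: 'a \<times> 'b)"
        by simp
      then show ?case using insert by (simp add: b(1,2) del: add_Pair scaleR_Pair)
    next
      case empty
      have "b (0 *\<^sub>R 0) x = 0 * b 0 x" by (rule b(2))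
      then show ?case by (simp add: zero_prod_def)
    next
      case (infinite I)
      have "b (0 *\<^sub>R 0) x = 0 * b 0 x" by (rule b(2))
      then show ?case using infinite by (simp add: zero_prod_def)
    qed
    have "b x (0, v) = b (0, \<Sum>i\<in>Basis. (v \<bullet> i) *\<^sub>R i) x" by (simp add: b(3)[of x] euclidean_representation)
    also have "\<dots> = (\<Sum>i\<in>Basis. (v \<bullet> i) * b x (0, i))" unfolding s by (simp add: b(3)[of x])
    also have "\<dots> = G x \<bullet> v"
      by (simp add: G_def inner_sum_left inner_commute[of v] mult.commute)
    finally show ?thesis by simp
  qed
  have G_linear: "linear G"
    by (rule linearI) (simp_all add: G_def b(1,2) algebra_simps sum.distrib scaleR_sum_right)
  define H where "H u = G (0, u)" for u
  have "linear (\<lambda>u. (0::'a, u::'b))" by (rule linearI) simp_all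
  then have H: "linear H" unfolding H_def using linear_compose[OF _ G_linear] by (simp add: o_def)
  have "inj H"
  proof (rule linear_injective_0[OF H, THEN iffD2], intro allI impI)
    fix u assume "H u = 0"
    then have "q (0, u) = 0" using G_inner[of "(0, u)" u] by (simp add: H_def b(4))
    then have "\<theta> * (norm u)\<^sup>2 \<le> 0" using coercive[of u] by simp
    then show "u = 0" using \<theta> by (simp add: mult_le_0_iff)
  qed
  then obtain h where h: "linear h" "\<And>x. H (h x) = x"
    using linear_injective_isomorphism[OF H] by blast
  define k where "k s = - h (G (s, 0))" for s
  have "linear (\<lambda>s. (s::'a, 0::'b))" by (rule linearI) simp_all
  from linear_compose[OF linear_compose[OF this G_linear] h(1)]
  have k: "linear k" unfolding k_def by (intro linear_compose_neg) (simp add: o_def)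
  have stationary: "b (s, k s) (0, v) = 0" for s v
  proof -
    have "(s, k s) = (s, 0) + (0, k s)" by simp
    then have "b (s, k s) (0, v) = G (s, 0) \<bullet> v + H (k s) \<bullet> v"
      unfolding H_def G_inner by (simp only: b(1))
    then show ?thesis by (simp add: k_def linear_neg[OF H] h(2))
  qed
  have "q (s, k s) \<le> q (s, u)" for s u
  proof -
    let ?v = "u - k s"
    have "(s, u) = (s, k s) + (0, ?v)" by simp
    moreover have "b (x + y) (x + y) = b x x + 2 * b x y + b y y" for x y
      using b(3)[of x "x + y"] b(3)[of y "x + y"] b(3)[of y x] by (simp add: b(1))
    ultimately have "q (s, u) = b (s, k s) (s, k s) + 2 * b (s, k s) (0, ?v) + b (0, ?v) (0, ?v)"
      by (simp only: b(4))
    then have "q (s, u) = q (s, k s) + q (0, ?v)" by (simp add: stationary b(4))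
    moreover have "0 \<le> q (0, ?v)" using coercive[of ?v] \<theta>
      by (meson mult_nonneg_nonneg less_imp_le order_trans zero_le_power2)
    ultimately show ?thesis by simp
  qed
  with k show ?thesis by blast
qed

text \<open>
  The off-diagonal coefficients of a nonnegative form are controlled by the diagonal ones, as one sees
  at the vectors \<open>i + j\<close> and \<open>i - j\<close>.
\<close>

lemma nonneg_quadratic_form_trace_bound:
  fixes d :: "'a::euclidean_space \<Rightarrow> real"
  assumes d: "quadratic_form d" and nonneg: "\<And>x. 0 \<le> d x"
  shows "d x \<le> DIM('a) * (\<Sum>i\<in>Basis. d i) * (norm x)\<^sup>2"
proof -
  obtain b where b0: "\<forall>x y z. b (x + y) z = b x z + b y z" "\<forall>r x z. b (r *\<^sub>R x) z = r * b x z"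
    "\<forall>x y. b x y = b y x" "\<forall>x. d x = b x x" and bil: "bilinear b"
    using quadratic_formD[OF d] by (elim exE conjE) (rule that)
  note b = b0[rule_format]
  have off: "\<bar>b i j\<bar> \<le> (d i + d j) / 2" for i j
  proof -
    have sq: "d (x + y) = d x + 2 * b x y + d y" for x y
      using b(3)[of x "x + y"] b(3)[of y "x + y"] b(3)[of y x] by (simp add: b(1,4))
    have "b i ((-1) *\<^sub>R j) = - b i j" "d ((-1) *\<^sub>R j) = d j"
      using b(2)[of "-1" j i] b(2)[of "-1" j "(-1) *\<^sub>R j"] b(2)[of "-1" j j] b(3)[of j i]
        b(3)[of i "(-1) *\<^sub>R j"] b(3)[of j "(-1) *\<^sub>R j"]
      by (simp_all only: b(4))
    with sq[of i j] sq[of i "(-1) *\<^sub>R j"] nonneg[of "i + j"] nonneg[of "i + (-1) *\<^sub>R j"]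
    show ?thesis by simp
  qed
  have "d x = b (\<Sum>i\<in>Basis. (x \<bullet> i) *\<^sub>R i) (\<Sum>j\<in>Basis. (x \<bullet> j) *\<^sub>R j)"
    by (simp add: b(4) euclidean_representation)
  also have "\<dots> = (\<Sum>(i,j)\<in>Basis \<times> Basis. b ((x \<bullet> i) *\<^sub>R i) ((x \<bullet> j) *\<^sub>R j))"
    by (rule bilinear_sum[OF bil])
  also have "\<dots> \<le> (\<Sum>(i,j)\<in>Basis \<times> Basis. (norm x)\<^sup>2 * ((d i + d j) / 2))"
  proof (rule sum_mono, clarify)
    fix i j :: 'a assume ij: "i \<in> Basis" "j \<in> Basis"
    have "b ((x \<bullet> i) *\<^sub>R i) ((x \<bullet> j) *\<^sub>R j) = (x \<bullet> i) * (x \<bullet> j) * b i j"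
      by (simp add: b(2) b(3)[of i "_ *\<^sub>R _"] b(3)[of j i])
    also have "\<dots> \<le> \<bar>x \<bullet> i\<bar> * \<bar>x \<bullet> j\<bar> * \<bar>b i j\<bar>" by (metis abs_ge_self abs_mult)
    also have "\<dots> \<le> norm x * norm x * ((d i + d j) / 2)"
      using off[of i j] ij by (intro mult_mono) (auto simp: Basis_le_norm)
    finally show "b ((x \<bullet> i) *\<^sub>R i) ((x \<bullet> j) *\<^sub>R j) \<le> (norm x)\<^sup>2 * ((d i + d j) / 2)"
      by (simp add: power2_eq_square)
  qed
  also have "\<dots> = (norm x)\<^sup>2 * (\<Sum>i\<in>Basis. \<Sum>j\<in>Basis. (d i + d j) / 2)"
    by (simp add: sum_distrib_left sum.cartesian_product case_prod_unfold)
  also have "\<dots> = DIM('a) * (\<Sum>i\<in>Basis. d i) * (norm x)\<^sup>2"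
    by (simp add: sum.distrib add_divide_distrib sum_divide_distrib[symmetric] sum_distrib_left[symmetric])
  finally show ?thesis .
qed

text \<open>
  The traces form a bounded increasing sequence of real numbers, so their increments become small, and
  the increment of the form is controlled by the increment of the trace.
\<close>

lemma bounded_increasing_quadratic_forms:
  fixes V :: "nat \<Rightarrow> 'a::euclidean_space \<Rightarrow> real"
  assumes q: "\<And>n. quadratic_form (V n)" and mono: "\<And>n x. V n x \<le> V (Suc n) x"
    and bound: "\<And>n x. V n x \<le> c * (norm x)\<^sup>2" and \<delta>: "0 < \<delta>"
  shows "\<exists>n>0. \<forall>x. V (Suc n) x \<le> V n x + \<delta> * (norm x)\<^sup>2"
proof -
  define a where "a n = (\<Sum>i\<in>Basis. V n i)" for n
  have "incseq a" unfolding a_def by (intro incseq_SucI sum_mono mono)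
  moreover have "a n \<le> DIM('a) * c" for n
  proof -
    have "a n \<le> (\<Sum>i\<in>(Basis::'a set). c)"
      unfolding a_def
    proof (rule sum_mono)
      fix i :: 'a assume "i \<in> Basis"
      then show "V n i \<le> c" using bound[of n i] by simp
    qed
    then show ?thesis by simp
  qed
  ultimately obtain L where "a \<longlonglongrightarrow> L" using incseq_convergent[of a] by metis
  then have "(\<lambda>n. a (Suc n) - a n) \<longlonglongrightarrow> L - L" by (intro tendsto_diff LIMSEQ_Suc)
  then have "\<forall>\<^sub>F n in sequentially. a (Suc n) - a n < \<delta> / DIM('a)"
    using \<delta> by (intro order_tendstoD(2)) (auto simp: DIM_positive)
  then obtain N where N: "\<And>n. N \<le> n \<Longrightarrow> a (Suc n) - a n < \<delta> / DIM('a)"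
    by (auto simp: eventually_sequentially)
  define n where "n = Suc N"
  have "V (Suc n) x \<le> V n x + \<delta> * (norm x)\<^sup>2" for x
  proof -
    have "V (Suc n) x - V n x \<le> DIM('a) * (\<Sum>i\<in>Basis. V (Suc n) i - V n i) * (norm x)\<^sup>2"
      by (rule nonneg_quadratic_form_trace_bound) (use mono in \<open>auto intro: quadratic_form_diff q\<close>)
    also have "\<dots> \<le> DIM('a) * (\<delta> / DIM('a)) * (norm x)\<^sup>2"
      using N[of n] by (intro mult_right_mono mult_left_mono) (auto simp: n_def a_def sum_subtractf)
    finally show ?thesis by simp
  qed
  then show ?thesis by (intro exI[of _ n]) (simp add: n_def)
qed

section \<open>The full-information game\<close>

definition game_payoff where
  "game_payoff A B1 B2 C D1 D2 e g V x w u =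
     stage_cost C D1 D2 e g x w u + V (A *v x + (B1 *v u - B2 *v w))"

text \<open>
  The equation \<open>V' x = (max w. min u. payoff)\<close> without suprema and infima, together with a choice of \<open>u\<close>
  that secures it and is linear in \<open>x\<close> and \<open>w\<close>.
\<close>

definition bellman_step where
  "bellman_step A B1 B2 C D1 D2 e g V V' \<longleftrightarrow>
     (\<exists>k. linear k \<and> (\<forall>x w. game_payoff A B1 B2 C D1 D2 e g V x w (k (x, w)) \<le> V' x)) \<and>
     (\<forall>x. \<exists>w. \<forall>u. V' x \<le> game_payoff A B1 B2 C D1 D2 e g V x w u)"

text \<open>
  Minimize over \<open>u\<close>, then maximize over \<open>w\<close>. The penalty on \<open>u\<close> makes the first problem coercive; the
  assumption \<open>concave\<close> says that the minimum over \<open>u\<close> is negative definite in \<open>w\<close> and so makes the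
  second one coercive.
\<close>

lemma bellman_step_exists:
  fixes A :: "real^'n^'n" and B1 :: "real^'m^'n" and B2 :: "real^'r^'n"
    and C :: "real^'n^'p" and D1 :: "real^'m^'p" and D2 :: "real^'r^'p"
  assumes V: "quadratic_form V" "\<And>x. 0 \<le> V x" and e: "0 < e" and \<theta>: "0 < \<theta>"
    and concave: "\<And>w. \<exists>u. game_payoff A B1 B2 C D1 D2 e g V 0 w u \<le> - \<theta> * (norm w)\<^sup>2"
  shows "\<exists>V'. quadratic_form V' \<and> bellman_step A B1 B2 C D1 D2 e g V V'"
proof -
  let ?Q = "game_payoff A B1 B2 C D1 D2 e g V"
  let ?q = "\<lambda>z :: ((real^'n) \<times> (real^'r)) \<times> (real^'m). ?Q (fst (fst z)) (snd (fst z)) (snd z)"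
  have lin: "linear (\<lambda>z::((real^'n) \<times> (real^'r)) \<times> (real^'m). M *v fst (fst z))"
    "linear (\<lambda>z::((real^'n) \<times> (real^'r)) \<times> (real^'m). M' *v snd (fst z))"
    "linear (\<lambda>z::((real^'n) \<times> (real^'r)) \<times> (real^'m). M'' *v snd z)"
    "linear (\<lambda>z::((real^'n) \<times> (real^'r)) \<times> (real^'m). fst (fst z))"
    "linear (\<lambda>z::((real^'n) \<times> (real^'r)) \<times> (real^'m). snd (fst z))"
    "linear (\<lambda>z::((real^'n) \<times> (real^'r)) \<times> (real^'m). snd z)"
    for M :: "real^'n^'l" and M' :: "real^'r^'k" and M'' :: "real^'m^'j"
    by (rule linearI; simp add: matrix_vector_right_distrib matrix_vector_mult_scaleR)+
  have q: "quadratic_form ?q"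
    unfolding game_payoff_def stage_cost_def
    by (intro quadratic_form_add quadratic_form_diff quadratic_form_scale
        quadratic_form_compose[OF quadratic_form_norm] quadratic_form_compose[OF V(1)]
        linear_compose_add linear_compose_sub lin)
  have "e\<^sup>2 * (norm u)\<^sup>2 \<le> ?q (0, u)" for u
    using V(2)[of "B1 *v u"] by (simp add: game_payoff_def stage_cost_def)
  with coercive_quadratic_form_minimizer[OF q, of "e\<^sup>2"] e
  obtain k where k: "linear k" "\<And>s u. ?q (s, k s) \<le> ?q (s, u)" by auto
  let ?q1 = "\<lambda>s. ?q (s, k s)"
  have "linear (\<lambda>s. (s, k s))"
    by (rule linearI) (simp_all add: linear_add[OF k(1)] linear_cmul[OF k(1)])
  then have q1: "quadratic_form (\<lambda>s. - ?q1 s)"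
    using quadratic_form_minus[OF quadratic_form_compose[OF q]] by blast
  have "\<theta> * (norm w)\<^sup>2 \<le> - ?q1 (0, w)" for w
  proof -
    obtain u where "?Q 0 w u \<le> - \<theta> * (norm w)\<^sup>2" using concave by blast
    moreover have "?q1 (0, w) \<le> ?Q 0 w u" using k(2)[of "(0, w)" u] by simp
    ultimately show ?thesis by simp
  qed
  with coercive_quadratic_form_minimizer[OF q1 \<theta>]
  obtain l where l: "linear l" "\<And>x w. ?q1 (x, w) \<le> ?q1 (x, l x)" by fastforce
  let ?V = "\<lambda>x. ?q1 (x, l x)"
  have "linear (\<lambda>x. (x, l x))"
    by (rule linearI) (simp_all add: linear_add[OF l(1)] linear_cmul[OF l(1)])
  then have "quadratic_form (\<lambda>x. - ?V x)" by (rule quadratic_form_compose[OF q1])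
  then have "quadratic_form ?V" using quadratic_form_minus by fastforce
  moreover have "bellman_step A B1 B2 C D1 D2 e g V ?V"
    unfolding bellman_step_def
  proof (intro conjI allI exI[of _ k])
    fix x w show "?Q x w (k (x, w)) \<le> ?V x" using l(2)[of x w] by simp
  next
    fix x
    show "\<exists>w. \<forall>u. ?V x \<le> ?Q x w u" using k(2)[of "(x, l x)"] by (intro exI[of _ "l x"]) simp
  qed (rule k(1))
  ultimately show ?thesis by blast
qed

lemma
  assumes "bellman_step A B1 B2 C D1 D2 e g V V'"
  shows bellman_step_minimizer:
      "\<exists>k. linear k \<and> (\<forall>x w. game_payoff A B1 B2 C D1 D2 e g V x w (k (x, w)) \<le> V' x)"
    and bellman_step_disturbance: "\<exists>w. \<forall>u. V' x \<le> game_payoff A B1 B2 C D1 D2 e g V x w u"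
    and bellman_step_control: "\<exists>u. game_payoff A B1 B2 C D1 D2 e g V x w u \<le> V' x"
  using assms unfolding bellman_step_def by simp_all blast

lemma fir_response_cong:
  "(\<And>s. s \<le> t \<Longrightarrow> w s = w' s) \<Longrightarrow> fir_response d f w t = fir_response d f w' t"
  unfolding fir_response_def by (intro sum.cong) auto

text \<open>
  Value iteration from zero. Each value lies below the cost that the finite impulse response
  guarantees; this bounds the values and also gives the concavity needed for the next step, the term
  with \<open>\<theta>\<close> being the margin.
\<close>

lemma bounded_game_value:
  fixes A :: "real^'n^'n" and B1 :: "real^'m^'n" and B2 :: "real^'r^'n"
    and C :: "real^'n^'p" and D1 :: "real^'m^'p" and D2 :: "real^'r^'p"
    and f :: "nat \<Rightarrow> real^'r^'m" and d :: nat and e g c \<theta> :: real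
  defines "u \<equiv> fir_response d f"
  defines "x \<equiv> \<lambda>x0 w. trajectory A (\<lambda>t. B1 *v u w t - B2 *v w t) x0"
  defines "cost \<equiv> \<lambda>x0 w t. stage_cost C D1 D2 e g (x x0 w t) (w t) (u w t)"
  assumes e: "0 < e" and \<theta>: "0 < \<theta>"
    and bound: "\<And>x0 w T. (\<Sum>t<T. cost x0 w t) \<le> c * (norm x0)\<^sup>2 - \<theta> * (\<Sum>t<T. (norm (w t))\<^sup>2)"
  shows "\<exists>V k. quadratic_form V \<and> (\<forall>x. e\<^sup>2 * (norm x)\<^sup>2 \<le> V x) \<and> linear k \<and>
    (\<forall>x w. game_payoff A B1 B2 C D1 D2 e g V x w (k (x, w)) \<le> V x + e\<^sup>2 / 2 * (norm x)\<^sup>2)"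
proof -
  let ?Q = "game_payoff A B1 B2 C D1 D2 e g"
  let ?step = "bellman_step A B1 B2 C D1 D2 e g"
  \<comment> \<open>Every bound \<open>M\<close> that the strategy guarantees over \<open>t + T\<close> steps, for all continuations of \<open>w\<close> from
    time \<open>t\<close> on, still holds if the last \<open>T\<close> steps are replaced by \<open>V\<close> at the state reached.\<close>
  define secured where "secured T V \<longleftrightarrow> (\<forall>x0 w t M.
      (\<forall>w'. (\<forall>s<t. w' s = w s) \<longrightarrow> (\<Sum>s<t + T. cost x0 w' s) \<le> M) \<longrightarrow>
      (\<Sum>s<t. cost x0 w s) + V (x x0 w t) \<le> M)" for T and V :: "real^'n \<Rightarrow> real"
  have x_cong: "x x0 w t = x x0 w' t" if "\<And>s. s < t \<Longrightarrow> w s = w' s" for x0 w w' t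
    unfolding x_def u_def using that
    by (intro trajectory_cong arg_cong2[where f = minus] arg_cong2[where f = "(*v)"] refl fir_response_cong) auto
  have cost_cong: "cost x0 w t = cost x0 w' t" if "\<And>s. s \<le> t \<Longrightarrow> w s = w' s" for x0 w w' t
    unfolding cost_def using that x_cong[of t w w'] fir_response_cong[of t w w' d f] by (simp add: u_def)
  have securedD: "(\<Sum>s<t. cost x0 w s) + V (x x0 w t) \<le> M"
    if V: "secured T V" and M: "\<And>w'. \<forall>s<t. w' s = w s \<Longrightarrow> (\<Sum>s<t + T. cost x0 w' s) \<le> M"
    for T V x0 w t M
  proof -
    have "(\<forall>w'. (\<forall>s<t. w' s = w s) \<longrightarrow> (\<Sum>s<t + T. cost x0 w' s) \<le> M) \<longrightarrow>
        (\<Sum>s<t. cost x0 w s) + V (x x0 w t) \<le> M"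
      using V[unfolded secured_def, THEN spec[of _ x0], THEN spec[of _ w], THEN spec[of _ t],
          THEN spec[of _ M]] .
    moreover have "\<forall>w'. (\<forall>s<t. w' s = w s) \<longrightarrow> (\<Sum>s<t + T. cost x0 w' s) \<le> M"
      using M by (intro allI impI)
    ultimately show ?thesis by (rule mp)
  qed
  define P where "P T V \<longleftrightarrow> quadratic_form V \<and> (\<forall>x. 0 \<le> V x) \<and> secured T V"
    for T and V :: "real^'n \<Rightarrow> real"
  have nonneg: "e\<^sup>2 * (norm x)\<^sup>2 \<le> V' x" if st: "?step V V'" and nn: "\<And>x. 0 \<le> V x" for V V' x
  proof -
    obtain v where "?Q V x 0 v \<le> V' x" using bellman_step_control[OF st] by blast
    moreover have "e\<^sup>2 * (norm x)\<^sup>2 \<le> ?Q V x 0 v" for v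
      using nn[of "A *v x + B1 *v v"] by (simp add: game_payoff_def stage_cost_def)
    ultimately show ?thesis by (meson order_trans)
  qed
  have "\<exists>V. \<forall>T. P T (V T) \<and> ?step (V T) (V (Suc T)) \<and> (T = 0 \<longrightarrow> V T = (\<lambda>x. 0))"
  proof -
    have "\<exists>V. \<forall>T. (P T (V T) \<and> (T = 0 \<longrightarrow> V T = (\<lambda>x. 0))) \<and> ?step (V T) (V (Suc T))"
    proof (rule dependent_nat_choice)
      have "secured 0 (\<lambda>x. 0)" unfolding secured_def by auto
      then show "\<exists>V. P 0 V \<and> (0 = 0 \<longrightarrow> V = (\<lambda>x. 0))"
        unfolding P_def by (intro exI[of _ "\<lambda>x. 0"]) (simp add: quadratic_form_0)
    next
      fix V T assume "P T V \<and> (T = 0 \<longrightarrow> V = (\<lambda>x. 0))"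
      then have V: "quadratic_form V" "\<And>x. 0 \<le> V x" "secured T V" by (auto simp: P_def)
      have "\<exists>v. ?Q V 0 \<omega> v \<le> - \<theta> * (norm \<omega>)\<^sup>2" for \<omega>
      proof -
        let ?w = "\<lambda>s. \<omega>"
        have "(\<Sum>s<1 + T. cost 0 w' s) \<le> - \<theta> * (norm \<omega>)\<^sup>2" if "\<forall>s<1. w' s = ?w s" for w'
        proof -
          have "(norm (w' 0))\<^sup>2 \<le> (\<Sum>s<1 + T. (norm (w' s))\<^sup>2)"
            by (rule member_le_sum) auto
          then have "\<theta> * (norm \<omega>)\<^sup>2 \<le> \<theta> * (\<Sum>s<1 + T. (norm (w' s))\<^sup>2)"
            using \<theta> that by (intro mult_left_mono) auto
          moreover have "(\<Sum>s<1 + T. cost 0 w' s)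
              \<le> c * (norm (0 :: real^'n))\<^sup>2 - \<theta> * (\<Sum>s<1 + T. (norm (w' s))\<^sup>2)" by (rule bound)
          ultimately show ?thesis by simp
        qed
        from securedD[OF V(3) this]
        have "(\<Sum>s<1. cost 0 ?w s) + V (x 0 ?w 1) \<le> - \<theta> * (norm \<omega>)\<^sup>2" .
        then have "?Q V 0 \<omega> (u ?w 0) \<le> - \<theta> * (norm \<omega>)\<^sup>2"
          by (simp add: cost_def game_payoff_def x_def)
        then show ?thesis by blast
      qed
      from bellman_step_exists[OF V(1,2) e \<theta> this]
      obtain V' where V': "quadratic_form V'" "?step V V'" by blast
      have "secured (Suc T) V'" unfolding secured_def
      proof (intro allI impI)
        fix x0 w t M
        assume M: "\<forall>w'. (\<forall>s<t. w' s = w s) \<longrightarrow> (\<Sum>s<t + Suc T. cost x0 w' s) \<le> M"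
        obtain \<omega> where \<omega>: "\<And>v. V' (x x0 w t) \<le> ?Q V (x x0 w t) \<omega> v"
          using bellman_step_disturbance[OF V'(2)] by blast
        \<comment> \<open>The worst disturbance at time \<open>t\<close> is one of the admissible continuations.\<close>
        define w1 where "w1 = w(t := \<omega>)"
        have agree: "w1 s = w s" if "s < t" for s using that by (simp add: w1_def)
        have "(\<Sum>s<Suc t + T. cost x0 w' s) \<le> M" if "\<forall>s<Suc t. w' s = w1 s" for w'
          using M[rule_format, of w'] that agree by simp
        from securedD[OF V(3) this]
        have "(\<Sum>s<Suc t. cost x0 w1 s) + V (x x0 w1 (Suc t)) \<le> M" .
        moreover have "(\<Sum>s<t. cost x0 w1 s) = (\<Sum>s<t. cost x0 w s)"
          using agree by (intro sum.cong cost_cong) auto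
        moreover have "x x0 w1 t = x x0 w t" using agree by (rule x_cong)
        moreover have "cost x0 w1 t + V (x x0 w1 (Suc t)) = ?Q V (x x0 w1 t) \<omega> (u w1 t)"
          by (simp add: cost_def game_payoff_def x_def w1_def)
        ultimately show "(\<Sum>s<t. cost x0 w s) + V' (x x0 w t) \<le> M" using \<omega>[of "u w1 t"] by simp
      qed
      moreover have "0 \<le> V' x" for x
      proof -
        have "0 \<le> e\<^sup>2 * (norm x)\<^sup>2" by simp
        also have "\<dots> \<le> V' x" by (rule nonneg[OF V'(2) V(2)])
        finally show ?thesis .
      qed
      ultimately show "\<exists>V'. (P (Suc T) V' \<and> (Suc T = 0 \<longrightarrow> V' = (\<lambda>x. 0))) \<and> ?step V V'"
        using V' unfolding P_def by blast
    qed
    then show ?thesis by blast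
  qed
  then obtain V where V: "\<And>T. P T (V T)" "\<And>T. ?step (V T) (V (Suc T))" "V 0 = (\<lambda>x. 0)" by blast
  have V_nonneg: "0 \<le> V T x" for T x using V(1)[of T] by (simp add: P_def)
  have mono: "V T x \<le> V (Suc T) x" for T x
  proof (induction T arbitrary: x)
    case 0
    then show ?case using V(3) V_nonneg[of 1] by simp
  next
    case (Suc T)
    obtain \<omega> where \<omega>: "\<And>v. V (Suc T) x \<le> ?Q (V T) x \<omega> v"
      using bellman_step_disturbance[OF V(2)] by blast
    obtain v where k: "?Q (V (Suc T)) x \<omega> v \<le> V (Suc (Suc T)) x"
      using bellman_step_control[OF V(2)] by blast
    have "V (Suc T) x \<le> ?Q (V T) x \<omega> v" by (rule \<omega>)
    also have "\<dots> \<le> ?Q (V (Suc T)) x \<omega> v" using Suc by (simp add: game_payoff_def)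
    also have "\<dots> \<le> V (Suc (Suc T)) x" by (rule k)
    finally show ?case .
  qed
  have upper: "V T x0 \<le> c * (norm x0)\<^sup>2" for T x0
  proof -
    have "(\<Sum>s<0 + T. cost x0 w' s) \<le> c * (norm x0)\<^sup>2" for w'
    proof -
      have "0 \<le> \<theta> * (\<Sum>t<T. (norm (w' t))\<^sup>2)" using \<theta> by (intro mult_nonneg_nonneg sum_nonneg) auto
      moreover have "(\<Sum>s<T. cost x0 w' s)
          \<le> c * (norm x0)\<^sup>2 - \<theta> * (\<Sum>s<T. (norm (w' s))\<^sup>2)" by (rule bound)
      ultimately show ?thesis by simp
    qed
    note sum_le = this
    have "secured T (V T)" using V(1)[of T] by (simp only: P_def)
    then have "(\<Sum>s<0. cost x0 (\<lambda>s. 0) s) + V T (x x0 (\<lambda>s. 0) 0) \<le> c * (norm x0)\<^sup>2"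
      by (rule securedD) (rule sum_le)
    then show ?thesis by (simp add: x_def)
  qed
  have qf: "quadratic_form (V T)" for T using V(1)[of T] by (simp add: P_def)
  obtain T where T: "T > 0" "\<And>x. V (Suc T) x \<le> V T x + e\<^sup>2 / 2 * (norm x)\<^sup>2"
    using bounded_increasing_quadratic_forms[of V c "e\<^sup>2 / 2", OF qf mono upper] e by auto
  obtain k where "linear k \<and> (\<forall>x w. ?Q (V T) x w (k (x, w)) \<le> V (Suc T) x)"
    using bellman_step_minimizer[OF V(2)] by (rule exE)
  then have k: "linear k" "?Q (V T) x w (k (x, w)) \<le> V (Suc T) x" for x w by blast+
  obtain S where S: "T = Suc S" using T(1) gr0_implies_Suc by blast
  have "e\<^sup>2 * (norm x)\<^sup>2 \<le> V T x" for x
    unfolding S by (rule nonneg[OF V(2)[of S] V_nonneg])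
  moreover have "?Q (V T) x w (k (x, w)) \<le> V T x + e\<^sup>2 / 2 * (norm x)\<^sup>2" for x w
    using k(2)[of x w] T(2)[of x] by (rule order_trans)
  ultimately show ?thesis using qf k(1) by blast
qed

text \<open>
  Products with a transpose stay in this form, so that adjoints can be moved across inner products.
\<close>

declare transpose_matrix_vector [simp del] vector_transpose_matrix [simp del]

section \<open>Block matrices as quadratic forms\<close>

definition upper :: "'a^('m::finite + 'n::finite) \<Rightarrow> 'a^'m" where "upper x = (\<chi> i. x $ Inl i)"
definition lower :: "'a^('m::finite + 'n::finite) \<Rightarrow> 'a^'n" where "lower x = (\<chi> i. x $ Inr i)"
definition stack :: "'a^'m::finite \<Rightarrow> 'a^'n::finite \<Rightarrow> 'a^('m + 'n)" (infixr "\<frown>" 54) where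
  "x \<frown> y = (\<chi> i. case i of Inl k \<Rightarrow> x $ k | Inr k \<Rightarrow> y $ k)"

lemma upper_stack [simp]: "upper (x \<frown> y) = x" and lower_stack [simp]: "lower (x \<frown> y) = y"
  by (simp_all add: upper_def lower_def stack_def vec_eq_iff)

lemma stack_eq_0_iff: "x = 0 \<longleftrightarrow> upper x = 0 \<and> lower x = 0"
  by (auto simp: upper_def lower_def vec_eq_iff) (metis sum.exhaust)

lemma sum_UNIV_sum: "(\<Sum>i\<in>(UNIV :: ('m::finite + 'n::finite) set). g i) = (\<Sum>i\<in>UNIV. g (Inl i)) + (\<Sum>i\<in>UNIV. g (Inr i))"
  using sum.Plus[of "UNIV::'m set" "UNIV::'n set" g] by (simp add: o_def)

lemma inner_stack: "x \<bullet> y = upper x \<bullet> upper y + lower x \<bullet> lower y" for x y :: "real^('m::finite + 'n::finite)"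
  by (simp add: inner_vec_def sum_UNIV_sum upper_def lower_def)

lemma hcat_mult: "(M ||| N) *v x = M *v upper x + N *v lower x" for x :: "real^('m::finite + 'n::finite)"
  by (simp add: vec_eq_iff matrix_vector_mult_def sum_UNIV_sum upper_def lower_def hcat_def)

lemma upper_vcat: "upper ((M === N) *v x) = M *v x" and lower_vcat: "lower ((M === N) *v x) = N *v x"
  by (simp_all add: vec_eq_iff matrix_vector_mult_def upper_def lower_def vcat_def)

lemma block_mult:
  fixes A :: "'a::semiring_1^'m^'r"
  shows "((A ||| B) === (C ||| D)) ** ((E ||| F) === (G ||| H))
    = ((A ** E + B ** G) ||| (A ** F + B ** H)) === ((C ** E + D ** G) ||| (C ** F + D ** H))"
  by (auto simp: vec_eq_iff matrix_matrix_mult_def sum_UNIV_sum hcat_def vcat_def split: sum.split)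

lemma block_transpose:
  "transpose ((A ||| B) === (C ||| D)) = (transpose A ||| transpose C) === (transpose B ||| transpose D)"
  by (auto simp: vec_eq_iff transpose_def hcat_def vcat_def split: sum.split)

lemma block_eq_iff:
  "((A ||| B) === (C ||| D)) = ((E ||| F) === (G ||| H)) \<longleftrightarrow> A = E \<and> B = F \<and> C = G \<and> D = H"
proof -
  have v: "(M === N) = (M' === N') \<longleftrightarrow> M = M' \<and> N = N'" for M M' :: "'x^'y^'z" and N N' :: "'x^'y^'w"
  proof
    assume e: "(M === N) = (M' === N')"
    have "M $ k = M' $ k" "N $ l = N' $ l" for k l
      using arg_cong[OF e, of "\<lambda>x. x $ Inl k"] arg_cong[OF e, of "\<lambda>x. x $ Inr l"]
      by (simp_all add: vcat_def)
    then show "M = M' \<and> N = N'" by (simp add: vec_eq_iff)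
  qed simp
  have h: "(M ||| N) = (M' ||| N') \<longleftrightarrow> M = M' \<and> N = N'" for M M' :: "'x^'y^'z" and N N' :: "'x^'w^'z"
  proof
    assume e: "(M ||| N) = (M' ||| N')"
    have "M $ i $ k = M' $ i $ k" "N $ i $ l = N' $ i $ l" for i k l
      using arg_cong[OF e, of "\<lambda>x. x $ i $ Inl k"] arg_cong[OF e, of "\<lambda>x. x $ i $ Inr l"]
      by (simp_all add: hcat_def)
    then show "M = M' \<and> N = N'" by (simp add: vec_eq_iff)
  qed simp
  show ?thesis unfolding v h by blast
qed

lemma inner_transpose: "x \<bullet> (transpose M *v y) = (M *v x) \<bullet> y" for M :: "real^'n^'m"
  by (metis dot_lmul_matrix inner_commute transpose_matrix_vector)

lemma inner_transpose_swap: "x \<bullet> (transpose M *v y) = y \<bullet> (M *v x)" for M :: "real^'n^'m"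
  by (simp only: inner_transpose inner_commute)

lemma inner_symmetric: "symmetric_matrix M \<Longrightarrow> x \<bullet> (M *v y) = y \<bullet> (M *v x)"
  by (metis inner_commute inner_transpose symmetric_matrix_def)

lemma transpose_add: "transpose (M + N) = transpose M + transpose N"
  and transpose_diff: "transpose (M - N) = transpose M - transpose N"
  for M N :: "'a::ab_group_add^'c^'r"
  by (simp_all add: transpose_def vec_eq_iff)

lemma filter_lmi_form:
  fixes x :: "real^('n::finite + 'n + 'n + 'n + 'r::finite + 'p::finite)"
    and A :: "real^'n^'n" and B1 :: "real^'m^'n" and B2 :: "real^'r^'n"
    and C :: "real^'n^'p" and D1 :: "real^'m^'p" and D2 :: "real^'r^'p"
    and X Z Q Ah :: "real^'n^'n" and F :: "real^'r^'n" and L K :: "real^'n^'m" and R :: "real^'r^'m"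
  assumes sym: "symmetric_matrix X" "symmetric_matrix Z"
  defines "a \<equiv> upper x" and "b \<equiv> upper (lower x)" and "c \<equiv> upper (lower (lower x))"
    and "d \<equiv> upper (lower (lower (lower x)))" and "e \<equiv> upper (lower (lower (lower (lower x))))"
    and "f \<equiv> lower (lower (lower (lower (lower x))))"
  defines "\<alpha> \<equiv> transpose A *v a + transpose C *v f" and "\<beta> \<equiv> transpose B1 *v a + transpose D1 *v f"
  shows "x \<bullet> (filter_lmi A B1 B2 C D1 D2 \<mu> X Z Q F L R *v x)
    = a \<bullet> (X *v a) + 2 * (a \<bullet> (Z *v b)) + b \<bullet> (Z *v b)
      + c \<bullet> (X *v c) + 2 * (c \<bullet> (Z *v d)) + d \<bullet> (Z *v d) + e \<bullet> e + \<mu>\<^sup>2 * (f \<bullet> f)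
      + 2 * (c \<bullet> (X *v \<alpha> + transpose L *v \<beta> + transpose Q *v b))
      + 2 * (d \<bullet> (Z *v \<alpha> + transpose L *v \<beta> + transpose Q *v b))
      + 2 * (e \<bullet> (transpose R *v \<beta> - transpose B2 *v a - transpose D2 *v f + transpose F *v b))"
proof -
  define AXL where "AXL = A ** X + B1 ** L"
  define AZL where "AZL = A ** Z + B1 ** L"
  define BR where "BR = B1 ** R - B2"
  define XCL where "XCL = X ** transpose C + transpose L ** transpose D1"
  define ZCL where "ZCL = Z ** transpose C + transpose L ** transpose D1"
  define DR where "DR = transpose R ** transpose D1 - transpose D2"
  have t: "transpose X = X" "transpose Z = Z" using sym by (simp_all add: symmetric_matrix_def)
  have m\<mu>: "mat (\<mu>\<^sup>2) *v f = \<mu>\<^sup>2 *\<^sub>R f"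
    by (simp add: mat_mult_vec scalar_mult_eq_scaleR)
  have "x \<bullet> (filter_lmi A B1 B2 C D1 D2 \<mu> X Z Q F L R *v x)
    = a \<bullet> (X *v a + Z *v b + AXL *v c + AZL *v d + BR *v e)
    + b \<bullet> (Z *v a + Z *v b + Q *v c + Q *v d + F *v e)
    + c \<bullet> (transpose AXL *v a + transpose Q *v b + X *v c + Z *v d + XCL *v f)
    + d \<bullet> (transpose AZL *v a + transpose Q *v b + Z *v c + Z *v d + ZCL *v f)
    + e \<bullet> (transpose BR *v a + transpose F *v b + e + DR *v f)
    + f \<bullet> (transpose XCL *v c + transpose ZCL *v d + transpose DR *v e + \<mu>\<^sup>2 *\<^sub>R f)"
    unfolding filter_lmi_def Let_def AXL_def[symmetric] AZL_def[symmetric] BR_def[symmetric]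
      XCL_def[symmetric] ZCL_def[symmetric] DR_def[symmetric]
    by (simp only: inner_stack[of x] inner_stack[of "lower _"] upper_vcat lower_vcat hcat_mult t
        a_def[symmetric] b_def[symmetric] c_def[symmetric] d_def[symmetric] e_def[symmetric]
        f_def[symmetric] m\<mu> matrix_vector_mul_lid matrix_vector_mult_0 add_0_left add_0_right add.assoc)
  also have "\<dots> = a \<bullet> (X *v a) + 2 * (a \<bullet> (Z *v b)) + b \<bullet> (Z *v b)
      + c \<bullet> (X *v c) + 2 * (c \<bullet> (Z *v d)) + d \<bullet> (Z *v d) + e \<bullet> e + \<mu>\<^sup>2 * (f \<bullet> f)
      + 2 * (c \<bullet> (transpose AXL *v a + XCL *v f + transpose Q *v b))
      + 2 * (d \<bullet> (transpose AZL *v a + ZCL *v f + transpose Q *v b))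
      + 2 * (e \<bullet> (transpose BR *v a + DR *v f + transpose F *v b))"
    by (simp add: inner_add_right inner_transpose_swap
        inner_symmetric[OF sym(2), of b a] inner_symmetric[OF sym(2), of d c])
  also have "transpose AXL *v a + XCL *v f = X *v \<alpha> + transpose L *v \<beta>"
    unfolding AXL_def XCL_def \<alpha>_def \<beta>_def
    by (simp add: transpose_add matrix_transpose_mul t matrix_vector_mult_add_rdistrib
        matrix_vector_right_distrib flip: matrix_vector_mul_assoc)
  also have "transpose AZL *v a + ZCL *v f = Z *v \<alpha> + transpose L *v \<beta>"
    unfolding AZL_def ZCL_def \<alpha>_def \<beta>_def
    by (simp add: transpose_add matrix_transpose_mul t matrix_vector_mult_add_rdistrib
        matrix_vector_right_distrib flip: matrix_vector_mul_assoc)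
  also have "transpose BR *v a + DR *v f = transpose R *v \<beta> - transpose B2 *v a - transpose D2 *v f"
    unfolding BR_def DR_def \<beta>_def
    by (simp add: transpose_diff matrix_transpose_mul matrix_vector_mult_diff_rdistrib
        matrix_vector_right_distrib flip: matrix_vector_mul_assoc)
  finally show ?thesis .
qed

definition form :: "real^'n^'n \<Rightarrow> real^'n \<Rightarrow> real" where "form M v = v \<bullet> (M *v v)"

lemma form_add:
  "symmetric_matrix M \<Longrightarrow> form M (v + w) = form M v + 2 * (v \<bullet> (M *v w)) + form M w"
  using inner_symmetric[of M w v]
  by (simp add: form_def matrix_vector_right_distrib inner_add_left inner_add_right)

text \<open>
  The minimum over \<open>c\<close>, \<open>d\<close> and \<open>e\<close> of the quadratic form of the matrix inequality, where
  \<open>a, b, c, d, e, f\<close> are the six blocks of its argument, \<open>W = X - Z\<close>, \<open>K = L Z\<^sup>-\<^sup>1\<close> and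
  \<open>Ah = Q Z\<^sup>-\<^sup>1\<close>. It is the decrease of the dual storage function
  \<open>form W a + form Z (a + b)\<close> along the adjoint system with input \<open>f\<close>, plus \<open>\<mu>\<^sup>2\<close> times the energy of
  this input, minus the energy of the adjoint output.
\<close>

definition dissipation ::
  "real^'n^'n \<Rightarrow> real^'m^'n \<Rightarrow> real^'r^'n \<Rightarrow> real^'n^'p \<Rightarrow> real^'m^'p \<Rightarrow> real^'r^'p \<Rightarrow> real \<Rightarrow>
   real^'n^'n \<Rightarrow> real^'n^'n \<Rightarrow> real^'n^'n \<Rightarrow> real^'r^'n \<Rightarrow> real^'n^'m \<Rightarrow> real^'r^'m \<Rightarrow>
   real^'n \<Rightarrow> real^'n \<Rightarrow> real^'p \<Rightarrow> real" where
  "dissipation A B1 B2 C D1 D2 \<mu> W Z Ah F K R a b f =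
     (let \<alpha> = transpose A *v a + transpose C *v f;
          \<beta> = transpose B1 *v a + transpose D1 *v f
      in form W a + form Z (a + b) + \<mu>\<^sup>2 * (norm f)\<^sup>2
         - form W \<alpha> - form Z (\<alpha> + transpose K *v \<beta> + transpose Ah *v b)
         - (norm (transpose R *v \<beta> - transpose B2 *v a - transpose D2 *v f + transpose F *v b))\<^sup>2)"

text \<open>
  The blocks \<open>X, Z, Z, Z\<close> become the block diagonal of \<open>X - Z\<close> and \<open>Z\<close> in the variables \<open>a\<close> and \<open>a + b\<close>,
  and likewise in \<open>c\<close> and \<open>c + d\<close>; then the terms that are linear in \<open>c\<close>, \<open>c + d\<close> and \<open>e\<close> are absorbed.
\<close>

lemma filter_lmi_completed_squares:
  fixes x :: "real^('n::finite + 'n + 'n + 'n + 'r::finite + 'p::finite)"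
    and A :: "real^'n^'n" and B1 :: "real^'m^'n" and B2 :: "real^'r^'n"
    and C :: "real^'n^'p" and D1 :: "real^'m^'p" and D2 :: "real^'r^'p"
    and X Z Q Ah :: "real^'n^'n" and F :: "real^'r^'n" and L K :: "real^'n^'m" and R :: "real^'r^'m"
  assumes sym: "symmetric_matrix X" "symmetric_matrix Z" and Q: "Q = Ah ** Z" and L: "L = K ** Z"
  defines "a \<equiv> upper x" and "b \<equiv> upper (lower x)" and "c \<equiv> upper (lower (lower x))"
    and "d \<equiv> upper (lower (lower (lower x)))" and "e \<equiv> upper (lower (lower (lower (lower x))))"
    and "f \<equiv> lower (lower (lower (lower (lower x))))"
  defines "\<alpha> \<equiv> transpose A *v a + transpose C *v f" and "\<beta> \<equiv> transpose B1 *v a + transpose D1 *v f"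
  shows "x \<bullet> (filter_lmi A B1 B2 C D1 D2 \<mu> X Z Q F L R *v x)
    = form (X - Z) (c + \<alpha>) + form Z (c + d + (\<alpha> + transpose K *v \<beta> + transpose Ah *v b))
      + (norm (e + (transpose R *v \<beta> - transpose B2 *v a - transpose D2 *v f + transpose F *v b)))\<^sup>2
      + dissipation A B1 B2 C D1 D2 \<mu> (X - Z) Z Ah F K R a b f"
proof -
  define \<nu> where "\<nu> = transpose R *v \<beta> - transpose B2 *v a - transpose D2 *v f + transpose F *v b"
  define \<eta> where "\<eta> = \<alpha> + transpose K *v \<beta> + transpose Ah *v b"
  have t: "transpose X = X" "transpose Z = Z" using sym by (simp_all add: symmetric_matrix_def)
  have symW: "symmetric_matrix (X - Z)" using t by (simp add: symmetric_matrix_def transpose_diff)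
  have W: "(X - Z) *v v = X *v v - Z *v v" for v by (simp add: matrix_vector_mult_diff_rdistrib)
  have e2: "Z *v \<alpha> + transpose L *v \<beta> + transpose Q *v b = Z *v \<eta>"
    unfolding Q L \<eta>_def by (simp add: matrix_transpose_mul t matrix_vector_right_distrib
        flip: matrix_vector_mul_assoc)
  then have e1: "X *v \<alpha> + transpose L *v \<beta> + transpose Q *v b = (X - Z) *v \<alpha> + Z *v \<eta>"
    unfolding W by (simp add: algebra_simps)
  have fX: "form X v = form (X - Z) v + form Z v" for v by (simp add: form_def W inner_diff_right)
  have "x \<bullet> (filter_lmi A B1 B2 C D1 D2 \<mu> X Z Q F L R *v x)
     = form X a + 2 * (a \<bullet> (Z *v b)) + form Z b + form X c + 2 * (c \<bullet> (Z *v d)) + form Z d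
       + (norm e)\<^sup>2 + \<mu>\<^sup>2 * (norm f)\<^sup>2 + 2 * (c \<bullet> ((X - Z) *v \<alpha> + Z *v \<eta>)) + 2 * (d \<bullet> (Z *v \<eta>)) + 2 * (e \<bullet> \<nu>)"
    using filter_lmi_form[OF sym, of x A B1 B2 C D1 D2 \<mu> Q F L R]
    unfolding a_def[symmetric] b_def[symmetric] c_def[symmetric] d_def[symmetric] e_def[symmetric]
      f_def[symmetric] \<alpha>_def[symmetric] \<beta>_def[symmetric] e1 e2 \<nu>_def[symmetric]
    by (simp add: form_def power2_norm_eq_inner)
  also have "form X c = form (X - Z) c + form Z c" by (rule fX)
  also have "2 * (c \<bullet> ((X - Z) *v \<alpha> + Z *v \<eta>)) = 2 * (c \<bullet> ((X - Z) *v \<alpha>)) + 2 * (c \<bullet> (Z *v \<eta>))"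
    by (simp add: inner_add_right)
  finally show ?thesis
    unfolding dissipation_def Let_def \<alpha>_def[symmetric] \<beta>_def[symmetric] \<nu>_def[symmetric] \<eta>_def[symmetric]
      form_add[OF symW, of c \<alpha>] form_add[OF sym(2), of "c + d" \<eta>] form_add[OF sym(2), of c d]
      form_add[OF sym(2), of a b]
    by (simp add: power2_norm_eq_inner inner_add_left inner_add_right inner_commute[of \<nu> e] fX[of a])
qed

lemma dissipation_zero: "dissipation A B1 B2 C D1 D2 \<mu> W Z Ah F K R 0 0 0 = 0"
  by (simp add: dissipation_def form_def)

lemma filter_lmi_symmetric:
  assumes "symmetric_matrix X" "symmetric_matrix Z"
  shows "symmetric_matrix (filter_lmi A B1 B2 C D1 D2 \<mu> X Z Q F L R)"
proof -
  have t: "X $ i $ j = X $ j $ i" "Z $ i $ j = Z $ j $ i" for i j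
    using assms unfolding symmetric_matrix_def transpose_def vec_eq_iff by simp_all
  show ?thesis
    unfolding symmetric_matrix_def filter_lmi_def Let_def vec_eq_iff
    by (simp add: transpose_def hcat_def vcat_def t[symmetric] mat_def split: sum.split)
qed

text \<open>
  Evaluate the form at vectors for which all but one of the terms of the completed square vanish.
\<close>

lemma filter_lmi_necessary:
  fixes A :: "real^'n^'n" and B1 :: "real^'m^'n" and B2 :: "real^'r^'n"
    and C :: "real^'n^'p" and D1 :: "real^'m^'p" and D2 :: "real^'r^'p"
    and X Z Ah :: "real^'n^'n" and F :: "real^'r^'n" and K :: "real^'n^'m" and R :: "real^'r^'m"
  assumes sym: "symmetric_matrix X" "symmetric_matrix Z"
    and lmi: "pos_def (filter_lmi A B1 B2 C D1 D2 \<mu> X Z (Ah ** Z) F (K ** Z) R)"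
  shows "v \<noteq> 0 \<Longrightarrow> 0 < form (X - Z) v" and "v \<noteq> 0 \<Longrightarrow> 0 < form Z v"
    and "a \<noteq> 0 \<or> b \<noteq> 0 \<or> f \<noteq> 0 \<Longrightarrow> 0 < dissipation A B1 B2 C D1 D2 \<mu> (X - Z) Z Ah F K R a b f"
proof -
  let ?M = "filter_lmi A B1 B2 C D1 D2 \<mu> X Z (Ah ** Z) F (K ** Z) R"
  have pos: "0 < x \<bullet> (?M *v x)" if "x \<noteq> 0" for x using lmi that by (simp add: pos_def_def)
  note sq = filter_lmi_completed_squares[OF sym refl refl, of _ A B1 B2 C D1 D2 \<mu> Ah F K R]
  note z = stack_eq_0_iff
  have m0: "M *v 0 = 0" for M :: "real^'x^'y" by simp
  show "0 < form (X - Z) v" if "v \<noteq> 0" for v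
  proof -
    have "(0 \<frown> 0 \<frown> v \<frown> - v \<frown> 0 \<frown> 0) \<noteq> (0 :: real^('n + 'n + 'n + 'n + 'r + 'p))"
      using that by (simp add: z)
    from pos[OF this] show ?thesis unfolding sq by (simp add: dissipation_zero form_def)
  qed
  show "0 < form Z v" if "v \<noteq> 0" for v
  proof -
    have "(0 \<frown> 0 \<frown> 0 \<frown> v \<frown> 0 \<frown> 0) \<noteq> (0 :: real^('n + 'n + 'n + 'n + 'r + 'p))"
      using that by (simp add: z)
    from pos[OF this] show ?thesis unfolding sq by (simp add: dissipation_zero form_def)
  qed
  show "0 < dissipation A B1 B2 C D1 D2 \<mu> (X - Z) Z Ah F K R a b f" if "a \<noteq> 0 \<or> b \<noteq> 0 \<or> f \<noteq> 0"
  proof -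
    let ?\<alpha> = "transpose A *v a + transpose C *v f" and ?\<beta> = "transpose B1 *v a + transpose D1 *v f"
    let ?\<nu> = "transpose R *v ?\<beta> - transpose B2 *v a - transpose D2 *v f + transpose F *v b"
    let ?\<eta> = "?\<alpha> + transpose K *v ?\<beta> + transpose Ah *v b"
    let ?x = "a \<frown> b \<frown> - ?\<alpha> \<frown> ?\<alpha> - ?\<eta> \<frown> - ?\<nu> \<frown> f"
    have "?x \<noteq> 0" using that by (auto simp: z)
    from pos[OF this] show ?thesis unfolding sq by (simp add: form_def)
  qed
qed

lemma filter_lmi_sufficient:
  fixes A :: "real^'n^'n" and B1 :: "real^'m^'n" and B2 :: "real^'r^'n"
    and C :: "real^'n^'p" and D1 :: "real^'m^'p" and D2 :: "real^'r^'p"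
    and X Z Ah :: "real^'n^'n" and F :: "real^'r^'n" and K :: "real^'n^'m" and R :: "real^'r^'m"
  assumes sym: "symmetric_matrix X" "symmetric_matrix Z"
    and W: "\<And>v. v \<noteq> 0 \<Longrightarrow> 0 < form (X - Z) v" and Z: "\<And>v. v \<noteq> 0 \<Longrightarrow> 0 < form Z v"
    and d: "\<And>a b f. a \<noteq> 0 \<or> b \<noteq> 0 \<or> f \<noteq> 0 \<Longrightarrow>
      0 < dissipation A B1 B2 C D1 D2 \<mu> (X - Z) Z Ah F K R a b f"
  shows "pos_def (filter_lmi A B1 B2 C D1 D2 \<mu> X Z (Ah ** Z) F (K ** Z) R)"
  unfolding pos_def_def
proof (intro conjI allI impI)
  let ?M = "filter_lmi A B1 B2 C D1 D2 \<mu> X Z (Ah ** Z) F (K ** Z) R"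
  show "symmetric_matrix ?M" using filter_lmi_symmetric[OF sym] .
  fix x :: "real^('n + 'n + 'n + 'n + 'r + 'p)" assume x: "x \<noteq> 0"
  have nn: "0 \<le> form (X - Z) v" "0 \<le> form Z v" for v
    using W[of v] Z[of v] by (cases "v = 0"; force simp: form_def)+
  define a where "a = upper x"
  define b where "b = upper (lower x)"
  define c where "c = upper (lower (lower x))"
  define g where "g = upper (lower (lower (lower x)))"
  define e where "e = upper (lower (lower (lower (lower x))))"
  define f where "f = lower (lower (lower (lower (lower x))))"
  note sq = filter_lmi_completed_squares[OF sym refl refl, of x A B1 B2 C D1 D2 \<mu> Ah F K R,
      folded a_def b_def c_def g_def e_def f_def]
  show "0 < x \<bullet> (?M *v x)"
  proof (cases "a \<noteq> 0 \<or> b \<noteq> 0 \<or> f \<noteq> 0")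
    case True
    from d[OF this] show ?thesis unfolding sq by (intro add_nonneg_pos add_nonneg_nonneg nn zero_le_power2)
  next
    case False
    then have *: "x \<bullet> (?M *v x) = form (X - Z) c + form Z (c + g) + (norm e)\<^sup>2"
      unfolding sq by (simp add: dissipation_zero)
    have "c \<noteq> 0 \<or> c + g \<noteq> 0 \<or> e \<noteq> 0"
      using x False by (auto simp: stack_eq_0_iff[of x] stack_eq_0_iff[of "lower _"] a_def b_def c_def g_def e_def f_def)
    then show ?thesis unfolding *
      using W[of c] Z[of "c + g"] nn(1)[of c] nn(2)[of "c + g"]
      by (smt (verit) zero_le_power2 zero_less_norm_iff zero_less_power)
  qed
qed

section \<open>From the game value to the matrix inequality\<close>

lemma quadratic_form_form: "quadratic_form (form M)"
proof -
  let ?b = "\<lambda>x y. (x \<bullet> (M *v y) + y \<bullet> (M *v x)) / 2"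
  have "?b x y = ?b y x" for x y by (simp add: add.commute)
  then show ?thesis
    by (intro quadratic_formI[of ?b])
      (simp_all add: form_def inner_add_left inner_add_right matrix_vector_right_distrib
        matrix_vector_mult_scaleR field_simps)
qed

lemma symmetric_matrixI:
  assumes "\<And>x y. x \<bullet> (M *v y) = y \<bullet> (M *v x)"
  shows "symmetric_matrix M"
proof -
  have "transpose M *v y = M *v y" for y
    by (rule vector_eq_ldot[THEN iffD1]) (simp add: inner_transpose_swap assms)
  then show ?thesis unfolding symmetric_matrix_def by (simp add: matrix_eq)
qed

lemma matrix_of_quadratic_form:
  fixes q :: "real^'n \<Rightarrow> real"
  assumes "quadratic_form q"
  shows "\<exists>M. symmetric_matrix M \<and> q = form M"
proof -
  obtain b where b0: "\<forall>x y z. b (x + y) z = b x z + b y z" "\<forall>r x z. b (r *\<^sub>R x) z = r * b x z"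
    "\<forall>x y. b x y = b y x" "\<forall>x. q x = b x x" and "bilinear b"
    using quadratic_formD[OF assms] by (elim exE conjE) (rule that)
  note b = b0[rule_format]
  have lin: "linear (\<lambda>x. b x y)" for y by (rule linearI) (simp_all add: b(1,2))
  have lin': "linear (\<lambda>y. b x y)" for x
    using lin[of x] by (simp add: b(3)[of x])
  define g where "g y = (\<chi> i. b (axis i 1) y)" for y
  have "linear g"
    unfolding g_def by (rule linearI) (simp_all add: vec_eq_iff linear_add[OF lin'] linear_cmul[OF lin'])
  then have M: "matrix g *v y = g y" for y by (simp add: matrix_works)
  have xb: "x \<bullet> (matrix g *v y) = b x y" for x y
  proof -
    have "b x y = b (\<Sum>i\<in>UNIV. (x $ i) *\<^sub>R axis i 1) y"
      by (simp only: basis_expansion[of x, unfolded scalar_mult_eq_scaleR])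
    also have "\<dots> = (\<Sum>i\<in>UNIV. x $ i * b (axis i 1) y)"
      by (simp add: linear_sum[OF lin] b(2))
    finally show ?thesis unfolding M by (simp add: inner_vec_def g_def)
  qed
  have "symmetric_matrix (matrix g)" by (rule symmetric_matrixI) (simp only: xb b(3))
  moreover have "q = form (matrix g)" by (rule ext) (simp add: form_def xb b(4))
  ultimately show ?thesis by blast
qed

lemma quadratic_form_bounded:
  fixes q :: "'a::euclidean_space \<Rightarrow> real"
  assumes "quadratic_form q"
  shows "\<exists>c\<ge>0. \<forall>x. q x \<le> c * (norm x)\<^sup>2"
proof -
  obtain b where "bilinear b" and q: "\<forall>x. q x = b x x" using assms unfolding quadratic_form_def by blast
  then have "bounded_bilinear b" by (simp add: bilinear_conv_bounded_bilinear)
  then obtain K where K: "0 \<le> K" "\<And>x y. norm (b x y) \<le> norm x * norm y * K"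
    using bounded_bilinear.nonneg_bounded by blast
  have "q x \<le> K * (norm x)\<^sup>2" for x
    using K(2)[of x x] q by (simp add: power2_eq_square mult.commute)
  with K(1) show ?thesis by blast
qed

lemma positive_quadratic_form_coercive:
  fixes q :: "'a::euclidean_space \<Rightarrow> real"
  assumes q: "quadratic_form q" and pos: "\<And>x. x \<noteq> 0 \<Longrightarrow> 0 < q x"
  shows "\<exists>\<delta>>0. \<forall>x. \<delta> * (norm x)\<^sup>2 \<le> q x"
proof -
  obtain b where b: "bilinear b" and qb: "\<forall>x. q x = b x x"
    using q unfolding quadratic_form_def by blast
  have scale: "q (r *\<^sub>R x) = r\<^sup>2 * q x" for r x
    using bilinear_lmul[OF b] bilinear_rmul[OF b] by (simp add: qb power2_eq_square)
  have "bounded_bilinear b" using b by (simp add: bilinear_conv_bounded_bilinear)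
  then have "continuous_on (sphere 0 1) (\<lambda>x. b x x)"
    by (rule bounded_bilinear.continuous_on) (rule continuous_on_id)+
  then have cont: "continuous_on (sphere 0 1) q" by (simp add: qb)
  obtain e :: 'a where "norm e = 1" using vector_choose_size[of 1] by auto
  then have "sphere (0::'a) 1 \<noteq> {}" by force
  from continuous_attains_inf[OF compact_sphere this cont]
  obtain x0 where x0: "norm x0 = 1" "\<And>x. norm x = 1 \<Longrightarrow> q x0 \<le> q x" by auto
  have "q x0 * (norm x)\<^sup>2 \<le> q x" for x
  proof (cases "x = 0")
    case True
    then show ?thesis using scale[of 0 0] by simp
  next
    case False
    then have "q x0 \<le> q ((1 / norm x) *\<^sub>R x)" by (intro x0(2)) simp
    also have "\<dots> = q x / (norm x)\<^sup>2" unfolding scale by (simp add: power_divide)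
    finally show ?thesis using False by (simp add: pos_le_divide_eq)
  qed
  moreover have "0 < q x0" using x0(1) by (intro pos) auto
  ultimately show ?thesis by blast
qed

text \<open>
  The solution is the sum of \<open>A\<^sup>k (A\<^sup>T)\<^sup>k\<close> over \<open>k < N\<close>, with \<open>N\<close> so large that the power \<open>N\<close> at least halves
  all vectors: the difference of the two forms telescopes, and \<open>3/4 = 1 - (1/2)\<^sup>2\<close>.
\<close>

lemma stein_inequality_solution:
  fixes A :: "real^'n^'n"
  assumes "schur_stable A"
  shows "\<exists>W. symmetric_matrix W \<and> (\<forall>v. 0 \<le> form W v) \<and>
    (\<forall>v. form W (transpose A *v v) + 3/4 * (norm v)\<^sup>2 \<le> form W v)"
proof -
  let ?f = "\<lambda>k. (*v) (transpose A) ^^ k"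
  obtain N where N: "\<And>v. norm (?f N v) \<le> 1/2 * norm v"
    using schur_stable_power_contraction[OF schur_stable_transpose[OF assms], of "1/2"] by auto
  define w where "w v = (\<Sum>k<N. (norm (?f k v))\<^sup>2)" for v
  have lin: "linear (?f k)" for k by (intro linear_funpow matrix_vector_mul_linear)
  have "quadratic_form (\<lambda>v. \<Sum>k<n. (norm (?f k v))\<^sup>2)" for n
    by (induction n) (auto intro: quadratic_form_0 quadratic_form_add
        quadratic_form_compose[OF quadratic_form_norm lin])
  then have "quadratic_form w" by (simp add: w_def[abs_def])
  then obtain W where W: "symmetric_matrix W" "w = form W" using matrix_of_quadratic_form by blast
  have "w (transpose A *v v) + 3/4 * (norm v)\<^sup>2 \<le> w v" for v
  proof -
    have "w (transpose A *v v) = (\<Sum>k<N. (norm (?f (Suc k) v))\<^sup>2)"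
      by (simp add: w_def funpow_swap1)
    also have "\<dots> = w v + (norm (?f N v))\<^sup>2 - (norm v)\<^sup>2"
      using sum.lessThan_Suc_shift[of "\<lambda>k. (norm (?f k v))\<^sup>2" N] by (simp add: w_def del: funpow.simps)
    finally show ?thesis using power_mono[OF N[of v], of 2] by (simp add: power_mult_distrib power_divide)
  qed
  moreover have "0 \<le> w v" for v by (simp add: w_def sum_nonneg)
  ultimately show ?thesis using W by auto
qed

lemma form_pos_invertible:
  assumes "\<And>v. v \<noteq> 0 \<Longrightarrow> 0 < form M v"
  shows "invertible M"
proof -
  have "v = 0" if "M *v v = 0" for v using assms[of v] that by (auto simp: form_def)
  then show ?thesis unfolding invertible_left_inverse matrix_left_invertible_ker by blast
qed

lemma form_diff:
  "symmetric_matrix M \<Longrightarrow> form M (v - w) = form M v - 2 * (v \<bullet> (M *v w)) + form M w"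
  using inner_symmetric[of M w v]
  by (simp add: form_def matrix_vector_mult_diff_distrib inner_diff_left inner_diff_right)

lemma completed_square_bound:
  fixes m :: real
  assumes "0 \<le> a - 2 * m * b + m * c" "0 < m"
  shows "2 * b \<le> a / m + c"
proof -
  have "2 * b * m \<le> a + c * m" using assms(1) by (simp add: algebra_simps)
  then have "2 * b \<le> (a + c * m) / m" using assms(2) by (simp only: pos_le_divide_eq)
  also have "(a + c * m) / m = a / m + c" using assms(2) by (simp add: add_divide_distrib)
  finally show ?thesis .
qed

text \<open>
  The dual storage matrix is \<open>\<mu>\<^sup>2 V\<^sup>-\<^sup>1\<close>. Testing the primal inequality at \<open>x = Z p\<close> and \<open>w = \<nu>\<close>, where
  \<open>p\<close> and \<open>\<nu>\<close> are the two components of the adjoint at \<open>(g, f)\<close>, makes the pairing of the output of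
  the system with \<open>(g, f)\<close> equal to the left-hand side, and Young's inequality bounds this pairing.
\<close>

lemma dual_dissipation:
  fixes V :: "real^'n^'n" and M :: "real^'n^'n" and N :: "real^'r^'n" and S :: "real^'n^'p" and T :: "real^'r^'p"
  assumes V: "symmetric_matrix V" "\<And>v. v \<noteq> 0 \<Longrightarrow> 0 < form V v" and \<mu>: "0 < \<mu>"
    and primal: "\<And>x w. x \<noteq> 0 \<or> w \<noteq> 0 \<Longrightarrow>
       (norm (S *v x + T *v w))\<^sup>2 + form V (M *v x + N *v w) < form V x + \<mu>\<^sup>2 * (norm w)\<^sup>2"
  shows "\<exists>Z. symmetric_matrix Z \<and> (\<forall>v. v \<noteq> 0 \<longrightarrow> 0 < form Z v) \<and>
     (\<forall>g f. g \<noteq> 0 \<or> f \<noteq> 0 \<longrightarrow>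
        form Z (transpose M *v g + transpose S *v f) + (norm (transpose N *v g + transpose T *v f))\<^sup>2
          < form Z g + \<mu>\<^sup>2 * (norm f)\<^sup>2)"
proof -
  have inv: "invertible V" by (rule form_pos_invertible[OF V(2)])
  define Z where "Z = \<mu>\<^sup>2 *\<^sub>R matrix_inv V"
  have Z: "Z *v g = \<mu>\<^sup>2 *\<^sub>R (matrix_inv V *v g)" for g
    by (simp add: Z_def scaleR_matrix_vector_assoc)
  have VZ: "V *v (Z *v g) = \<mu>\<^sup>2 *\<^sub>R g" for g
    unfolding Z by (simp add: matrix_vector_mult_scaleR matrix_vector_mul_assoc matrix_inv_right[OF inv])
  have symVi: "x \<bullet> (matrix_inv V *v y) = y \<bullet> (matrix_inv V *v x)" for x y
  proof -
    have "x \<bullet> (matrix_inv V *v y) = (V *v (matrix_inv V *v x)) \<bullet> (matrix_inv V *v y)"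
      by (simp add: matrix_vector_mul_assoc matrix_inv_right[OF inv])
    also have "\<dots> = (V *v (matrix_inv V *v y)) \<bullet> (matrix_inv V *v x)"
      using inner_symmetric[OF V(1)] by (simp add: inner_commute)
    finally show ?thesis by (simp add: matrix_vector_mul_assoc matrix_inv_right[OF inv])
  qed
  then have symZ: "symmetric_matrix Z" by (intro symmetric_matrixI) (simp add: Z symVi)
  have VZform: "form V (Z *v g) = \<mu>\<^sup>2 * form Z g" for g
    by (simp add: form_def VZ inner_commute)
  have Zpos: "0 < form Z g" if "g \<noteq> 0" for g
  proof -
    have "Z *v g \<noteq> 0" using VZ[of g] that \<mu> by auto
    then have "0 < \<mu>\<^sup>2 * form Z g" using V(2) VZform by metis
    then show ?thesis using \<mu> by (simp add: zero_less_mult_iff)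
  qed
  have young: "2 * (g \<bullet> \<xi>) \<le> form V \<xi> / \<mu>\<^sup>2 + form Z g" for g \<xi>
  proof -
    have "0 \<le> form V (\<xi> - Z *v g)"
      using V(2)[of "\<xi> - Z *v g"] by (cases "\<xi> - Z *v g = 0") (auto simp: form_def)
    also have "\<dots> = form V \<xi> - 2 * \<mu>\<^sup>2 * (g \<bullet> \<xi>) + \<mu>\<^sup>2 * form Z g"
      unfolding form_diff[OF V(1)] VZform VZ by (simp add: inner_commute)
    finally show ?thesis using \<mu> by (intro completed_square_bound) simp_all
  qed
  have "form Z (transpose M *v g + transpose S *v f) + (norm (transpose N *v g + transpose T *v f))\<^sup>2
          < form Z g + \<mu>\<^sup>2 * (norm f)\<^sup>2" if gf: "g \<noteq> 0 \<or> f \<noteq> 0" for g f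
  proof -
    define p where "p = transpose M *v g + transpose S *v f"
    define \<nu> where "\<nu> = transpose N *v g + transpose T *v f"
    let ?x = "Z *v p" and ?s = "form Z p + (norm \<nu>)\<^sup>2"
    let ?\<xi> = "M *v ?x + N *v \<nu>" and ?y = "S *v ?x + T *v \<nu>"
    have s: "?s = g \<bullet> ?\<xi> + f \<bullet> ?y"
    proof -
      have "?s = ?x \<bullet> p + \<nu> \<bullet> \<nu>" by (simp add: form_def power2_norm_eq_inner inner_commute)
      also have "?x \<bullet> p = g \<bullet> (M *v ?x) + f \<bullet> (S *v ?x)"
        by (simp add: p_def[of] inner_add_right inner_transpose_swap)
      also have "\<nu> \<bullet> \<nu> = g \<bullet> (N *v \<nu>) + f \<bullet> (T *v \<nu>)"
        by (subst (2) \<nu>_def) (simp add: inner_add_right inner_transpose_swap)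
      finally show ?thesis by (simp add: inner_add_right)
    qed
    have yf: "2 * (f \<bullet> ?y) \<le> (norm ?y)\<^sup>2 / \<mu>\<^sup>2 + \<mu>\<^sup>2 * (norm f)\<^sup>2"
    proof -
      have "0 \<le> (norm (?y - \<mu>\<^sup>2 *\<^sub>R f))\<^sup>2" by simp
      also have "\<dots> = (norm ?y)\<^sup>2 - 2 * \<mu>\<^sup>2 * (f \<bullet> ?y) + \<mu>\<^sup>2 * (\<mu>\<^sup>2 * (norm f)\<^sup>2)"
        unfolding power2_norm_eq_inner inner_diff_left inner_diff_right
        by (simp add: inner_commute[of "?y" f])
      finally show ?thesis using \<mu> by (intro completed_square_bound) simp_all
    qed
    have upper: "2 * ?s \<le> ((norm ?y)\<^sup>2 + form V ?\<xi>) / \<mu>\<^sup>2 + (form Z g + \<mu>\<^sup>2 * (norm f)\<^sup>2)"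
      using young[of g ?\<xi>] yf unfolding s by (simp add: add_divide_distrib)
    show ?thesis
    proof (cases "?x = 0 \<and> \<nu> = 0")
      case True
      then have "?s = 0" by (simp add: form_def)
      moreover have "0 < form Z g + \<mu>\<^sup>2 * (norm f)\<^sup>2"
      proof (cases "g = 0")
        case True
        then show ?thesis using gf \<mu> by (simp add: form_def)
      next
        case False
        then show ?thesis using Zpos[of g] by (intro add_pos_nonneg) auto
      qed
      ultimately show ?thesis unfolding p_def[symmetric] \<nu>_def[symmetric] by linarith
    next
      case False
      then have "(norm ?y)\<^sup>2 + form V ?\<xi> < \<mu>\<^sup>2 * ?s"
        using primal[of ?x \<nu>] by (auto simp: VZform distrib_left)
      then have "((norm ?y)\<^sup>2 + form V ?\<xi>) / \<mu>\<^sup>2 < ?s" using \<mu> by (simp add: pos_divide_less_eq mult.commute)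
      moreover have "s < u" if "2 * s \<le> t + u" "t < s" for s t u :: real using that by linarith
      ultimately show ?thesis unfolding p_def[symmetric] \<nu>_def[symmetric] using upper by blast
    qed
  qed
  with symZ Zpos show ?thesis by blast
qed

text \<open>
  The filter simulates the plant, so its state differs from that of the plant by an error with
  dynamics \<open>A\<close> that is not driven by \<open>w\<close>. Taking \<open>X - Z = \<epsilon> W\<close> with \<open>W\<close> from
  \<open>stein_inequality_solution\<close>, the error contributes a term of order \<open>\<epsilon>\<close>, whose indefinite part is
  dominated by the margin \<open>\<delta>\<close> of the dual inequality if \<open>\<epsilon>\<close> is small.
\<close>

lemma lmi_feasible_if_full_information:
  fixes A :: "real^'n^'n" and B1 :: "real^'m^'n" and B2 :: "real^'r^'n"
    and C :: "real^'n^'p" and D1 :: "real^'m^'p" and D2 :: "real^'r^'p"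
    and Z :: "real^'n^'n" and K :: "real^'n^'m" and R :: "real^'r^'m"
  assumes A: "schur_stable A"
    and Z: "symmetric_matrix Z" "\<And>v. v \<noteq> 0 \<Longrightarrow> 0 < form Z v"
    and dual: "\<And>g f. g \<noteq> 0 \<or> f \<noteq> 0 \<Longrightarrow>
        form Z (transpose (A + B1 ** K) *v g + transpose (C + D1 ** K) *v f)
          + (norm (transpose (B1 ** R - B2) *v g + transpose (D1 ** R - D2) *v f))\<^sup>2
          < form Z g + \<mu>\<^sup>2 * (norm f)\<^sup>2"
  shows "\<exists>X. symmetric_matrix X \<and>
    pos_def (filter_lmi A B1 B2 C D1 D2 \<mu> X Z ((A + B1 ** K) ** Z) (B1 ** R - B2) (K ** Z) R)"
proof -
  obtain W where W: "symmetric_matrix W" "\<And>v. 0 \<le> form W v"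
    "\<And>v. form W (transpose A *v v) + 3/4 * (norm v)\<^sup>2 \<le> form W v"
    using stein_inequality_solution[OF A] by blast
  let ?p = "\<lambda>g f. transpose (A + B1 ** K) *v g + transpose (C + D1 ** K) *v f"
  let ?\<nu> = "\<lambda>g f. transpose (B1 ** R - B2) *v g + transpose (D1 ** R - D2) *v f"
  let ?E = "\<lambda>g f. form Z g + \<mu>\<^sup>2 * (norm f)\<^sup>2 - (form Z (?p g f) + (norm (?\<nu> g f))\<^sup>2)"
  have lin: "linear (\<lambda>z :: (real^'n) \<times> (real^'p). M *v fst z + M' *v snd z)"
    for M :: "real^'n^'k" and M' :: "real^'p^'k"
    by (rule linearI; simp add: matrix_vector_right_distrib matrix_vector_mult_scaleR algebra_simps)
  have "quadratic_form (\<lambda>z :: (real^'n) \<times> (real^'p). ?E (fst z) (snd z))"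
    by (intro quadratic_form_add quadratic_form_diff quadratic_form_scale
        quadratic_form_compose[OF quadratic_form_norm] quadratic_form_compose[OF quadratic_form_form]
        lin linear_fst linear_snd)
  from positive_quadratic_form_coercive[OF this] dual
  obtain \<delta> where \<delta>: "0 < \<delta>" "\<And>g f. \<delta> * (norm (g, f))\<^sup>2 \<le> ?E g f"
    by (force simp: zero_prod_def)
  have E: "\<delta> * ((norm g)\<^sup>2 + (norm f)\<^sup>2) \<le> ?E g f" for g f
    using \<delta>(2)[of g f] by (simp add: norm_Pair)
  \<comment> \<open>Young's inequality splits the cross term; it may cost \<open>1/4\<close> of the \<open>3/4\<close> available.\<close>
  obtain c where c: "0 \<le> c" "\<And>a f. form W a - form W (transpose A *v a + transpose C *v f)
      \<ge> 1/2 * (norm a)\<^sup>2 - c * (norm f)\<^sup>2"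
  proof -
    have "quadratic_form (\<lambda>v. form W (transpose C *v v))"
      by (rule quadratic_form_compose[OF quadratic_form_form matrix_vector_mul_linear])
    from quadratic_form_bounded[OF this]
    obtain c1 where c1: "0 \<le> c1" "\<And>v. form W (transpose C *v v) \<le> c1 * (norm v)\<^sup>2" by auto
    have "linear (\<lambda>v. A *v (W *v (transpose C *v v)))"
      by (rule linearI) (simp_all add: matrix_vector_right_distrib matrix_vector_mult_scaleR)
    from quadratic_form_bounded[OF quadratic_form_compose[OF quadratic_form_norm this]]
    obtain c2 where c2: "0 \<le> c2"
      "\<And>v. (norm (A *v (W *v (transpose C *v v))))\<^sup>2 \<le> c2 * (norm v)\<^sup>2" by auto
    have "form W a - form W (transpose A *v a + transpose C *v f)
      \<ge> 1/2 * (norm a)\<^sup>2 - (4 * c2 + c1) * (norm f)\<^sup>2" for a f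
    proof -
      let ?h = "A *v (W *v (transpose C *v f))"
      have "2 * ((transpose A *v a) \<bullet> (W *v (transpose C *v f))) = 2 * (a \<bullet> ?h)"
        by (simp only: inner_commute[of "transpose A *v a"] inner_transpose_swap)
      also have "\<dots> \<le> 1/4 * (norm a)\<^sup>2 + 4 * (norm ?h)\<^sup>2"
      proof -
        have "0 \<le> (norm ((1/2) *\<^sub>R a - 2 *\<^sub>R ?h))\<^sup>2" by simp
        also have "\<dots> = 1/4 * (norm a)\<^sup>2 - 2 * (a \<bullet> ?h) + 4 * (norm ?h)\<^sup>2"
          unfolding power2_norm_eq_inner
          by (simp add: inner_diff_left inner_diff_right inner_commute)
        finally show ?thesis by simp
      qed
      finally show ?thesis
        unfolding form_add[OF W(1)] using W(3)[of a] c1(2)[of f] c2(2)[of f]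
        by (simp add: algebra_simps)
    qed
    then show thesis using that[of "4 * c2 + c1"] c1(1) c2(1) by simp
  qed
  define \<epsilon> where "\<epsilon> = \<delta> / (2 * (c + 1))"
  have \<epsilon>: "0 < \<epsilon>" "\<epsilon> * c < \<delta>"
  proof -
    show "0 < \<epsilon>" using \<delta>(1) c(1) by (simp add: \<epsilon>_def)
    have "\<epsilon> * (2 * (c + 1)) = \<delta>" using c(1) by (simp add: \<epsilon>_def)
    then have "\<delta> = 2 * \<epsilon> + 2 * (\<epsilon> * c)" by (simp add: algebra_simps)
    moreover have "0 \<le> \<epsilon> * c" using \<open>0 < \<epsilon>\<close> c(1) by simp
    ultimately show "\<epsilon> * c < \<delta>" using \<open>0 < \<epsilon>\<close> by linarith
  qed
  let ?X = "Z + \<epsilon> *\<^sub>R W"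
  have XZ: "?X - Z = \<epsilon> *\<^sub>R W" by simp
  have fW: "form (\<epsilon> *\<^sub>R W) v = \<epsilon> * form W v" for v
    by (simp add: form_def scaleR_matrix_vector_assoc[symmetric])
  have symX: "symmetric_matrix ?X"
    using Z(1) W(1) by (simp add: symmetric_matrix_def transpose_add transpose_scalar)
  have "pos_def (filter_lmi A B1 B2 C D1 D2 \<mu> ?X Z ((A + B1 ** K) ** Z) (B1 ** R - B2) (K ** Z) R)"
  proof (rule filter_lmi_sufficient[OF symX Z(1) _ Z(2)])
    show "0 < form (?X - Z) v" if "v \<noteq> 0" for v
    proof -
      have "0 < 3/4 * (norm v)\<^sup>2" using that by simp
      also have "\<dots> \<le> form W v" using W(3)[of v] W(2)[of "transpose A *v v"] by linarith
      finally show ?thesis unfolding XZ fW using \<epsilon>(1) by simp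
    qed
    fix a b :: "real^'n" and f :: "real^'p" assume abf: "a \<noteq> 0 \<or> b \<noteq> 0 \<or> f \<noteq> 0"
    let ?g = "a + b"
    let ?\<alpha> = "transpose A *v a + transpose C *v f" and ?\<beta> = "transpose B1 *v a + transpose D1 *v f"
    have 1: "?\<alpha> + transpose K *v ?\<beta> + transpose (A + B1 ** K) *v b = ?p ?g f"
      by (simp add: transpose_add matrix_transpose_mul matrix_vector_right_distrib
          matrix_vector_mult_add_rdistrib flip: matrix_vector_mul_assoc)
    have 2: "transpose R *v ?\<beta> - transpose B2 *v a - transpose D2 *v f + transpose (B1 ** R - B2) *v b
        = ?\<nu> ?g f"
      by (simp add: transpose_diff matrix_transpose_mul matrix_vector_right_distrib
          matrix_vector_mult_diff_rdistrib flip: matrix_vector_mul_assoc)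
    have diss: "dissipation A B1 B2 C D1 D2 \<mu> (?X - Z) Z (A + B1 ** K) (B1 ** R - B2) K R a b f
        = \<epsilon> * (form W a - form W ?\<alpha>) + ?E ?g f"
      unfolding dissipation_def Let_def 1 2 XZ fW by (simp add: algebra_simps)
    have "0 < \<epsilon> / 2 * (norm a)\<^sup>2 + \<delta> * (norm ?g)\<^sup>2 + (\<delta> - \<epsilon> * c) * (norm f)\<^sup>2"
    proof -
      have "0 \<le> \<epsilon> / 2 * (norm a)\<^sup>2" "0 \<le> \<delta> * (norm ?g)\<^sup>2" "0 \<le> (\<delta> - \<epsilon> * c) * (norm f)\<^sup>2"
        using \<epsilon> \<delta>(1) by simp_all
      moreover have "a \<noteq> 0 \<Longrightarrow> 0 < \<epsilon> / 2 * (norm a)\<^sup>2" "?g \<noteq> 0 \<Longrightarrow> 0 < \<delta> * (norm ?g)\<^sup>2"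
        "f \<noteq> 0 \<Longrightarrow> 0 < (\<delta> - \<epsilon> * c) * (norm f)\<^sup>2"
        using \<epsilon> \<delta>(1) by simp_all
      moreover have "a \<noteq> 0 \<or> ?g \<noteq> 0 \<or> f \<noteq> 0" using abf by auto
      ultimately show ?thesis by linarith
    qed
    also have "\<dots> = \<epsilon> * (1/2 * (norm a)\<^sup>2 - c * (norm f)\<^sup>2) + \<delta> * ((norm ?g)\<^sup>2 + (norm f)\<^sup>2)"
      by (simp add: algebra_simps)
    also have "\<dots> \<le> \<epsilon> * (form W a - form W ?\<alpha>) + ?E ?g f"
      using c(2)[of a f] E[of ?g f] \<epsilon>(1) by (intro add_mono mult_left_mono) auto
    finally show "0 < dissipation A B1 B2 C D1 D2 \<mu> (?X - Z) Z (A + B1 ** K) (B1 ** R - B2) K R a b f"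
      unfolding diss .
  qed
  with symX show ?thesis by blast
qed

section \<open>Necessity of the matrix inequality\<close>

lemma gain_le_cong:
  "(\<And>z v. cmod z = 1 \<Longrightarrow> G z *v v = H z *v v) \<Longrightarrow> gain_le G s \<longleftrightarrow> gain_le H s"
  unfolding gain_le_def by simp

lemma tm_eval_mismatch_mult:
  assumes A: "schur_stable A" and F: "F \<in> RH_inf" and z: "cmod z = 1"
  shows "tm_eval (transfer_matrix A B1 C D1 ** F - transfer_matrix A B2 C D2) z *v v
     = cmat C *v (matrix_inv (mat z - cmat A) *v (cmat B1 *v (tm_eval F z *v v) - cmat B2 *v v))
       + cmat D1 *v (tm_eval F z *v v) - cmat D2 *v v"
  using z A by (simp add: tm_eval_model_mismatch transfer_matrix_RH_inf F tm_eval_transfer_matrix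
      matrix_vector_mult_add_rdistrib matrix_vector_mult_diff_rdistrib matrix_vector_right_distrib
      matrix_vector_mult_diff_distrib flip: matrix_vector_mul_assoc)

text \<open>
  The strict inequality leaves the room \<open>\<mu> - h\<close>; the error \<open>\<eta>\<close> of the approximation is chosen so that,
  amplified by the gain \<open>K1\<close> of the plant, it uses up at most half of it.
\<close>

lemma fir_filter_with_gain:
  fixes A :: "real^'n^'n" and B1 :: "real^'m^'n" and B2 :: "real^'r^'n"
    and C :: "real^'n^'p" and D1 :: "real^'m^'p" and D2 :: "real^'r^'p" and F :: "ratfun^'r^'m"
  assumes \<mu>: "0 < \<mu>" and A: "schur_stable A" and F: "F \<in> RH_inf"
    and norm: "hinf_norm (transfer_matrix A B1 C D1 ** F - transfer_matrix A B2 C D2) < \<mu>"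
  shows "\<exists>d f sy sx su. 0 \<le> sy \<and> sy < \<mu> \<and>
    gain_le (\<lambda>z. cmat C ** matrix_inv (mat z - cmat A) ** (cmat B1 ** fir_eval d f z - cmat B2)
               + (cmat D1 ** fir_eval d f z - cmat D2)) sy \<and>
    gain_le (\<lambda>z. matrix_inv (mat z - cmat A) ** (cmat B1 ** fir_eval d f z - cmat B2)) sx \<and>
    gain_le (fir_eval d f) su"
proof -
  let ?P1 = "transfer_matrix A B1 C D1" and ?P2 = "transfer_matrix A B2 C D2"
  have P1: "?P1 \<in> RH_inf" and P2: "?P2 \<in> RH_inf" by (rule transfer_matrix_RH_inf[OF A])+
  obtain K1 where K1: "0 \<le> K1" "gain_le (tm_eval ?P1) K1" using gain_le_RH_inf[OF P1] by blast
  obtain K2 where K2: "0 \<le> K2" "gain_le (tm_eval ?P2) K2" using gain_le_RH_inf[OF P2] by blast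
  obtain KF where KF: "0 \<le> KF" "gain_le (tm_eval F) KF" using gain_le_RH_inf[OF F] by blast
  define h where "h = max 0 (hinf_norm (?P1 ** F - ?P2))"
  have h: "0 \<le> h" "h < \<mu>" using norm \<mu> by (auto simp: h_def)
  have "gain_le (tm_eval (?P1 ** F - ?P2)) (K1 * KF + K2)"
    using gain_le_diff[OF gain_le_mult[OF K1(2) KF(2) K1(1)] K2(2)]
    by (subst gain_le_cong) (auto simp: tm_eval_model_mismatch P1 P2 F)
  from gain_le_mono[OF gain_le_hinf_norm[OF this], of h]
  have gh: "gain_le (tm_eval (?P1 ** F - ?P2)) h" by (simp add: h_def)
  define \<eta> where "\<eta> = (\<mu> - h) / (2 * (K1 + 1))"
  have \<eta>: "0 < \<eta>" using h K1(1) by (simp add: \<eta>_def)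
  have "\<eta> * (2 * (K1 + 1)) = \<mu> - h" using K1(1) by (simp add: \<eta>_def)
  then have "2 * (K1 * \<eta>) + 2 * \<eta> = \<mu> - h" by (simp add: algebra_simps)
  moreover have "0 \<le> K1 * \<eta>" using K1(1) \<eta> by simp
  ultimately have sy: "h + K1 * \<eta> < \<mu>" "0 \<le> h + K1 * \<eta>" using \<eta> h by linarith+
  obtain d f where fir: "gain_le (\<lambda>z. tm_eval F z - fir_eval d f z) \<eta>"
    using fir_approximation[OF F \<eta>] by blast
  have su: "gain_le (fir_eval d f) (KF + \<eta>)"
    using gain_le_diff[OF KF(2) fir] by (subst (asm) gain_le_cong) auto
  have gy: "gain_le (\<lambda>z. cmat C ** matrix_inv (mat z - cmat A) ** (cmat B1 ** fir_eval d f z - cmat B2)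
               + (cmat D1 ** fir_eval d f z - cmat D2)) (h + K1 * \<eta>)"
    using gain_le_diff[OF gh gain_le_mult[OF K1(2) fir K1(1)]]
  proof (subst (asm) gain_le_cong)
    fix z and v :: "complex^'r" assume z: "cmod z = 1"
    then show "(tm_eval (?P1 ** F - ?P2) z - tm_eval ?P1 z ** (tm_eval F z - fir_eval d f z)) *v v
       = (cmat C ** matrix_inv (mat z - cmat A) ** (cmat B1 ** fir_eval d f z - cmat B2)
               + (cmat D1 ** fir_eval d f z - cmat D2)) *v v"
      using tm_eval_transfer_matrix[OF A, of z B1 C D1]
      by (simp add: tm_eval_mismatch_mult[OF A F] matrix_vector_mult_add_rdistrib
          matrix_vector_mult_diff_rdistrib matrix_vector_right_distrib
          matrix_vector_mult_diff_distrib flip: matrix_vector_mul_assoc)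
  qed
  obtain KR where KR: "0 \<le> KR" "gain_le (\<lambda>z. matrix_inv (mat z - cmat A)) KR"
    using gain_le_resolvent[OF A] by blast
  obtain KB where KB: "0 \<le> KB" "gain_le (\<lambda>z. cmat B1) KB" using gain_le_cmat by blast
  obtain KB2 where KB2: "0 \<le> KB2" "gain_le (\<lambda>z. cmat B2) KB2" using gain_le_cmat by blast
  have gx: "gain_le (\<lambda>z. matrix_inv (mat z - cmat A) ** (cmat B1 ** fir_eval d f z - cmat B2))
      (KR * (KB * (KF + \<eta>) + KB2))"
    by (rule gain_le_mult[OF KR(2) gain_le_diff[OF gain_le_mult[OF KB(2) su KB(1)] KB2(2)] KR(1)])
  from sy gy gx su show ?thesis by blast
qed

lemma linear_on_pair_as_matrices:
  fixes k :: "(real^'n) \<times> (real^'r) \<Rightarrow> real^'m"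
  assumes "linear k"
  shows "\<exists>K R. \<forall>x w. k (x, w) = K *v x + R *v w"
proof -
  have "linear (\<lambda>x. (x :: real^'n, 0 :: real^'r))" "linear (\<lambda>w. (0 :: real^'n, w :: real^'r))"
    by (rule linearI; simp)+
  then have "linear (\<lambda>x. k (x, 0))" "linear (\<lambda>w. k (0, w))"
    using linear_compose[OF _ assms] by (auto simp: o_def)
  then have "matrix (\<lambda>x. k (x, 0)) *v x = k (x, 0)" "matrix (\<lambda>w. k (0, w)) *v w = k (0, w)" for x w
    by (simp_all add: matrix_works)
  moreover have "k (x, w) = k (x, 0) + k (0, w)" for x w
    using linear_add[OF assms, of "(x, 0)" "(0, w)"] by simp
  ultimately show ?thesis by metis
qed

lemma lmi_feasible_if_filter_exists:
  fixes A :: "real^'n^'n" and B1 :: "real^'m^'n" and B2 :: "real^'r^'n"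
    and C :: "real^'n^'p" and D1 :: "real^'m^'p" and D2 :: "real^'r^'p" and F :: "ratfun^'r^'m"
  assumes \<mu>: "0 < \<mu>" and A: "schur_stable A" and F: "F \<in> RH_inf"
    and norm: "hinf_norm (transfer_matrix A B1 C D1 ** F - transfer_matrix A B2 C D2) < \<mu>"
  shows "\<exists>(X :: real^'n^'n) (Z :: real^'n^'n) (Q :: real^'n^'n)
         (F :: real^'r^'n) (L :: real^'n^'m) (R :: real^'r^'m).
         symmetric_matrix X \<and> symmetric_matrix Z \<and>
         pos_def (filter_lmi A B1 B2 C D1 D2 \<mu> X Z Q F L R)"
proof -
  obtain d f sy sx su where sy: "0 \<le> sy" "sy < \<mu>"
    and gains: "gain_le (\<lambda>z. cmat C ** matrix_inv (mat z - cmat A) ** (cmat B1 ** fir_eval d f z - cmat B2)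
               + (cmat D1 ** fir_eval d f z - cmat D2)) sy"
      "gain_le (\<lambda>z. matrix_inv (mat z - cmat A) ** (cmat B1 ** fir_eval d f z - cmat B2)) sx"
      "gain_le (fir_eval d f) su"
    using fir_filter_with_gain[OF assms] by blast
  \<comment> \<open>The gap between \<open>sy\<^sup>2\<close> and \<open>\<mu>\<^sup>2\<close> is shared out: less than half of it for the penalties, one quarter
    each for the margin \<open>\<theta>\<close> of the game and for the strictness of the final inequality.\<close>
  define \<Delta> where "\<Delta> = \<mu>\<^sup>2 - sy\<^sup>2"
  have \<Delta>: "0 < \<Delta>" using sy power_strict_mono[of sy \<mu> 2] by (simp add: \<Delta>_def)
  define e where "e = sqrt (\<Delta> / (4 * (sx\<^sup>2 + su\<^sup>2 + 1)))"
  have den: "0 < sx\<^sup>2 + su\<^sup>2 + 1" by (simp add: add_nonneg_pos)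
  have e: "0 < e" using \<Delta> den by (simp add: e_def)
  have e2: "e\<^sup>2 * (4 * (sx\<^sup>2 + su\<^sup>2 + 1)) = \<Delta>"
    using \<Delta> den by (simp add: e_def)
  have small: "e\<^sup>2 * (sx\<^sup>2 + su\<^sup>2) < \<Delta> / 2"
  proof -
    have "\<Delta> = 4 * (e\<^sup>2 * (sx\<^sup>2 + su\<^sup>2)) + 4 * e\<^sup>2" using e2 by (simp add: algebra_simps)
    moreover have "0 < e\<^sup>2" using e by simp
    ultimately show ?thesis using \<Delta> by linarith
  qed
  define g' where "g' = sqrt (sy\<^sup>2 + \<Delta> / 2)"
  define g where "g = sqrt (sy\<^sup>2 + 3 / 4 * \<Delta>)"
  have g'2: "g'\<^sup>2 = sy\<^sup>2 + \<Delta> / 2" and g2: "g\<^sup>2 = sy\<^sup>2 + 3 / 4 * \<Delta>"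
    using \<Delta> by (simp_all add: g'_def g_def)
  have g\<mu>: "g\<^sup>2 < \<mu>\<^sup>2" 
  proof -
    have "sy\<^sup>2 + \<Delta> = \<mu>\<^sup>2" by (simp add: \<Delta>_def)
    then show ?thesis unfolding g2 using \<Delta> by linarith
  qed
  have "sy\<^sup>2 + e\<^sup>2 * (sx\<^sup>2 + su\<^sup>2) < g'\<^sup>2" unfolding g'2 using small by simp
  from fir_cost_bound[OF A gains this] obtain c where c: "\<And>x0 w T. (\<Sum>t<T. stage_cost C D1 D2 e g'
      (trajectory A (\<lambda>t. B1 *v fir_response d f w t - B2 *v w t) x0 t) (w t) (fir_response d f w t))
      \<le> c * (norm x0)\<^sup>2" by blast
  have slack: "stage_cost C D1 D2 e g x w u = stage_cost C D1 D2 e g' x w u - \<Delta> / 4 * (norm w)\<^sup>2" for x w u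
    unfolding stage_cost_def g2 g'2 by (simp add: algebra_simps)
  have bound: "(\<Sum>t<T. stage_cost C D1 D2 e g
      (trajectory A (\<lambda>t. B1 *v fir_response d f w t - B2 *v w t) x0 t) (w t) (fir_response d f w t))
      \<le> c * (norm x0)\<^sup>2 - \<Delta> / 4 * (\<Sum>t<T. (norm (w t))\<^sup>2)" for x0 w T
    unfolding slack sum_subtractf sum_distrib_left[symmetric] by (rule diff_right_mono) (rule c)
  have "0 < \<Delta> / 4" using \<Delta> by simp
  from bounded_game_value[OF e this bound] obtain q k where q: "quadratic_form q"
      "\<And>x. e\<^sup>2 * (norm x)\<^sup>2 \<le> q x" and k: "linear k"
      "\<And>x w. game_payoff A B1 B2 C D1 D2 e g q x w (k (x, w)) \<le> q x + e\<^sup>2 / 2 * (norm x)\<^sup>2"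
    by blast
  obtain V where V: "symmetric_matrix V" "q = form V" using matrix_of_quadratic_form[OF q(1)] by blast
  obtain K R where KR: "\<And>x w. k (x, w) = K *v x + R *v w" using linear_on_pair_as_matrices[OF k(1)] by blast
  have Vpos: "0 < form V v" if "v \<noteq> 0" for v
  proof -
    have "0 < e\<^sup>2 * (norm v)\<^sup>2" using e that by simp
    then show ?thesis using q(2)[of v] unfolding V(2) by linarith
  qed
  have "\<exists>Z. symmetric_matrix Z \<and> (\<forall>v. v \<noteq> 0 \<longrightarrow> 0 < form Z v) \<and>
     (\<forall>g f. g \<noteq> 0 \<or> f \<noteq> 0 \<longrightarrow>
        form Z (transpose (A + B1 ** K) *v g + transpose (C + D1 ** K) *v f)
          + (norm (transpose (B1 ** R - B2) *v g + transpose (D1 ** R - D2) *v f))\<^sup>2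
          < form Z g + \<mu>\<^sup>2 * (norm f)\<^sup>2)"
  proof (rule dual_dissipation[OF V(1) Vpos \<mu>])
    fix x :: "real^'n" and w :: "real^'r" assume xw: "x \<noteq> 0 \<or> w \<noteq> 0"
    let ?u = "K *v x + R *v w"
    have y: "C *v x + D1 *v ?u - D2 *v w = (C + D1 ** K) *v x + (D1 ** R - D2) *v w"
      and x': "A *v x + (B1 *v ?u - B2 *v w) = (A + B1 ** K) *v x + (B1 ** R - B2) *v w"
      by (simp_all add: matrix_vector_right_distrib matrix_vector_mult_add_rdistrib
          matrix_vector_mult_diff_rdistrib matrix_vector_mul_assoc)
    have "(norm ((C + D1 ** K) *v x + (D1 ** R - D2) *v w))\<^sup>2 + e\<^sup>2 * (norm x)\<^sup>2 + e\<^sup>2 * (norm ?u)\<^sup>2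
        - g\<^sup>2 * (norm w)\<^sup>2 + form V ((A + B1 ** K) *v x + (B1 ** R - B2) *v w)
        \<le> form V x + e\<^sup>2 / 2 * (norm x)\<^sup>2"
      using k(2)[of x w] unfolding game_payoff_def stage_cost_def KR V(2) y x' .
    moreover have "0 \<le> e\<^sup>2 * (norm ?u)\<^sup>2" "e\<^sup>2 * (norm x)\<^sup>2 = 2 * (e\<^sup>2 / 2 * (norm x)\<^sup>2)"
      "0 \<le> e\<^sup>2 / 2 * (norm x)\<^sup>2" by simp_all
    moreover have "g\<^sup>2 * (norm w)\<^sup>2 - e\<^sup>2 / 2 * (norm x)\<^sup>2 < \<mu>\<^sup>2 * (norm w)\<^sup>2"
    proof (cases "x = 0")
      case True
      then show ?thesis using xw g\<mu> by simp
    next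
      case False
      then have "0 < e\<^sup>2 / 2 * (norm x)\<^sup>2" using e by simp
      moreover have "g\<^sup>2 * (norm w)\<^sup>2 \<le> \<mu>\<^sup>2 * (norm w)\<^sup>2" using g\<mu> by (intro mult_right_mono) auto
      ultimately show ?thesis by linarith
    qed
    ultimately show "(norm ((C + D1 ** K) *v x + (D1 ** R - D2) *v w))\<^sup>2
        + form V ((A + B1 ** K) *v x + (B1 ** R - B2) *v w) < form V x + \<mu>\<^sup>2 * (norm w)\<^sup>2"
      by linarith
  qed
  then obtain Z where Z: "symmetric_matrix Z" "\<And>v. v \<noteq> 0 \<Longrightarrow> 0 < form Z v"
    "\<And>g f. g \<noteq> 0 \<or> f \<noteq> 0 \<Longrightarrow>
        form Z (transpose (A + B1 ** K) *v g + transpose (C + D1 ** K) *v f)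
          + (norm (transpose (B1 ** R - B2) *v g + transpose (D1 ** R - D2) *v f))\<^sup>2
          < form Z g + \<mu>\<^sup>2 * (norm f)\<^sup>2" by blast
  from lmi_feasible_if_full_information[OF A Z] Z(1) show ?thesis by blast
qed

section \<open>Sufficiency of the matrix inequality\<close>

definition re_vec :: "complex^'n \<Rightarrow> real^'n" where "re_vec v = (\<chi> i. Re (v $ i))"
definition im_vec :: "complex^'n \<Rightarrow> real^'n" where "im_vec v = (\<chi> i. Im (v $ i))"

lemma re_im_vec_simps:
  "re_vec (v + w) = re_vec v + re_vec w" "im_vec (v + w) = im_vec v + im_vec w"
  "re_vec (v - w) = re_vec v - re_vec w" "im_vec (v - w) = im_vec v - im_vec w"
  "re_vec (cmat M *v v) = M *v re_vec v" "im_vec (cmat M *v v) = M *v im_vec v"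
  "re_vec 0 = 0" "im_vec 0 = 0"
  by (simp_all add: re_vec_def im_vec_def vec_eq_iff matrix_vector_mult_def Re_sum Im_sum)

lemma norm_re_im_vec:
  fixes v :: "complex^'n"
  shows "(norm v)\<^sup>2 = (norm (re_vec v))\<^sup>2 + (norm (im_vec v))\<^sup>2"
proof -
  have "(norm w)\<^sup>2 = (\<Sum>i\<in>UNIV. (w $ i)\<^sup>2)" for w :: "real^'n"
    unfolding norm_vec_def L2_set_def by (simp add: sum_nonneg)
  then show ?thesis
    by (simp add: norm_vec_power2 cmod_power2 re_vec_def im_vec_def sum.distrib)
qed

text \<open>
  The value of a symmetric real matrix on a complex vector, as a sum over real and imaginary part, so
  that inequalities between real forms carry over by addition.
\<close>

definition hermitian_form :: "real^'n^'n \<Rightarrow> complex^'n \<Rightarrow> real" where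
  "hermitian_form M v = form M (re_vec v) + form M (im_vec v)"

lemma hermitian_form_scale:
  assumes "symmetric_matrix M"
  shows "hermitian_form M (z *s v) = (cmod z)\<^sup>2 * hermitian_form M v"
proof -
  have r: "re_vec (z *s v) = Re z *\<^sub>R re_vec v - Im z *\<^sub>R im_vec v"
    and i: "im_vec (z *s v) = Re z *\<^sub>R im_vec v + Im z *\<^sub>R re_vec v"
    by (simp_all add: re_vec_def im_vec_def vec_eq_iff)
  have s: "form M (t *\<^sub>R w) = t\<^sup>2 * form M w" for t w
    by (simp add: form_def matrix_vector_mult_scaleR power2_eq_square)
  show ?thesis
    unfolding hermitian_form_def r i form_diff[OF assms] form_add[OF assms] s cmod_power2
    using inner_symmetric[OF assms, of "im_vec v" "re_vec v"]
    by (simp add: matrix_vector_mult_scaleR algebra_simps)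
qed

lemma hermitian_form_pos:
  assumes "\<And>v. v \<noteq> 0 \<Longrightarrow> 0 < form M v" "v \<noteq> 0"
  shows "0 < hermitian_form M v"
proof -
  have "re_vec v \<noteq> 0 \<or> im_vec v \<noteq> 0"
    using assms(2) norm_re_im_vec[of v] by auto
  moreover have "0 \<le> form M w" for w using assms(1)[of w] by (cases "w = 0") (auto simp: form_def)
  ultimately show ?thesis unfolding hermitian_form_def
    using assms(1) by (metis add_nonneg_pos add_pos_nonneg)
qed

lemma cmat_adjoint: "(cmat M *v x) \<bullet> y = x \<bullet> (cmat (transpose M) *v y)"
proof -
  have "conj_transpose (cmat M) = cmat (transpose M)"
    by (simp add: conj_transpose_def vec_eq_iff transpose_def)
  then show ?thesis by (simp add: conj_transpose_adjoint)
qed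

lemma resolvent_adjoint:
  "((mat z - cmat A) *v x) \<bullet> y = x \<bullet> ((mat (cnj z) - cmat (transpose A)) *v y)"
proof -
  have "conj_transpose (mat z - cmat A) = mat (cnj z) - cmat (transpose A)"
    by (simp add: conj_transpose_def vec_eq_iff transpose_def mat_def)
  then show ?thesis by (simp add: conj_transpose_adjoint)
qed

lemma dissipation_coercive:
  fixes A :: "real^'n^'n" and B1 :: "real^'m^'n" and B2 :: "real^'r^'n"
    and C :: "real^'n^'p" and D1 :: "real^'m^'p" and D2 :: "real^'r^'p"
    and W Z Ah :: "real^'n^'n" and F :: "real^'r^'n" and K :: "real^'n^'m" and R :: "real^'r^'m"
  assumes pos: "\<And>a b f. a \<noteq> 0 \<or> b \<noteq> 0 \<or> f \<noteq> 0 \<Longrightarrow> 0 < dissipation A B1 B2 C D1 D2 \<mu> W Z Ah F K R a b f"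
  shows "\<exists>\<delta>>0. \<forall>a b f. \<delta> * (norm f)\<^sup>2 \<le> dissipation A B1 B2 C D1 D2 \<mu> W Z Ah F K R a b f"
proof -
  let ?q = "\<lambda>p :: (real^'n) \<times> (real^'n) \<times> (real^'p).
      dissipation A B1 B2 C D1 D2 \<mu> W Z Ah F K R (fst p) (fst (snd p)) (snd (snd p))"
  have m: "linear (\<lambda>x. M *v g x)" if "linear g" for M :: "real^'k^'l" and g :: "_ \<Rightarrow> real^'k"
    using linear_compose[OF that matrix_vector_mul_linear[of M]] by (simp add: o_def)
  have f: "linear (\<lambda>p :: (real^'n) \<times> (real^'n) \<times> (real^'p). fst p)"
    "linear (\<lambda>p :: (real^'n) \<times> (real^'n) \<times> (real^'p). fst (snd p))"
    "linear (\<lambda>p :: (real^'n) \<times> (real^'n) \<times> (real^'p). snd (snd p))"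
    by (rule linearI; simp)+
  have "quadratic_form ?q"
    unfolding dissipation_def Let_def
    by (intro quadratic_form_diff quadratic_form_add quadratic_form_scale
        quadratic_form_compose[OF quadratic_form_form] quadratic_form_compose[OF quadratic_form_norm]
        linear_compose_add linear_compose_sub m f)
  moreover have "0 < ?q p" if "p \<noteq> 0" for p
    using that by (intro pos) (auto simp: prod_eq_iff)
  ultimately obtain \<delta> where \<delta>: "0 < \<delta>" "\<And>p. \<delta> * (norm p)\<^sup>2 \<le> ?q p"
    using positive_quadratic_form_coercive[of ?q] by blast
  have "\<delta> * (norm f)\<^sup>2 \<le> dissipation A B1 B2 C D1 D2 \<mu> W Z Ah F K R a b f" for a b f
  proof -
    have "(norm f)\<^sup>2 \<le> (norm (a, b, f))\<^sup>2" by (simp add: norm_Pair)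
    then have "\<delta> * (norm f)\<^sup>2 \<le> \<delta> * (norm (a, b, f))\<^sup>2" using \<delta>(1) by simp
    also have "\<dots> \<le> dissipation A B1 B2 C D1 D2 \<mu> W Z Ah F K R a b f" using \<delta>(2)[of "(a, b, f)"] by simp
    finally show ?thesis .
  qed
  with \<delta>(1) show ?thesis by blast
qed

text \<open>
  The costates \<open>a\<close> and \<open>b\<close> solve the adjoint equations of plant and filter at \<open>z\<close> for the output
  direction \<open>y\<close>. The storage at the next instant is then that at \<open>cnj z *s a\<close> and \<open>cnj z *s (a + b)\<close>,
  equal to the present one, and \<open>\<nu>\<close> is the adjoint of the closed loop applied to \<open>y\<close>. Since
  \<open>v \<bullet> \<nu> = y \<bullet> y\<close>, the bound on \<open>\<nu>\<close> gives the bound on \<open>y\<close>.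
\<close>

lemma frequency_response_bound:
  fixes A :: "real^'n^'n" and B1 :: "real^'m^'n" and B2 :: "real^'r^'n"
    and C :: "real^'n^'p" and D1 :: "real^'m^'p" and D2 :: "real^'r^'p"
    and W Z Ah :: "real^'n^'n" and F :: "real^'r^'n" and K :: "real^'n^'m" and R :: "real^'r^'m"
  assumes stable: "schur_stable A" "schur_stable Ah"
    and sym: "symmetric_matrix W" "symmetric_matrix Z"
    and diss: "\<And>a b f. \<delta> * (norm f)\<^sup>2 \<le> dissipation A B1 B2 C D1 D2 \<mu> W Z Ah F K R a b f"
    and z: "cmod z = 1"
    and \<xi>: "(mat z - cmat Ah) *v \<xi> = cmat F *v v" and u: "u = cmat K *v \<xi> + cmat R *v v"
    and x: "(mat z - cmat A) *v x = cmat B1 *v u - cmat B2 *v v"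
    and y: "y = cmat C *v x + cmat D1 *v u - cmat D2 *v v"
  shows "(norm y)\<^sup>2 \<le> max 0 (\<mu>\<^sup>2 - \<delta>) * (norm v)\<^sup>2"
proof -
  have inv: "invertible (mat (cnj z) - cmat (transpose A))" "invertible (mat (cnj z) - cmat (transpose Ah))"
    using schur_stable_resolvent[OF schur_stable_transpose[OF stable(1)], of "cnj z"]
      schur_stable_resolvent[OF schur_stable_transpose[OF stable(2)], of "cnj z"] z by simp_all
  define a where "a = matrix_inv (mat (cnj z) - cmat (transpose A)) *v (cmat (transpose C) *v y)"
  have a: "(mat (cnj z) - cmat (transpose A)) *v a = cmat (transpose C) *v y"
    unfolding a_def by (simp add: matrix_vector_mul_assoc matrix_mul_assoc matrix_inv_right[OF inv(1)])
  define \<beta> where "\<beta> = cmat (transpose B1) *v a + cmat (transpose D1) *v y"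
  define b where "b = matrix_inv (mat (cnj z) - cmat (transpose Ah)) *v (cmat (transpose K) *v \<beta>)"
  have b: "(mat (cnj z) - cmat (transpose Ah)) *v b = cmat (transpose K) *v \<beta>"
    unfolding b_def by (simp add: matrix_vector_mul_assoc matrix_mul_assoc matrix_inv_right[OF inv(2)])
  define \<alpha> where "\<alpha> = cmat (transpose A) *v a + cmat (transpose C) *v y"
  define \<eta> where "\<eta> = \<alpha> + cmat (transpose K) *v \<beta> + cmat (transpose Ah) *v b"
  define \<nu> where "\<nu> = cmat (transpose R) *v \<beta> - cmat (transpose B2) *v a - cmat (transpose D2) *v y
      + cmat (transpose F) *v b"
  have \<alpha>_eq: "\<alpha> = cnj z *s a"
    unfolding \<alpha>_def a[symmetric] by (simp add: matrix_vector_mult_diff_rdistrib mat_mult_vec)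
  have \<eta>_eq: "\<eta> = cnj z *s (a + b)"
    unfolding \<eta>_def \<alpha>_eq b[symmetric]
    by (simp add: matrix_vector_mult_diff_rdistrib mat_mult_vec vector_add_ldistrib)
  have "\<delta> * (norm y)\<^sup>2 \<le> hermitian_form W a + hermitian_form Z (a + b) + \<mu>\<^sup>2 * (norm y)\<^sup>2
      - hermitian_form W \<alpha> - hermitian_form Z \<eta> - (norm \<nu>)\<^sup>2"
    using add_mono[OF diss[of "re_vec y" "re_vec a" "re_vec b"] diss[of "im_vec y" "im_vec a" "im_vec b"]]
    unfolding dissipation_def Let_def norm_re_im_vec[of y] norm_re_im_vec[of \<nu>] hermitian_form_def
    unfolding \<alpha>_def \<eta>_def \<nu>_def \<beta>_def re_im_vec_simps
    by (simp add: distrib_left)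
  then have \<nu>: "(norm \<nu>)\<^sup>2 \<le> (\<mu>\<^sup>2 - \<delta>) * (norm y)\<^sup>2"
    unfolding \<alpha>_eq \<eta>_eq hermitian_form_scale[OF sym(1)] hermitian_form_scale[OF sym(2)]
    using z by (simp add: algebra_simps)
  have "v \<bullet> \<nu> = y \<bullet> y"
  proof -
    have "v \<bullet> \<nu> = (cmat R *v v) \<bullet> \<beta> - (cmat B2 *v v) \<bullet> a - (cmat D2 *v v) \<bullet> y + (cmat F *v v) \<bullet> b"
      unfolding \<nu>_def by (simp add: inner_add_right inner_diff_right cmat_adjoint)
    also have "(cmat F *v v) \<bullet> b = (cmat K *v \<xi>) \<bullet> \<beta>"
      unfolding \<xi>[symmetric] resolvent_adjoint b by (simp add: cmat_adjoint)
    also have "(cmat R *v v) \<bullet> \<beta> - (cmat B2 *v v) \<bullet> a - (cmat D2 *v v) \<bullet> y + (cmat K *v \<xi>) \<bullet> \<beta>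
        = u \<bullet> \<beta> - (cmat B2 *v v) \<bullet> a - (cmat D2 *v v) \<bullet> y"
      by (simp add: u inner_add_left)
    also have "u \<bullet> \<beta> = (cmat B1 *v u) \<bullet> a + (cmat D1 *v u) \<bullet> y"
      unfolding \<beta>_def by (simp add: inner_add_right cmat_adjoint)
    also have "(cmat B1 *v u) \<bullet> a + (cmat D1 *v u) \<bullet> y - (cmat B2 *v v) \<bullet> a - (cmat D2 *v v) \<bullet> y
        = ((mat z - cmat A) *v x) \<bullet> a + (cmat D1 *v u) \<bullet> y - (cmat D2 *v v) \<bullet> y"
      unfolding x by (simp add: inner_diff_left)
    also have "((mat z - cmat A) *v x) \<bullet> a = (cmat C *v x) \<bullet> y"
      unfolding resolvent_adjoint a by (simp add: cmat_adjoint)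
    also have "(cmat C *v x) \<bullet> y + (cmat D1 *v u) \<bullet> y - (cmat D2 *v v) \<bullet> y = y \<bullet> y"
      by (subst (4) y) (simp add: inner_add_left inner_diff_left)
    finally show ?thesis .
  qed
  then have "(norm y)\<^sup>2 \<le> norm v * norm \<nu>"
    using norm_cauchy_schwarz[of v \<nu>] by (simp add: power2_norm_eq_inner)
  then have "((norm y)\<^sup>2)\<^sup>2 \<le> (norm v * norm \<nu>)\<^sup>2" by (intro power_mono) auto
  also have "\<dots> \<le> (norm v)\<^sup>2 * ((\<mu>\<^sup>2 - \<delta>) * (norm y)\<^sup>2)"
    unfolding power_mult_distrib using \<nu> by (intro mult_left_mono) auto
  finally have main: "(norm y)\<^sup>2 * (norm y)\<^sup>2 \<le> ((\<mu>\<^sup>2 - \<delta>) * (norm v)\<^sup>2) * (norm y)\<^sup>2"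
    by (simp add: power2_eq_square[of "(norm y)\<^sup>2"] ac_simps)
  show ?thesis
  proof (cases "y = 0")
    case False
    then have "(norm y)\<^sup>2 \<le> (\<mu>\<^sup>2 - \<delta>) * (norm v)\<^sup>2"
      by (intro mult_right_le_imp_le[OF main]) simp
    also have "\<dots> \<le> max 0 (\<mu>\<^sup>2 - \<delta>) * (norm v)\<^sup>2" by (intro mult_right_mono) auto
    finally show ?thesis .
  qed simp
qed

lemma cmat_mult: "cmat (M ** N) = cmat M ** cmat N"
  by (simp add: vec_eq_iff matrix_matrix_mult_def)

lemma cmat_mat_1: "cmat (mat 1) = mat 1"
  by (simp add: vec_eq_iff mat_def)

text \<open>
  An eigenvector of the transpose for the eigenvalue \<open>z\<close> has its storage multiplied by
  \<open>(cmod z)\<^sup>2\<close>.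
\<close>

lemma schur_stable_if_dissipative:
  assumes sym: "symmetric_matrix Z" and pos: "\<And>v. v \<noteq> 0 \<Longrightarrow> 0 < form Z v"
    and decrease: "\<And>v. v \<noteq> 0 \<Longrightarrow> form Z (transpose Ah *v v) < form Z v"
  shows "schur_stable Ah"
proof -
  have "schur_stable (transpose Ah)"
    unfolding schur_stable_def
  proof (intro allI impI)
    fix z v assume v: "v \<noteq> 0 \<and> cmat (transpose Ah) *v v = z *s v"
    have nn: "form Z (transpose Ah *v w) \<le> form Z w" for w
      using decrease[of w] by (cases "w = 0") (auto simp: form_def)
    have "re_vec v \<noteq> 0 \<or> im_vec v \<noteq> 0"
      using v norm_re_im_vec[of v] by auto
    then have "form Z (transpose Ah *v re_vec v) + form Z (transpose Ah *v im_vec v)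
        < form Z (re_vec v) + form Z (im_vec v)"
      using decrease nn by (metis add_less_le_mono add_le_less_mono)
    then have "hermitian_form Z (z *s v) < hermitian_form Z v"
      unfolding hermitian_form_def v[THEN conjunct2, symmetric] re_im_vec_simps .
    then have "(cmod z)\<^sup>2 * hermitian_form Z v < 1 * hermitian_form Z v"
      unfolding hermitian_form_scale[OF sym] by simp
    moreover have "0 < hermitian_form Z v" using hermitian_form_pos[OF pos] v by blast
    ultimately have "(cmod z)\<^sup>2 < 1" by (simp only: mult_less_cancel_right_pos)
    then show "cmod z < 1" by (simp add: power_less_one_iff abs_square_less_1)
  qed
  from schur_stable_transpose[OF this] show ?thesis by simp
qed

lemma schur_stable_similar:
  assumes A: "schur_stable A" and T: "invertible T"
  shows "schur_stable (T ** A ** matrix_inv T)"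
  unfolding schur_stable_def
proof (intro allI impI)
  fix z v assume v: "v \<noteq> 0 \<and> cmat (T ** A ** matrix_inv T) *v v = z *s v"
  let ?w = "cmat (matrix_inv T) *v v"
  have inv: "cmat (matrix_inv T) ** cmat T = mat 1" "cmat T ** cmat (matrix_inv T) = mat 1"
    by (simp_all add: cmat_mat_1 matrix_inv_left[OF T] matrix_inv_right[OF T] flip: cmat_mult)
  have "cmat A *v ?w = (cmat (matrix_inv T) ** cmat T) *v (cmat A *v ?w)" by (simp add: inv)
  also have "\<dots> = cmat (matrix_inv T) *v (cmat (T ** A ** matrix_inv T) *v v)"
    by (simp add: cmat_mult matrix_vector_mul_assoc matrix_mul_assoc)
  also have "\<dots> = z *s ?w" using v by (simp add: vector_scalar_commute)
  finally have "cmat A *v ?w = z *s ?w" .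
  moreover have "?w \<noteq> 0"
  proof
    assume "?w = 0"
    then have "cmat T *v ?w = 0" by simp
    then have "v = 0" by (simp add: matrix_vector_mul_assoc inv)
    with v show False by simp
  qed
  ultimately show "cmod z < 1" using A unfolding schur_stable_def by blast
qed

text \<open>
  With \<open>T = U\<^sup>T Z\<^sup>-\<^sup>1\<close> the realization is that of the filter \<open>(Q Z\<^sup>-\<^sup>1, F, L Z\<^sup>-\<^sup>1, R)\<close> in the coordinates
  \<open>T \<xi>\<close>, since \<open>T\<^sup>-\<^sup>1 = Z (U\<^sup>-\<^sup>1)\<^sup>T\<close>.
\<close>

lemma filter_from_lmi:
  fixes A :: "real^'n^'n" and B1 :: "real^'m^'n" and B2 :: "real^'r^'n"
    and C :: "real^'n^'p" and D1 :: "real^'m^'p" and D2 :: "real^'r^'p"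
    and X Z Q U :: "real^'n^'n" and F :: "real^'r^'n" and L :: "real^'n^'m" and R :: "real^'r^'m"
  assumes \<mu>: "0 < \<mu>" and A: "schur_stable A"
    and sym: "symmetric_matrix X" "symmetric_matrix Z"
    and lmi: "pos_def (filter_lmi A B1 B2 C D1 D2 \<mu> X Z Q F L R)" and U: "invertible U"
    and Ah: "Ah = transpose U ** matrix_inv Z ** Q ** transpose (matrix_inv U)"
    and Bh: "Bh = transpose U ** matrix_inv Z ** F"
    and Ch: "Ch = L ** transpose (matrix_inv U)"
  shows "schur_stable Ah \<and> hinf_norm (transfer_matrix A B1 C D1 ** transfer_matrix Ah Bh Ch R
      - transfer_matrix A B2 C D2) < \<mu>"
proof -
  have sq: "x \<bullet> (filter_lmi A B1 B2 C D1 D2 \<mu> X Z Q F L R *v x) > 0" if "x \<noteq> 0" for x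
    using lmi that by (simp add: pos_def_def)
  have Zpos0: "0 < form Z v" if "v \<noteq> 0" for v
  proof -
    let ?x = "0 \<frown> 0 \<frown> 0 \<frown> v \<frown> 0 \<frown> 0 :: real^('n + 'n + 'n + 'n + 'r + 'p)"
    have "?x \<noteq> 0" using that by (simp add: stack_eq_0_iff)
    from sq[OF this] show ?thesis
      unfolding filter_lmi_form[OF sym] by (simp add: form_def)
  qed
  have Zi: "invertible Z" by (rule form_pos_invertible[OF Zpos0])
  define K where "K = L ** matrix_inv Z"
  define Ao where "Ao = Q ** matrix_inv Z"
  have LQ: "L = K ** Z" "Q = Ao ** Z"
    unfolding K_def Ao_def by (simp_all add: matrix_inv_left[OF Zi] flip: matrix_mul_assoc)
  note nec = filter_lmi_necessary[OF sym lmi[unfolded LQ]]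
  have Wsym: "symmetric_matrix (X - Z)" using sym by (simp add: symmetric_matrix_def transpose_diff)
  obtain \<delta> where \<delta>: "0 < \<delta>"
    "\<And>a b f. \<delta> * (norm f)\<^sup>2 \<le> dissipation A B1 B2 C D1 D2 \<mu> (X - Z) Z Ao F K R a b f"
    using dissipation_coercive[OF nec(3)] by blast
  have Ao: "schur_stable Ao"
  proof (rule schur_stable_if_dissipative[OF sym(2) Zpos0])
    fix v :: "real^'n" assume "v \<noteq> 0"
    then have "0 < dissipation A B1 B2 C D1 D2 \<mu> (X - Z) Z Ao F K R 0 v 0" by (intro nec(3)) auto
    then have "0 < form Z v - form Z (transpose Ao *v v) - (norm (transpose F *v v))\<^sup>2"
      by (simp add: dissipation_def form_def)
    moreover have "0 \<le> (norm (transpose F *v v))\<^sup>2" by simp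
    ultimately show "form Z (transpose Ao *v v) < form Z v" by linarith
  qed
  define T where "T = transpose U ** matrix_inv Z"
  have Ti: "T ** (Z ** transpose (matrix_inv U)) = mat 1"
  proof -
    have "T ** (Z ** transpose (matrix_inv U)) = transpose U ** (matrix_inv Z ** Z) ** transpose (matrix_inv U)"
      by (simp add: T_def matrix_mul_assoc)
    also have "\<dots> = transpose (matrix_inv U ** U)"
      by (simp add: matrix_inv_left[OF Zi] matrix_transpose_mul)
    finally show ?thesis by (simp add: matrix_inv_left[OF U])
  qed
  have T: "invertible T" using Ti by (auto simp: invertible_right_inverse)
  have Tinv: "matrix_inv T = Z ** transpose (matrix_inv U)" by (rule matrix_inv_unique[OF Ti])
  have Ah': "Ah = T ** Ao ** matrix_inv T"
    unfolding Tinv unfolding Ah T_def LQ(2) by (simp add: matrix_mul_assoc)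
  have Bh': "Bh = T ** F" unfolding Bh T_def ..
  have Ch': "Ch = K ** matrix_inv T" unfolding Tinv unfolding Ch LQ(1) by (simp add: matrix_mul_assoc)
  have stable: "schur_stable Ah" unfolding Ah' by (rule schur_stable_similar[OF Ao T])
  let ?G = "transfer_matrix Ah Bh Ch R"
  define s where "s = sqrt (max 0 (\<mu>\<^sup>2 - \<delta>))"
  have "s < sqrt (\<mu>\<^sup>2)" unfolding s_def using \<mu> \<delta>(1) by (intro real_sqrt_less_mono) simp
  then have s: "s < \<mu>" using \<mu> by simp
  have G: "?G \<in> RH_inf" by (rule transfer_matrix_RH_inf[OF stable])
  have "gain_le (tm_eval (transfer_matrix A B1 C D1 ** ?G - transfer_matrix A B2 C D2)) s"
    unfolding gain_le_def
  proof (intro allI impI)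
    fix z and v :: "complex^'r" assume z: "cmod z = 1"
    have inv: "invertible (mat z - cmat A)" "invertible (mat z - cmat Ah)"
      using schur_stable_resolvent[OF A] schur_stable_resolvent[OF stable] z by simp_all
    define \<xi>h where "\<xi>h = matrix_inv (mat z - cmat Ah) *v (cmat Bh *v v)"
    define \<xi> where "\<xi> = cmat (matrix_inv T) *v \<xi>h"
    define u where "u = tm_eval ?G z *v v"
    define x where "x = matrix_inv (mat z - cmat A) *v (cmat B1 *v u - cmat B2 *v v)"
    define y where "y = tm_eval (transfer_matrix A B1 C D1 ** ?G - transfer_matrix A B2 C D2) z *v v"
    have cT: "cmat (matrix_inv T) ** cmat T = mat 1"
      by (simp add: cmat_mat_1 matrix_inv_left[OF T] flip: cmat_mult)
    have \<xi>h: "(mat z - cmat Ah) *v \<xi>h = cmat Bh *v v"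
      unfolding \<xi>h_def by (simp add: matrix_vector_mul_assoc matrix_mul_assoc matrix_inv_right[OF inv(2)])
    have "(mat z - cmat Ao) *v \<xi> = cmat (matrix_inv T) *v ((mat z - cmat Ah) *v \<xi>h)"
    proof -
      have "cmat (matrix_inv T) *v (cmat Ah *v \<xi>h)
          = (cmat (matrix_inv T) ** cmat T) *v (cmat Ao *v \<xi>)"
        unfolding Ah' \<xi>_def by (simp add: cmat_mult matrix_vector_mul_assoc matrix_mul_assoc)
      then show ?thesis
        by (simp add: cT matrix_vector_mult_diff_rdistrib matrix_vector_mult_diff_distrib
            mat_mult_vec vector_scalar_commute \<xi>_def)
    qed
    also have "\<dots> = cmat F *v v"
      unfolding \<xi>h Bh' cmat_mult by (simp add: matrix_vector_mul_assoc matrix_mul_assoc cT)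
    finally have \<xi>: "(mat z - cmat Ao) *v \<xi> = cmat F *v v" .
    have u: "u = cmat K *v \<xi> + cmat R *v v"
      using z unfolding u_def \<xi>_def \<xi>h_def
      by (simp add: tm_eval_transfer_matrix[OF stable] Ch' cmat_mult matrix_vector_mult_add_rdistrib
          flip: matrix_vector_mul_assoc)
    have x: "(mat z - cmat A) *v x = cmat B1 *v u - cmat B2 *v v"
      unfolding x_def by (simp add: matrix_vector_mul_assoc matrix_inv_right[OF inv(1)])
    have y: "y = cmat C *v x + cmat D1 *v u - cmat D2 *v v"
      unfolding y_def x_def u_def by (rule tm_eval_mismatch_mult[OF A G z])
    have "(norm y)\<^sup>2 \<le> max 0 (\<mu>\<^sup>2 - \<delta>) * (norm v)\<^sup>2"
      by (rule frequency_response_bound[OF A Ao Wsym sym(2) \<delta>(2) z \<xi> u x y])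
    also have "\<dots> = (s * norm v)\<^sup>2" by (simp add: s_def power_mult_distrib)
    finally show "norm (tm_eval (transfer_matrix A B1 C D1 ** ?G - transfer_matrix A B2 C D2) z *v v)
        \<le> s * norm v"
      unfolding y_def by (rule power2_le_imp_le) (simp add: s_def)
  qed
  from hinf_norm_le[OF this] s stable show ?thesis by simp
qed

theorem theorem3:
  fixes \<mu> :: real
    and P1 :: "ratfun^'m^'p" and P2 :: "ratfun^'r^'p"
    and A :: "real^'n^'n" and B1 :: "real^'m^'n" and B2 :: "real^'r^'n"
    and C :: "real^'n^'p" and D1 :: "real^'m^'p" and D2 :: "real^'r^'p"
  assumes "\<mu> > 0"
    and "P1 \<in> RH_inf" and "P2 \<in> RH_inf"
    and "stable_realization A B1 C D1 P1"
    and "stable_realization A B2 C D2 P2"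
  shows
    "((\<exists>Fz :: ratfun^'r^'m. Fz \<in> RH_inf \<and> hinf_norm (P1 ** Fz - P2) < \<mu>)
      \<longleftrightarrow>
      (\<exists>(X :: real^'n^'n) (Z :: real^'n^'n) (Q :: real^'n^'n)
         (F :: real^'r^'n) (L :: real^'n^'m) (R :: real^'r^'m).
         symmetric_matrix X \<and> symmetric_matrix Z \<and>
         pos_def (filter_lmi A B1 B2 C D1 D2 \<mu> X Z Q F L R)))
     \<and>
     (\<forall>(X :: real^'n^'n) (Z :: real^'n^'n) (Q :: real^'n^'n)
        (F :: real^'r^'n) (L :: real^'n^'m) (R :: real^'r^'m) (U :: real^'n^'n)
        (Ah :: real^'n^'n) (Bh :: real^'r^'n) (Ch :: real^'n^'m) (Dh :: real^'r^'m).
        symmetric_matrix X \<longrightarrow> symmetric_matrix Z \<longrightarrow>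
        pos_def (filter_lmi A B1 B2 C D1 D2 \<mu> X Z Q F L R) \<longrightarrow>
        invertible U \<longrightarrow>
        (((Ah ||| Bh) === (Ch ||| Dh)) =
           ((transpose U ** matrix_inv Z ||| 0) === (0 ||| mat 1)) **
           ((Q ||| F) === (L ||| R)) **
           transpose ((matrix_inv U ||| 0) === (0 ||| mat 1))) \<longrightarrow>
        (\<exists>Fz. Fz \<in> RH_inf \<and> stable_realization Ah Bh Ch Dh Fz \<and>
              hinf_norm (P1 ** Fz - P2) < \<mu>))"
proof (intro conjI iffI allI impI, goal_cases)
  have A: "schur_stable A" and P1: "P1 = transfer_matrix A B1 C D1"
    and P2: "P2 = transfer_matrix A B2 C D2"
    using assms(4,5) by (simp_all add: stable_realization_def)
  note construct = filter_from_lmi[OF assms(1) A, of _ _ B1 B2 C D1 D2, folded P1 P2]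
  {
    case 1
    then show ?case unfolding P1 P2 using lmi_feasible_if_filter_exists[OF assms(1) A] by blast
  next
    case 2
    then obtain X Z Q :: "real^'n^'n" and F :: "real^'r^'n" and L :: "real^'n^'m" and R :: "real^'r^'m"
      where lmi: "symmetric_matrix X" "symmetric_matrix Z"
        "pos_def (filter_lmi A B1 B2 C D1 D2 \<mu> X Z Q F L R)" by blast
    have "invertible (mat 1 :: real^'n^'n)" by (simp add: invertible_det_nz)
    from construct[OF lmi this refl refl refl] transfer_matrix_RH_inf show ?case by blast
  next
    case (3 X Z Q F L R U Ah Bh Ch Dh)
    have t0: "transpose 0 = (0 :: real^'n^'r)" "transpose 0 = (0 :: real^'r^'n)"
      by (simp_all add: transpose_def vec_eq_iff)
    have "Ah = transpose U ** matrix_inv Z ** Q ** transpose (matrix_inv U)"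
      "Bh = transpose U ** matrix_inv Z ** F" "Ch = L ** transpose (matrix_inv U)" "Dh = R"
      using 3(5) unfolding block_mult block_transpose block_eq_iff by (simp_all add: t0)
    with construct[OF 3(1-4)] transfer_matrix_RH_inf show ?case
      unfolding stable_realization_def by blast
  }
qed

end
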